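(* Let $n$ be a positive integer with prime factorization $n = \prod_{i=1}^r p_i^{\alpha_i}$, where $p_1,\ldots,p_r$ are distinct primes and each $\alpha_i\ge 1$. Let $G(n)$ denote the number of isomorphism classes of finite groups of order $n$. (1) $G(n) = 2$ if and only if one of the following holds: (a) $r = 1$ and $\alpha_1 = 2$; (b) $r \geq 2$, $n$ is square-free, and there is a unique pair $(i,j)$ such that $p_i \mid p_j - 1$; (c) $r\ge 2$ and, for a suitable labelling of the primes, $n = p_1^2p_2\cdots p_r$, where $p_i \nmid p_j - 1$ for all $i, j$ with $1 \leq i,j \leq r$, and $p_k \nmid p_1^2 - 1$ for each $k$ with $2 \leq k \leq r$. (2) $G(n) = 3$ if and only if one of the following holds: (a) $r \geq 3$, $n$ is square-free, and there is a unique triple $(i,j,l)$ such that $p_i \mid p_j - 1$ and $p_j \mid p_l - 1$; (b) $r\ge 2$ and, for a suitable labelling of the primes, $n = p_1^2p_2\cdots p_r$, where $p_i \nmid p_j - 1$ for all $i, j$ with $1 \leq i,j \leq r$, and there exists a unique positive integer $l$ with $2 \leq l \leq r$ such that $p_l \mid p_1^2 - 1$.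
   Context: $G(n)$ denotes the number of non-isomorphic finite groups of order $n$, i.e. the number of isomorphism classes of groups with exactly $n$ elements. The primes $p_1,\ldots,p_r$ are distinct and in no particular order; indices $i,j,l$ in pairs and triples range over $\{1,\ldots,r\}$.
   Formalization: In (2)(a) it is added that the chain's two divisibilities are the only relations p_a | p_b - 1 among the primes; as stated the clause fails for n = 42 = 2·3·7, which has the unique triple (2,3,7) but also 2 | 7-1, and G(42) = 6. *)

theory Defs
  imports "HOL-Algebra.Algebra" "HOL-Computational_Algebra.Squarefree"
begin

text \<open>
  Groups are taken with carrier in \<^typ>\<open>nat\<close>, so that the groups of order \<open>n\<close> form a set.
  Every finite group, over any type, has an isomorphic copy of this kind
  (lemma \<open>finite_group_copy\<close> below), so no isomorphism class is lost.
\<close>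

definition groups_of_order :: "nat \<Rightarrow> nat monoid set" where
  "groups_of_order n = {G. group G \<and> finite (carrier G) \<and> order G = n}"

definition group_iso_rel :: "nat \<Rightarrow> (nat monoid \<times> nat monoid) set" where
  "group_iso_rel n = {(G, H). G \<in> groups_of_order n \<and> H \<in> groups_of_order n \<and> G \<cong> H}"

definition num_groups :: "nat \<Rightarrow> nat" where
  "num_groups n = card (groups_of_order n // group_iso_rel n)"

lemma equiv_group_iso_rel: "equiv (groups_of_order n) (group_iso_rel n)"
proof (rule equivI)
  show "group_iso_rel n \<subseteq> groups_of_order n \<times> groups_of_order n"
    by (auto simp: group_iso_rel_def)
  show "refl_on (groups_of_order n) (group_iso_rel n)"
    by (auto simp: group_iso_rel_def refl_on_def)
  show "sym (group_iso_rel n)"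
    by (auto simp: group_iso_rel_def sym_def groups_of_order_def intro: group.iso_sym)
  show "trans (group_iso_rel n)"
    by (auto simp: group_iso_rel_def trans_def intro: iso_trans)
qed

lemma finite_group_copy:
  fixes H :: "('a, 'b) monoid_scheme"
  assumes "group H" and fin: "finite (carrier H)"
  shows "\<exists>G \<in> groups_of_order (order H). carrier G = {..<order H} \<and> H \<cong> G"
proof -
  interpret H: group H by fact
  obtain f where f: "bij_betw f (carrier H) {..<order H}"
    using ex_bij_betw_finite_nat[OF fin] by (auto simp: order_def atLeast0LessThan)
  define g where "g = inv_into (carrier H) f"
  have g: "g x \<in> carrier H" "f (g x) = x" if "x < order H" for x
    using that f bij_betw_inv_into_right[OF f, of x] bij_betwE[OF bij_betw_inv_into[OF f]]
    by (auto simp: g_def)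
  have gf: "g (f x) = x" "f x < order H" if "x \<in> carrier H" for x
    using that f bij_betw_inv_into_left[OF f, of x] bij_betwE[OF f] by (auto simp: g_def)
  define G :: "nat monoid" where
    "G = \<lparr>carrier = {..<order H}, monoid.mult = (\<lambda>x y. f (g x \<otimes>\<^bsub>H\<^esub> g y)), one = f \<one>\<^bsub>H\<^esub>\<rparr>"
  have "group G"
  proof (rule groupI)
    fix x assume x: "x \<in> carrier G"
    then have "f (inv\<^bsub>H\<^esub> (g x)) \<in> carrier G"
      and "f (inv\<^bsub>H\<^esub> (g x)) \<otimes>\<^bsub>G\<^esub> x = \<one>\<^bsub>G\<^esub>"
      by (simp_all add: G_def g gf)
    then show "\<exists>y\<in>carrier G. y \<otimes>\<^bsub>G\<^esub> x = \<one>\<^bsub>G\<^esub>" by blast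
  qed (simp_all add: G_def g gf H.m_assoc)
  moreover have "order G = order H" by (simp add: G_def order_def)
  moreover have "f \<in> iso H G"
    using f by (auto simp: iso_def hom_def G_def gf)
  ultimately show ?thesis
    by (intro bexI[of _ G]) (auto simp: groups_of_order_def is_iso_def G_def)
qed

end

theory Submission
  imports "HOL-Computational_Algebra.Polynomial" Defs "HOL-Number_Theory.Number_Theory"
begin

text \<open>
  Call a pair of primes \<open>q, p\<close> dividing \<open>n\<close> with \<open>q dvd p - 1\<close> an edge \<open>q \<rightarrow> p\<close>. If \<open>p\<close> divides
  \<open>n\<close> exactly once and no edge ends in \<open>p\<close>, a Sylow \<open>p\<close>-subgroup is central in its normalizer, and
  transfer (Burnside) yields a normal subgroup of index \<open>p\<close>. Intersecting these subgroups writes a group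
  of order \<open>n\<close> as \<open>K \<rtimes> \<langle>y\<rangle>\<close> with \<open>|K|\<close> and the order of \<open>y\<close> coprime, where \<open>K\<close> is trivial, of prime
  order or of order \<open>p\<^sup>2\<close> in every case with at most three groups. The action of \<open>y\<close> on \<open>K\<close> is then
  determined up to replacing \<open>y\<close> by a power: for \<open>|K|\<close> prime because the roots of unity of prime order mod
  \<open>p\<close> are powers of each other; for \<open>K\<close> elementary abelian of order \<open>p\<^sup>2\<close> because the action has
  determinant \<open>1\<close> and prime order \<open>l = 2h + 1\<close>, so its trace is a root mod \<open>p\<close> of a monic polynomial of
  degree \<open>h\<close>, and the traces of its first \<open>h\<close> powers already give \<open>h\<close> distinct roots.

  In all remaining cases four groups are separated by commutativity, by the exponent, and by which
  primes \<open>t\<close> have all elements \<open>x\<close> with \<open>x\<^sup>t = 1\<close> central. They are semidirect products of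
  \<open>\<int>/a\<close> or \<open>(\<int>/p)\<^sup>2\<close> with a cyclic group; an automorphism of \<open>(\<int>/p)\<^sup>2\<close> of prime order
  \<open>l dvd p\<^sup>2 - 1\<close> is multiplication by an element of order \<open>l\<close> in the field with \<open>p\<^sup>2\<close> elements.
  An infinite number of isomorphism classes need not be excluded separately: \<open>card\<close> would then be \<open>0\<close>.
\<close>


subsection \<open>Transfer\<close>

text \<open>An element normalizing a subgroup of prime order \<open>t\<close> acts on it by an
  exponent that is a root of unity modulo \<open>t\<close> of order dividing both \<open>n\<close>
  and \<open>t - 1\<close>; without an edge into \<open>t\<close> this exponent is 1, which is the
  fusion condition of the transfer. Every target of an edge therefore needs its own argument. On a
  path \<open>q -> p -> s\<close> there are two targets, and one of them always yields: if the Sylow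
  subgroup of \<open>s\<close> is central, the fusion condition holds for \<open>s\<close> anyway;
  if not, its centralizer is normal of index \<open>p\<close>. One prime then remains in the kernel,
  and the two cases separate the two nonabelian classes.

  Normal subgroups of coprime index are described as solution sets of \<open>x^d = 1\<close>, so
  they are canonical and survive conjugation and isomorphism. Eigenvalues outside the prime field
  are avoided: the identities for traces are multiplicative recurrences inside the kernel. Counting
  uses a numerical code computed from isomorphism invariants; an exact count needs the code to
  determine the class, an excluded order only needs four attained values.\<close>

lemma funpow_fixed_coprime:
  assumes a: "(f ^^ a) x = x" and b: "(f ^^ b) x = x" and "coprime a b"
  shows "f x = x"
proof -
  have fix_mult: "(f ^^ (c * k)) x = x" if "(f ^^ c) x = x" for c k :: nat
    using that by (induction k) (simp_all add: funpow_add)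
  show ?thesis
  proof (cases "a = 0")
    case True
    then show ?thesis using b \<open>coprime a b\<close> by simp
  next
    case False
    then obtain u v where uv: "a * u = b * v + 1"
      using bezout_nat[of a b] \<open>coprime a b\<close> by auto
    have "x = (f ^^ (a * u)) x"
      using fix_mult[OF a] by simp
    also have "\<dots> = f x"
      using fix_mult[OF b] by (simp add: uv)
    finally show ?thesis by simp
  qed
qed

text \<open>Since \<open>t\<close> is prime, a point not fixed by \<open>f\<close> has an orbit of
  exactly \<open>t\<close> points, and the last assumption lets that orbit drop out of the sum; the
  induction removes one orbit at a time. The weight \<open>s\<close> is there for the transfer,
  where the orbit sums telescope.\<close>

lemma sum_fixpoints_cong:
  fixes s :: "'x \<Rightarrow> int"
  assumes t: "Factorial_Ring.prime t" and "finite A" and "f ` A \<subseteq> A"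
    and "\<And>x. x \<in> A \<Longrightarrow> (f ^^ t) x = x"
    and "\<And>x. x \<in> A \<Longrightarrow> f x \<noteq> x \<Longrightarrow> [(\<Sum>i<t. s ((f ^^ i) x)) = 0] (mod int t)"
  shows "[(\<Sum>x\<in>A. s x) = (\<Sum>x\<in>{x \<in> A. f x = x}. s x)] (mod int t)"
  using assms(2-)
proof (induction A rule: finite_psubset_induct)
  case (psubset A)
  show ?case
  proof (cases "\<exists>x\<in>A. f x \<noteq> x")
    case False
    then have "{x \<in> A. f x = x} = A" by auto
    then show ?thesis by simp
  next
    case True
    then obtain x where x: "x \<in> A" "f x \<noteq> x" by blast
    define orb where "orb = (\<lambda>i. (f ^^ i) x) ` {..<t}"
    have t0: "t > 0" using t by (simp add: prime_gt_0_nat)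
    have iter_in: "(f ^^ i) y \<in> A" if "y \<in> A" for i y
      using that psubset.prems(1) by (induction i) auto
    have per: "(f ^^ t) x = x" using psubset.prems(2) x by blast
    have orbI: "(f ^^ i) x \<in> orb" for i
      unfolding orb_def
      by (rule image_eqI[of _ _ "i mod t"]) (simp_all add: funpow_mod_eq[OF per] t0)
    have orb_sub: "orb \<subseteq> A" unfolding orb_def using iter_in x by blast
    have diff: "(f ^^ (j - i)) x = x" if "i < j" "j < t" "(f ^^ i) x = (f ^^ j) x" for i j
    proof -
      have "(f ^^ (t - i)) ((f ^^ i) x) = (f ^^ (t - i)) ((f ^^ j) x)"
        using that by simp
      then have "(f ^^ (t - i + i)) x = (f ^^ (t - i + j)) x"
        by (simp add: funpow_add)
      moreover have "t - i + j = (j - i) + t" "t - i + i = t" using that by simp_all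
      ultimately have "(f ^^ t) x = (f ^^ (j - i)) ((f ^^ t) x)"
        by (simp only: funpow_add o_apply)
      then show ?thesis using per by simp
    qed
    \<comment> \<open>A repetition among the first \<open>t\<close> iterates would give a period
      \<open>j - i\<close> prime to \<open>t\<close>, hence a fixed point.\<close>
    have no_coll: "(f ^^ i) x \<noteq> (f ^^ j) x" if "i < j" "j < t" for i j
    proof
      assume "(f ^^ i) x = (f ^^ j) x"
      then have "(f ^^ (j - i)) x = x" using diff that by blast
      moreover have "coprime (j - i) t"
        using t that by (metis coprime_commute diff_le_self dual_order.strict_trans1
            linorder_not_less nat_dvd_not_less prime_imp_coprime zero_less_diff)
      ultimately show False using funpow_fixed_coprime[of "j - i" f x t] per x by blast
    qed
    have inj: "inj_on (\<lambda>i. (f ^^ i) x) {..<t}"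
      by (rule inj_onI) (metis lessThan_iff linorder_neqE_nat no_coll)
    have "f y \<noteq> y" if "y \<in> orb" for y
    proof
      assume fy: "f y = y"
      from that obtain i where i: "i < t" "y = (f ^^ i) x" unfolding orb_def by auto
      have "(f ^^ k) y = y" for k using fy by (induction k) auto
      then have "(f ^^ (t - i + i)) x = y" by (simp add: funpow_add i(2))
      then have "x = y" using i per by simp
      then show False using fy x by simp
    qed
    then have fixeq: "{z \<in> A. f z = z} = {z \<in> A - orb. f z = z}"
      by blast
    have closed: "f ` (A - orb) \<subseteq> A - orb"
    proof
      fix z assume "z \<in> f ` (A - orb)"
      then obtain y where y: "y \<in> A" "y \<notin> orb" "z = f y" by blast
      have "z \<notin> orb"
      proof
        assume "z \<in> orb"
        then obtain i where i: "f y = (f ^^ i) x" unfolding orb_def y by auto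
        have "y = (f ^^ Suc (t - 1)) y" using psubset.prems(2)[OF y(1)] t0 by simp
        also have "\<dots> = (f ^^ (t - 1)) (f y)" by (simp only: funpow_Suc_right o_apply)
        also have "\<dots> = (f ^^ (t - 1 + i)) x" by (simp add: i funpow_add)
        finally show False using orbI y by metis
      qed
      then show "z \<in> A - orb" using y psubset.prems(1) by blast
    qed
    have "x \<in> orb" using orbI[of 0] by simp
    then have "A - orb \<subset> A" using x by blast
    then have IH: "[(\<Sum>z\<in>A - orb. s z) = (\<Sum>z\<in>{z \<in> A - orb. f z = z}. s z)] (mod int t)"
      using psubset.IH[of "A - orb"] closed psubset.prems by blast
    have "(\<Sum>z\<in>A. s z) = (\<Sum>z\<in>A - orb. s z) + (\<Sum>z\<in>orb. s z)"
      using psubset.hyps orb_sub by (simp add: sum.subset_diff)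
    also have "(\<Sum>z\<in>orb. s z) = (\<Sum>i<t. s ((f ^^ i) x))"
      unfolding orb_def using sum.reindex[OF inj] by simp
    finally have "[(\<Sum>z\<in>A. s z) = (\<Sum>z\<in>{z \<in> A - orb. f z = z}. s z) + 0] (mod int t)"
      using cong_add[OF IH psubset.prems(3)[OF x]] by simp
    then show ?thesis by (simp add: fixeq)
  qed
qed

lemma card_fixpoints_cong:
  assumes "Factorial_Ring.prime t" and "finite A" and "f ` A \<subseteq> A"
    and "\<And>x. x \<in> A \<Longrightarrow> (f ^^ t) x = x"
  shows "[card A = card {x \<in> A. f x = x}] (mod t)"
  using sum_fixpoints_cong[OF assms, of "\<lambda>_. 1"] by (simp add: cong_int_iff cong_0_iff)

context group
begin

lemma pow_eq_pow_iff:
  assumes "x \<in> carrier G"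
  shows "x [^] (i::nat) = x [^] (j::nat) \<longleftrightarrow> [i = j] (mod local.ord x)"
proof -
  have "x [^] (int i) = x [^] (int j) \<longleftrightarrow> int (local.ord x) dvd int i - int j"
    using int_pow_eq[OF assms, of "int i" "int j"] by (simp add: dvd_diff_commute)
  then show ?thesis
    by (simp add: int_pow_int flip: cong_int_iff cong_iff_dvd_diff)
qed

text \<open>The image of \<open>h\<close> is a nontrivial subgroup of a group of prime order, hence
  everything; the kernel then has as many cosets as \<open>h\<close> has values.\<close>

lemma card_normal_kernel_Zn:
  assumes fin: "finite (carrier G)" and t: "Factorial_Ring.prime t"
    and hom: "h \<in> hom G (integer_mod_group t)" and x: "x \<in> carrier G" "h x \<noteq> 0"
  shows "kernel G (integer_mod_group t) h \<lhd> G \<and>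
    card (kernel G (integer_mod_group t) h) * t = order G"
proof -
  interpret gh: group_hom G "integer_mod_group t" h
    using hom by (simp add: group_hom_def group_hom_axioms_def)
  have t0: "t > 0" using t by (simp add: prime_gt_0_nat)
  have ordt: "order (integer_mod_group t) = t" "finite (carrier (integer_mod_group t))"
    using t0 by (simp_all add: order_def carrier_integer_mod_group)
  have sub: "subgroup (h ` carrier G) (integer_mod_group t)" by (rule gh.img_is_subgroup)
  then have "card (h ` carrier G) dvd t"
    using gh.H.lagrange[OF sub] ordt by (metis dvd_triv_right)
  moreover have "card (h ` carrier G) \<noteq> 1"
  proof
    assume "card (h ` carrier G) = 1"
    then obtain a where "h ` carrier G = {a}" using card_1_singletonE by blast
    moreover have "h \<one> = 0" using gh.hom_one by simp
    ultimately have "h x = 0" using x by (metis image_eqI one_closed singletonD)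
    then show False using x by simp
  qed
  ultimately have "card (h ` carrier G) = t" using t by (metis prime_nat_iff)
  then have surj: "h ` carrier G = carrier (integer_mod_group t)"
    using ordt sub by (intro card_subset_eq) (auto simp: order_def subgroup_def)
  have "G Mod kernel G (integer_mod_group t) h \<cong> integer_mod_group t"
    using gh.FactGroup_iso[OF surj] .
  then have "card (rcosets kernel G (integer_mod_group t) h) = t"
    using iso_same_order ordt unfolding is_iso_def by (fastforce simp: order_def FactGroup_def)
  then show ?thesis
    using lagrange[OF gh.subgroup_kernel] gh.normal_kernel by (simp add: mult.commute)
qed

text \<open>
  Transfer to a Sylow subgroup of prime order. With \<open>e (x\<^sup>i r) = i\<close> for the chosen representative
  \<open>r\<close> of a coset of \<open>\<langle>x\<rangle>\<close>, the map \<open>g \<mapsto> \<Sum> (e (r g) - e r)\<close> is a homomorphism to the integers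
  mod \<open>t\<close>, and only the cosets fixed by \<open>x\<close> contribute to its value at \<open>x\<close>.
\<close>

lemma transfer_normal_complement:
  assumes fin: "finite (carrier G)" and t: "Factorial_Ring.prime t"
    and ordG: "order G = t * m" and m: "\<not> t dvd m"
    and x: "x \<in> carrier G" and ordx: "local.ord x = t"
    and fusion: "\<And>g j. g \<in> carrier G \<Longrightarrow> g \<otimes> x \<otimes> inv g = x [^] (j::nat) \<Longrightarrow> g \<otimes> x \<otimes> inv g = x"
  shows "\<exists>K. K \<lhd> G \<and> card K = m"
proof -
  define P where "P = generate G {x}"
  have P_eq: "P = {x [^] (k::nat) | k. True}"
    unfolding P_def using generate_pow_on_finite_carrier[OF fin x] by auto
  have subP: "subgroup P G" unfolding P_def using x by (simp add: generate_is_subgroup)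
  then interpret P: subgroup P G .
  have cardP: "card P = t" unfolding P_def using generate_pow_card[OF x] ordx by simp
  have t0: "t > 0" using t by (simp add: prime_gt_0_nat)
  have cardA: "card (rcosets P) = m"
    using lagrange[OF subP] cardP ordG t0 by (simp add: mult.commute)
  have finA: "finite (rcosets P)" using fin by (simp add: rcosets_finite[OF _ P.subset] RCOSETS_def)
  define rep where "rep C = (SOME r. r \<in> C)" for C :: "'a set"
  have rep: "rep C \<in> C" "rep C \<in> carrier G" "P #> rep C = C" if "C \<in> rcosets P" for C
  proof -
    have "C \<noteq> {}" using P.rcosets_non_empty[OF that] .
    then show 1: "rep C \<in> C" unfolding rep_def by (simp add: some_in_eq)
    show 2: "rep C \<in> carrier G" using 1 P.rcosets_carrier[OF is_group that] by blast
    from that obtain g where g: "g \<in> carrier G" "C = P #> g" unfolding RCOSETS_def by blast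
    show "P #> rep C = C" using repr_independence[OF _ g(1) subP, of "rep C"] 1 g by simp
  qed
  have cos: "P #> g \<in> rcosets P" if "g \<in> carrier G" for g
    using that P.subset by (simp add: rcosetsI)
  have coset_elem: "\<exists>k::nat. h = x [^] k \<otimes> g" if "h \<in> P #> g" for h g
    using that unfolding r_coset_def P_eq by auto
  define e where "e g = (SOME i::nat. g = x [^] i \<otimes> rep (P #> g))" for g
  have e: "g = x [^] e g \<otimes> rep (P #> g)" if g: "g \<in> carrier G" for g
  proof -
    have "g \<in> P #> rep (P #> g)" using rep[OF cos[OF g]] g subP by (simp add: rcos_self)
    then have "\<exists>i::nat. g = x [^] i \<otimes> rep (P #> g)" using coset_elem by blast
    then show ?thesis unfolding e_def by (rule someI_ex)
  qed
  \<comment> \<open>\<open>e\<close> is a chosen exponent, determined only modulo the order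
    \<open>t\<close> of \<open>x\<close>; all later statements about it are congruences.\<close>
  have e_shift: "[int (e (x [^] k \<otimes> g)) = int k + int (e g)] (mod int t)"
    if g: "g \<in> carrier G" for k :: nat and g
  proof -
    let ?r = "rep (P #> g)"
    have "P #> (x [^] k \<otimes> g) = P #> g"
    proof (rule repr_independence[symmetric, OF _ g subP])
      show "x [^] k \<otimes> g \<in> P #> g" unfolding r_coset_def P_eq by blast
    qed
    then have "x [^] k \<otimes> g = x [^] e (x [^] k \<otimes> g) \<otimes> ?r"
      using e[of "x [^] k \<otimes> g"] g x by simp
    moreover have "x [^] k \<otimes> g = x [^] (k + e g) \<otimes> ?r"
      using e[OF g] rep(2)[OF cos[OF g]] x g by (metis m_assoc nat_pow_closed nat_pow_mult)
    ultimately have "x [^] e (x [^] k \<otimes> g) = x [^] (k + e g)"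
      using rep(2)[OF cos[OF g]] x by (metis nat_pow_closed right_cancel)
    then have "[e (x [^] k \<otimes> g) = k + e g] (mod t)" using pow_eq_pow_iff[OF x] ordx by simp
    then show ?thesis by (metis cong_int_iff of_nat_add)
  qed
  define s where "s C g = int (e (rep C \<otimes> g)) - int (e (rep C))" for C g
  \<comment> \<open>Replacing \<open>h\<close> by another element of its coset shifts both terms by
    the same exponent, so the difference depends on the coset alone.\<close>
  have s_indep: "[int (e (h \<otimes> g)) - int (e h) = s (P #> h) g] (mod int t)"
    if h: "h \<in> carrier G" and g: "g \<in> carrier G" for h g
  proof -
    have r: "rep (P #> h) \<in> carrier G" using rep[OF cos[OF h]] by blast
    have "h \<in> P #> rep (P #> h)" using rep[OF cos[OF h]] h subP by (simp add: rcos_self)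
    then obtain k :: nat where k: "h = x [^] k \<otimes> rep (P #> h)" using coset_elem by blast
    have "[int (e (x [^] k \<otimes> (rep (P #> h) \<otimes> g))) - int (e (x [^] k \<otimes> rep (P #> h))) =
       (int k + int (e (rep (P #> h) \<otimes> g))) - (int k + int (e (rep (P #> h))))] (mod int t)"
      by (rule cong_diff; rule e_shift) (use r g in simp_all)
    moreover have "x [^] k \<otimes> (rep (P #> h) \<otimes> g) = h \<otimes> g"
      using k r g x by (metis m_assoc nat_pow_closed)
    ultimately show ?thesis unfolding s_def using k by simp
  qed
  define V where "V g = (\<Sum>C\<in>rcosets P. s C g)" for g
  have shift_cos: "C #> g \<in> rcosets P" if "C \<in> rcosets P" "g \<in> carrier G" for C g
    using that cos unfolding RCOSETS_def by (auto simp: coset_mult_assoc P.subset)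
  have shift_back: "(C #> g) #> h = C #> (g \<otimes> h)" if "C \<in> rcosets P" "g \<in> carrier G" "h \<in> carrier G" for C g h
    using that P.rcosets_carrier[OF is_group that(1)] by (simp add: coset_mult_assoc)
  have shift_one: "C #> \<one> = C" if "C \<in> rcosets P" for C
    using P.rcosets_carrier[OF is_group that] by simp
  have shift_rep: "P #> (rep C \<otimes> g) = C #> g" if "C \<in> rcosets P" "g \<in> carrier G" for C g
    using rep[OF that(1)] that by (metis coset_mult_assoc P.subset)
  have bij: "bij_betw (\<lambda>C. C #> g) (rcosets P) (rcosets P)" if g: "g \<in> carrier G" for g
    by (rule bij_betw_byWitness[of _ "\<lambda>C. C #> inv g"])
      (auto simp: shift_back shift_one shift_cos g)
  \<comment> \<open>The increments form a cocycle, \<open>s C (g h) = s C g + s (C g) h\<close>, and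
    right multiplication by \<open>g\<close> permutes the cosets over which the second part is
    summed.\<close>
  have V_mult: "[V (g \<otimes> h) = V g + V h] (mod int t)"
    if g: "g \<in> carrier G" and h: "h \<in> carrier G" for g h
  proof -
    have "[V (g \<otimes> h) = (\<Sum>C\<in>rcosets P. s C g + s (C #> g) h)] (mod int t)"
      unfolding V_def
    proof (rule cong_sum)
      fix C assume C: "C \<in> rcosets P"
      have r: "rep C \<in> carrier G" using rep[OF C] by blast
      have "[int (e ((rep C \<otimes> g) \<otimes> h)) - int (e (rep C \<otimes> g)) = s (C #> g) h] (mod int t)"
        using s_indep[of "rep C \<otimes> g" h] r g h shift_rep[OF C g] by simp
      then have "[s C g + (int (e ((rep C \<otimes> g) \<otimes> h)) - int (e (rep C \<otimes> g))) = s C g + s (C #> g) h] (mod int t)"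
        by (rule cong_add[OF cong_refl])
      then show "[s C (g \<otimes> h) = s C g + s (C #> g) h] (mod int t)"
        unfolding s_def using r g h by (simp add: m_assoc)
    qed
    also have "(\<Sum>C\<in>rcosets P. s C g + s (C #> g) h) = V g + (\<Sum>C\<in>rcosets P. s (C #> g) h)"
      unfolding V_def by (simp add: sum.distrib)
    also have "(\<Sum>C\<in>rcosets P. s (C #> g) h) = V h"
      unfolding V_def by (rule sum.reindex_bij_betw[OF bij[OF g]])
    finally show ?thesis .
  qed
  have iter: "((\<lambda>C. C #> x) ^^ i) C = C #> x [^] i" if "C \<in> rcosets P" for i C
    using that x by (induction i) (simp_all add: shift_one shift_back)
  have "[V x = (\<Sum>C\<in>{C \<in> rcosets P. C #> x = C}. s C x)] (mod int t)"
    unfolding V_def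
  proof (rule sum_fixpoints_cong[OF t finA])
    show "(\<lambda>C. C #> x) ` (rcosets P) \<subseteq> rcosets P" using shift_cos x by blast
    show "((\<lambda>C. C #> x) ^^ t) C = C" if "C \<in> rcosets P" for C
      using iter[OF that] ordx pow_ord_eq_1[OF x] shift_one[OF that] by simp
    fix C assume C: "C \<in> rcosets P"
    have r: "rep C \<in> carrier G" using rep[OF C] by blast
    \<comment> \<open>Along an orbit of \<open>x\<close> the increments telescope to
      \<open>e (r x^t) - e r\<close>, where \<open>r\<close> represents \<open>C\<close>; this is 0
      because \<open>x^t\<close> is trivial.\<close>
    have "[(\<Sum>i<t. s (((\<lambda>C. C #> x) ^^ i) C) x) =
      (\<Sum>i<t. int (e (rep C \<otimes> x [^] Suc i)) - int (e (rep C \<otimes> x [^] i)))] (mod int t)"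
    proof (rule cong_sum)
      fix i :: nat
      have "[int (e ((rep C \<otimes> x [^] i) \<otimes> x)) - int (e (rep C \<otimes> x [^] i)) = s (C #> x [^] i) x] (mod int t)"
        using s_indep[of "rep C \<otimes> x [^] i" x] r x shift_rep[OF C, of "x [^] i"] by simp
      then show "[s (((\<lambda>C. C #> x) ^^ i) C) x =
        int (e (rep C \<otimes> x [^] Suc i)) - int (e (rep C \<otimes> x [^] i))] (mod int t)"
        using r x by (simp add: iter[OF C] m_assoc cong_sym_eq)
    qed
    also have "(\<Sum>i<t. int (e (rep C \<otimes> x [^] Suc i)) - int (e (rep C \<otimes> x [^] i))) =
      int (e (rep C \<otimes> x [^] t)) - int (e (rep C \<otimes> x [^] (0::nat)))"
      by (rule sum_lessThan_telescope)
    also have "\<dots> = 0" using ordx pow_ord_eq_1[OF x] by simp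
    finally show "[(\<Sum>i<t. s (((\<lambda>C. C #> x) ^^ i) C) x) = 0] (mod int t)" .
  qed
  \<comment> \<open>A coset fixed by \<open>x\<close> has a representative \<open>r\<close> with
    \<open>r x r^-1\<close> in \<open>P\<close>; the fusion assumption makes \<open>r\<close>
    commute with \<open>x\<close>, so the coset contributes exactly 1.\<close>
  also have "[(\<Sum>C\<in>{C \<in> rcosets P. C #> x = C}. s C x) = (\<Sum>C\<in>{C \<in> rcosets P. C #> x = C}. 1)] (mod int t)"
  proof (rule cong_sum)
    fix C assume "C \<in> {C \<in> rcosets P. C #> x = C}"
    then have C: "C \<in> rcosets P" and fixC: "C #> x = C" by auto
    have r: "rep C \<in> carrier G" "rep C \<in> C" using rep[OF C] by auto
    have "rep C \<otimes> x \<in> C #> x" using r unfolding r_coset_def by blast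
    then have "rep C \<otimes> x \<in> P #> rep C" using fixC rep(3)[OF C] by simp
    then obtain j :: nat where j: "rep C \<otimes> x = x [^] j \<otimes> rep C" using coset_elem by blast
    then have "rep C \<otimes> x \<otimes> inv (rep C) = x [^] j" using r x by (simp add: inv_solve_right')
    then have "rep C \<otimes> x \<otimes> inv (rep C) = x" using fusion[OF r(1)] by blast
    then have "rep C \<otimes> x = x [^] (1::nat) \<otimes> rep C" using r x by (simp add: inv_solve_right')
    then show "[s C x = 1] (mod int t)"
      unfolding s_def using e_shift[OF r(1), of 1] by (simp add: cong_iff_dvd_diff algebra_simps)
  qed
  also have "(\<Sum>C\<in>{C \<in> rcosets P. C #> x = C}. 1) = int (card {C \<in> rcosets P. C #> x = C})"
    by simp
  also have "[\<dots> = int (card (rcosets P))] (mod int t)"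
    unfolding cong_int_iff
  proof (rule cong_sym, rule card_fixpoints_cong[OF t finA])
    show "(\<lambda>C. C #> x) ` (rcosets P) \<subseteq> rcosets P" using shift_cos x by blast
    show "((\<lambda>C. C #> x) ^^ t) C = C" if "C \<in> rcosets P" for C
      using iter[OF that] ordx pow_ord_eq_1[OF x] shift_one[OF that] by simp
  qed
  \<comment> \<open>The number of fixed cosets agrees modulo \<open>t\<close> with the number
    \<open>m\<close> of all cosets; as \<open>t\<close> does not divide \<open>m\<close>, the
    homomorphism is nonzero at \<open>x\<close>.\<close>
  finally have Vx: "[V x = int m] (mod int t)" by (simp add: cardA)
  define h where "h g = V g mod int t" for g
  have "h \<in> hom G (integer_mod_group t)"
    using V_mult t0 unfolding hom_def h_def
    by (auto simp: carrier_integer_mod_group cong_def mod_add_eq)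
  moreover have "h x \<noteq> 0"
    using Vx m unfolding h_def cong_def by (simp flip: of_nat_mod add: dvd_eq_mod_eq_0)
  ultimately have K: "kernel G (integer_mod_group t) h \<lhd> G \<and>
      card (kernel G (integer_mod_group t) h) * t = order G"
    using card_normal_kernel_Zn[OF fin t _ x] by blast
  then have "card (kernel G (integer_mod_group t) h) = m" using ordG t0 by simp
  then show ?thesis using K by blast
qed

end

subsection \<open>Normal subgroups of prime index\<close>

lemma cong_power_gcd_eq_1:
  fixes k a b m :: nat
  assumes "[k ^ a = 1] (mod m)" and "[k ^ b = 1] (mod m)"
  shows "[k ^ gcd a b = 1] (mod m)"
  using assms by (simp only: ord_divides gcd_greatest_iff)

text \<open>By Fermat the order of \<open>k\<close> divides \<open>p - 1\<close> as well as
  \<open>n\<close>; \<open>n > 0\<close> is what makes \<open>k\<close> a unit.\<close>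

lemma prime_power_eq_1_coprime:
  fixes k p n :: nat
  assumes p: "Factorial_Ring.prime p" and "[k ^ n = 1] (mod p)" and "coprime n (p - 1)" and "n > 0"
  shows "[k = 1] (mod p)"
proof -
  have "coprime k p"
  proof -
    have "coprime (k ^ n) p" using cong_imp_coprime[OF cong_sym[OF assms(2)]] by simp
    then show ?thesis using \<open>n > 0\<close> by simp
  qed
  then have "[k ^ (p - 1) = 1] (mod p)"
    using p fermat_theorem[of p k] coprime_common_divisor_nat[of k p p] prime_gt_1_nat[OF p] by auto
  then show ?thesis
    using cong_power_gcd_eq_1[OF assms(2), of "p - 1"] assms(3) by (simp only: coprime_iff_gcd_eq_1 power_one_right)
qed

text \<open>A prime \<open>t\<close> common to \<open>d\<close> and \<open>N\<close> occurs once in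
  \<open>a * N\<close>, hence not at all in \<open>a * N div t\<close>. Applied to orders of
  elements, this makes \<open>torsion G a\<close> the intersection of the sets
  \<open>torsion G (a * N div t)\<close>.\<close>

lemma dvd_cofactor_if_dvd_all:
  fixes a N d :: nat
  assumes "d dvd a * N" "coprime a N" "squarefree N" "a * N > 0"
    and "\<And>t. Factorial_Ring.prime t \<Longrightarrow> t dvd N \<Longrightarrow> d dvd a * N div t"
  shows "d dvd a"
proof -
  have "coprime d N"
  proof (rule ccontr)
    assume "\<not> coprime d N"
    then obtain t where t: "Factorial_Ring.prime t" "t dvd d" "t dvd N"
    proof -
      have "gcd d N \<noteq> 1" using \<open>\<not> coprime d N\<close> by (simp only: coprime_iff_gcd_eq_1 not_False_eq_True)
      then obtain t where "Factorial_Ring.prime t" "t dvd gcd d N" using prime_factor_nat by blast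
      then show ?thesis using that by simp
    qed
    then obtain c where c: "N = t * c" by (elim dvdE)
    have t0: "t > 0" using t by (simp add: prime_gt_0_nat)
    have "t dvd a * N div t" using assms(5)[OF t(1,3)] t(2) dvd_trans by blast
    then have "t dvd a * c" using c t0 by (simp add: mult.left_commute)
    moreover have "\<not> t dvd a" using t(1,3) assms(2) coprime_common_divisor_nat[of a N t] by auto
    moreover have "\<not> t dvd c"
      using squarefreeD[OF assms(3), of t] t(1) c by (auto simp: power2_eq_square)
    ultimately show False using t(1) prime_dvd_mult_iff by blast
  qed
  then show ?thesis using assms(1) by (simp add: coprime_dvd_mult_left_iff)
qed

text \<open>A plain set of solutions, in general not a subgroup. It involves no choice, so
  conjugation and isomorphisms preserve it, and a normal subgroup of coprime index is necessarily of
  this form.\<close>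

definition torsion :: "('a, 'b) monoid_scheme \<Rightarrow> nat \<Rightarrow> 'a set" where
  "torsion G d = {x \<in> carrier G. x [^]\<^bsub>G\<^esub> d = \<one>\<^bsub>G\<^esub>}"

definition normal_index :: "('a, 'b) monoid_scheme \<Rightarrow> nat \<Rightarrow> bool" where
  "normal_index G t \<longleftrightarrow> (\<exists>K. K \<lhd> G \<and> card K * t = order G)"

text \<open>An internal semidirect product of \<open>K\<close> with the cyclic group generated by
  \<open>y\<close>; coprimality stands in for trivial intersection, and the product of the orders
  for generation.\<close>

definition splits :: "('a, 'b) monoid_scheme \<Rightarrow> 'a set \<Rightarrow> 'a \<Rightarrow> bool" where
  "splits G K y \<longleftrightarrow> subgroup K G \<and> y \<in> carrier G
     \<and> (\<forall>k\<in>K. y \<otimes>\<^bsub>G\<^esub> k \<otimes>\<^bsub>G\<^esub> inv\<^bsub>G\<^esub> y \<in> K)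
     \<and> card K * group.ord G y = order G \<and> coprime (card K) (group.ord G y)"

context group
begin

lemma subgroup_pow_card:
  assumes "subgroup H G" and "finite H" and "x \<in> H"
  shows "x [^] card H = \<one>"
proof -
  interpret H: group "G\<lparr>carrier := H\<rparr>" using subgroup_imp_group[OF assms(1)] .
  have "x [^]\<^bsub>G\<lparr>carrier := H\<rparr>\<^esub> order (G\<lparr>carrier := H\<rparr>) = \<one>"
    using H.pow_order_eq_1[of x] assms by simp
  then show ?thesis by (simp add: order_def flip: nat_pow_consistent)
qed

text \<open>The Sylow theorem is applied to the first power of \<open>t\<close>, whatever power
  divides the order; a nontrivial element of a subgroup of prime order has that order.\<close>

lemma Cauchy_prime:
  assumes fin: "finite (carrier G)" and t: "Factorial_Ring.prime t" "t dvd order G"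
  obtains x where "x \<in> carrier G" "local.ord x = t"
proof -
  obtain m where m: "order G = t ^ 1 * m" using t(2) by auto
  obtain H where H: "subgroup H G" "card H = t"
    using sylow_thm[OF t(1) is_group m fin] by auto
  have t1: "t > 1" using t(1) by (rule prime_gt_1_nat)
  have finH: "finite H" using H(1) fin by (meson finite_subset subgroup.subset)
  have "H \<noteq> {\<one>}" using H(2) t1 by auto
  then obtain x where x: "x \<in> H" "x \<noteq> \<one>" using H(1) subgroup.one_closed by fastforce
  have xG: "x \<in> carrier G" using x H(1) subgroup.mem_carrier by metis
  have "local.ord x dvd t" using subgroup_pow_card[OF H(1) finH x(1)] H(2) xG by (simp add: pow_eq_id)
  moreover have "local.ord x \<noteq> 1" using x(2) xG ord_eq_1 by blast
  ultimately have "local.ord x = t" using t(1) by (metis prime_nat_iff)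
  then show ?thesis using that xG by blast
qed

lemma coprime_pows_eq_1:
  assumes "x \<in> carrier G" and "x [^] (a::nat) = \<one>" and "x [^] (b::nat) = \<one>" and "coprime a b"
  shows "x = \<one>"
proof -
  have "local.ord x dvd a" "local.ord x dvd b" using assms pow_eq_id by blast+
  then have "local.ord x = 1" using assms(4) coprime_common_divisor_nat by blast
  then show ?thesis using assms(1) ord_eq_1 by blast
qed

lemma conj_pow_closed:
  assumes "g \<in> carrier G" "x \<in> carrier G"
  shows "(g \<otimes> x \<otimes> inv g) [^] (k::nat) = g \<otimes> x [^] k \<otimes> inv g"
  using assms by (induction k) (simp_all add: m_assoc, metis inv_closed l_inv l_one m_assoc m_closed nat_pow_closed)

lemma conj_conj:
  assumes "g \<in> carrier G" "h \<in> carrier G" "x \<in> carrier G"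
  shows "g \<otimes> (h \<otimes> x \<otimes> inv h) \<otimes> inv g = (g \<otimes> h) \<otimes> x \<otimes> inv (g \<otimes> h)"
  using assms by (simp add: m_assoc inv_mult_group)

lemma conj_iterate_pow:
  assumes g: "g \<in> carrier G" and x: "x \<in> carrier G" and conj: "g \<otimes> x \<otimes> inv g = x [^] (j::nat)"
  shows "g [^] (i::nat) \<otimes> x \<otimes> inv (g [^] i) = x [^] (j ^ i)"
proof (induction i)
  case 0
  then show ?case using x by simp
next
  case (Suc i)
  have "g [^] Suc i \<otimes> x \<otimes> inv (g [^] Suc i) = g [^] i \<otimes> (g \<otimes> x \<otimes> inv g) \<otimes> inv (g [^] i)"
    using g x by (simp add: conj_conj)
  also have "\<dots> = (g [^] i \<otimes> x \<otimes> inv (g [^] i)) [^] j"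
    using g x by (simp add: conj conj_pow_closed)
  also have "\<dots> = x [^] (j ^ Suc i)"
    using x by (simp add: Suc nat_pow_pow mult.commute)
  finally show ?case .
qed

lemma conj_eq_iff_commute:
  assumes "g \<in> carrier G" "x \<in> carrier G"
  shows "g \<otimes> x \<otimes> inv g = x \<longleftrightarrow> g \<otimes> x = x \<otimes> g"
  using assms by (metis inv_solve_right m_closed)

text \<open>The link from group theory to arithmetic: an element normalizing the group generated by
  \<open>x\<close> gives a root of unity modulo the order of \<open>x\<close>.\<close>

lemma conj_pow_exponent_cong:
  assumes g: "g \<in> carrier G" and x: "x \<in> carrier G" and conj: "g \<otimes> x \<otimes> inv g = x [^] (j::nat)"
    and gi: "g [^] (i::nat) = \<one>"
  shows "[j ^ i = 1] (mod local.ord x)"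
proof -
  have "x [^] (j ^ i) = x [^] (1::nat)" using conj_iterate_pow[OF g x conj, of i] gi x by simp
  then show ?thesis using pow_eq_pow_iff[OF x] by blast
qed

text \<open>Conjugation acts on a subgroup of order \<open>t\<close> by an exponent whose order
  divides \<open>order G\<close> and \<open>t - 1\<close>, so it acts trivially and the fusion
  condition of the transfer holds.\<close>

lemma normal_index_coprime:
  assumes fin: "finite (carrier G)" and t: "Factorial_Ring.prime t" "order G = t * m" "\<not> t dvd m"
    and cop: "coprime (order G) (t - 1)"
  shows "normal_index G t"
proof -
  obtain x where x: "x \<in> carrier G" "local.ord x = t" using Cauchy_prime[OF fin t(1)] t(2) by auto
  have "\<exists>K. K \<lhd> G \<and> card K = m"
  proof (rule transfer_normal_complement[OF fin t x])
    fix g and j :: nat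
    assume g: "g \<in> carrier G" and j: "g \<otimes> x \<otimes> inv g = x [^] j"
    have "[j ^ order G = 1] (mod t)"
      using conj_pow_exponent_cong[OF g x(1) j pow_order_eq_1[OF g]] x(2) by simp
    then have "[j = 1] (mod t)" using prime_power_eq_1_coprime[OF t(1) _ cop] fin order_gt_0_iff_finite by blast
    then have "x [^] j = x [^] (1::nat)" using pow_eq_pow_iff[OF x(1)] x(2) by blast
    then show "g \<otimes> x \<otimes> inv g = x" using j x by simp
  qed
  then show ?thesis using t(2) unfolding normal_index_def by (metis mult.commute)
qed

lemma normal_pow_index_mem:
  assumes K: "K \<lhd> G" and fin: "finite (carrier G)" and card: "card K * t = order G" and x: "x \<in> carrier G"
  shows "x [^] t \<in> K"
proof -
  interpret K: normal K G by fact
  interpret Q: group "G Mod K" by (rule K.factorgroup_is_group)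
  have "card K > 0" using K.subset fin K.one_closed by (metis card_gt_0_iff empty_iff finite_subset)
  moreover have "card (rcosets K) * card K = t * card K"
    using lagrange[OF K.subgroup_axioms] card by (simp add: mult.commute)
  ultimately have "card (rcosets K) = t" by simp
  then have "order (G Mod K) = t" by (simp add: order_def FactGroup_def)
  then have "(K #> x) [^]\<^bsub>G Mod K\<^esub> t = K"
    using Q.pow_order_eq_1[of "K #> x"] x by (auto simp: carrier_FactGroup)
  then have "K #> (x [^] t) = K" using K.FactGroup_pow[OF x, of t] by simp
  then show ?thesis using x K.subgroup_axioms by (metis nat_pow_closed rcos_self)
qed

lemma subgroup_mem_coprime_pows:
  assumes K: "subgroup K G" and x: "x \<in> carrier G" "x [^] (a::nat) \<in> K" "x [^] (b::nat) \<in> K"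
    and "coprime a b"
  shows "x \<in> K"
proof (cases "a = 0")
  case True
  then show ?thesis using assms by simp
next
  case False
  then obtain u v where uv: "a * u = b * v + 1"
    using bezout_nat[of a b] \<open>coprime a b\<close> by auto
  have pow_mem: "z [^] (i::nat) \<in> K" if "z \<in> K" for z i
    using that K by (induction i) (simp_all add: subgroup.one_closed subgroup.m_closed)
  have "x [^] (a * u) \<in> K" "x [^] (b * v) \<in> K"
    using pow_mem x by (simp_all flip: nat_pow_pow)
  moreover have "x [^] (a * u) = x [^] (b * v) \<otimes> x" using uv x by simp
  ultimately have "inv (x [^] (b * v)) \<otimes> (x [^] (b * v) \<otimes> x) \<in> K"
    using K by (metis subgroup.m_closed subgroup.m_inv_closed)
  then show ?thesis using x by (simp flip: m_assoc)
qed

text \<open>Lagrange gives one inclusion. Conversely \<open>x^t\<close> lies in \<open>K\<close>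
  because the quotient has order \<open>t\<close>, and if \<open>x^(card K)\<close> is trivial as
  well, coprimality brings \<open>x\<close> itself into \<open>K\<close>.\<close>

lemma normal_index_torsion:
  assumes fin: "finite (carrier G)" and K: "K \<lhd> G" and card: "card K * t = order G" and cop: "coprime (card K) t"
  shows "K = torsion G (card K)"
proof
  interpret K: normal K G by fact
  have finK: "finite K" using K.subset fin finite_subset by blast
  show "K \<subseteq> torsion G (card K)"
    using subgroup_pow_card[OF K.subgroup_axioms finK] K.subset unfolding torsion_def by auto
  show "torsion G (card K) \<subseteq> K"
  proof
    fix x assume "x \<in> torsion G (card K)"
    then have "x \<in> carrier G" "x [^] card K \<in> K" by (auto simp: torsion_def)
    then show "x \<in> K"
      using subgroup_mem_coprime_pows[OF K.subgroup_axioms _ _ normal_pow_index_mem[OF K fin card]] cop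
      by blast
  qed
qed

lemma normal_index_torsion_subgroup:
  assumes fin: "finite (carrier G)" and "normal_index G t" and "order G = t * m" "coprime t m" "t > 0"
  shows "torsion G m \<lhd> G" "card (torsion G m) = m"
proof -
  obtain K where K: "K \<lhd> G" "card K * t = order G" using assms(2) unfolding normal_index_def by blast
  then have "card K = m" using assms by simp
  then have "K = torsion G m"
    using normal_index_torsion[OF fin K] assms(4) by (simp add: coprime_commute)
  then show "torsion G m \<lhd> G" "card (torsion G m) = m" using K \<open>card K = m\<close> by auto
qed

text \<open>The quotient by \<open>K\<close> has prime order, so the coset of \<open>y\<close>
  generates it, and \<open>g\<close> lies in the coset of some power of \<open>y\<close>.\<close>

lemma prime_index_coset:
  assumes fin: "finite (carrier G)" and K: "K \<lhd> G" and card: "card K * t = order G"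
    and t: "Factorial_Ring.prime t" and y: "y \<in> carrier G" "y \<notin> K" and g: "g \<in> carrier G"
  obtains j :: nat where "g \<otimes> inv (y [^] j) \<in> K"
proof -
  interpret K: normal K G by fact
  have "card K > 0" using K.subset fin K.one_closed by (metis card_gt_0_iff empty_iff finite_subset)
  moreover have "card (rcosets K) * card K = t * card K"
    using lagrange[OF K.subgroup_axioms] card by (simp add: mult.commute)
  ultimately have cardR: "card (rcosets K) = t" by simp
  have finR: "finite (rcosets K)" using fin by (simp add: rcosets_finite[OF _ K.subset] RCOSETS_def)
  let ?c = "\<lambda>j::nat. K #> y [^] j"
  have ne: "?c i \<noteq> ?c j" if "i < j" "j < t" for i j
  proof
    assume "?c i = ?c j"
    then have "y [^] j \<in> K #> y [^] i" using y rcos_self[OF _ K.subgroup_axioms] by simp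
    then have "y [^] j \<otimes> inv (y [^] i) \<in> K"
      using K.rcos_module_imp[OF is_group, of "y [^] i" "y [^] j"] y by simp
    moreover have "y [^] j = y [^] (j - i) \<otimes> y [^] i" using that y by (simp add: nat_pow_mult)
    ultimately have "y [^] (j - i) \<in> K" using y by (simp add: m_assoc)
    moreover have "coprime (j - i) t"
      using t that by (metis coprime_commute diff_le_self dual_order.strict_trans1
            linorder_not_less nat_dvd_not_less prime_imp_coprime zero_less_diff)
    ultimately have "y \<in> K"
      using subgroup_mem_coprime_pows[OF K.subgroup_axioms y(1) _ normal_pow_index_mem[OF K fin card y(1)]] by blast
    then show False using y by simp
  qed
  have inj: "inj_on ?c {..<t}"
    by (rule inj_onI) (metis lessThan_iff linorder_neqE_nat ne)
  have "?c ` {..<t} = rcosets K"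
  proof (rule card_subset_eq[OF finR])
    show "?c ` {..<t} \<subseteq> rcosets K" using y K.subset by (auto intro: rcosetsI)
    show "card (?c ` {..<t}) = card (rcosets K)" using card_image[OF inj] cardR by simp
  qed
  then have "K #> g \<in> ?c ` {..<t}" using rcosetsI[OF K.subset g] by simp
  then obtain j where "K #> g = K #> y [^] (j::nat)" by blast
  then have "g \<in> K #> y [^] j" using g rcos_self[OF _ K.subgroup_axioms] by metis
  then have "g \<otimes> inv (y [^] j) \<in> K"
    using K.rcos_module_imp[OF is_group, of "y [^] j" g] y by simp
  then show ?thesis using that by blast
qed

end

subsection \<open>Split extensions by cyclic groups\<close>

context group
begin

lemma mult_inv_cancel_middle:
  assumes "a \<in> carrier G" "b \<in> carrier G" "c \<in> carrier G"
  shows "(a \<otimes> inv b) \<otimes> (b \<otimes> c) = a \<otimes> c"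
proof -
  have "inv b \<otimes> (b \<otimes> c) = c" using assms by (simp flip: m_assoc)
  then show ?thesis using assms by (simp add: m_assoc)
qed

text \<open>If two products agree, \<open>k'^-1 k\<close> is a power of \<open>y\<close>, and it is
  annihilated by the coprime exponents \<open>a\<close> and \<open>local.ord y\<close>.\<close>

lemma inj_on_mult_pow:
  assumes sub: "subgroup K G" and yG: "y \<in> carrier G" and exp: "\<And>k. k \<in> K \<Longrightarrow> k [^] (a::nat) = \<one>"
    and cop: "coprime a (local.ord y)"
  shows "inj_on (\<lambda>(k, j::nat). k \<otimes> y [^] j) (K \<times> {..<local.ord y})"
proof (rule inj_onI, clarsimp)
  fix k i k' j
  assume k: "k \<in> K" "k' \<in> K" and ij: "i < local.ord y" "j < local.ord y"
    and eq: "k \<otimes> y [^] i = k' \<otimes> y [^] j"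
  have kG: "k \<in> carrier G" "k' \<in> carrier G" using k sub subgroup.mem_carrier by metis+
  have "inv k' \<otimes> k = y [^] j \<otimes> inv (y [^] i)"
    using kG yG eq by (metis inv_closed inv_solve_left inv_solve_right m_assoc m_closed nat_pow_closed)
  also have "\<dots> = y [^] (int j - int i)" using yG by (simp add: int_pow_diff int_pow_int)
  finally have e: "inv k' \<otimes> k = y [^] (int j - int i)" .
  have "inv k' \<otimes> k \<in> K" using k sub by (simp add: subgroup.m_closed subgroup.m_inv_closed)
  then have "(inv k' \<otimes> k) [^] a = \<one>" using exp by blast
  moreover have "(inv k' \<otimes> k) [^] local.ord y = \<one>"
  proof -
    have "(y [^] (int j - int i)) [^] int (local.ord y) = y [^] ((int j - int i) * int (local.ord y))"
      using yG by (simp add: int_pow_pow)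
    also have "\<dots> = \<one>" using yG by (simp add: int_pow_eq_id)
    finally show ?thesis using e by (simp flip: int_pow_int)
  qed
  ultimately have "inv k' \<otimes> k = \<one>" using coprime_pows_eq_1[OF _ _ _ cop] kG by simp
  then have kk: "k = k'" using kG by (metis inv_equality inv_inv inv_closed)
  then have "y [^] i = y [^] j" using eq kG yG by simp
  then have "[i = j] (mod local.ord y)" using pow_eq_pow_iff[OF yG] by simp
  then show "k = k' \<and> i = j" using kk ij by (simp add: cong_def)
qed

text \<open>For each prime \<open>t\<close> dividing \<open>N\<close> the normal subgroup of index
  \<open>t\<close> is \<open>torsion G (a * N div t)\<close>. Their intersection is
  \<open>torsion G a\<close>; an element outside all of them, raised to the power \<open>a\<close>,
  has order \<open>N\<close> and generates a complement.\<close>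

lemma split_structure:
  assumes fin: "finite (carrier G)" and ordG: "order G = a * N" and cop: "coprime a N" and sqf: "squarefree N"
    and idx: "\<And>t. Factorial_Ring.prime t \<Longrightarrow> t dvd N \<Longrightarrow> normal_index G t"
  obtains y where "splits G (torsion G a) y" "local.ord y = N"
    "card (torsion G a) = a" "torsion G a \<lhd> G"
proof -
  have n0: "a * N > 0" using ordG fin order_gt_0_iff_finite by metis
  then have N0: "N > 0" and a0: "a > 0" by auto
  have co: "order G = t * (a * N div t)" "coprime t (a * N div t)" "a dvd a * N div t" "t > 0"
    "card (torsion G (a * N div t)) * t = order G"
    "torsion G (a * N div t) \<lhd> G"
    if t: "Factorial_Ring.prime t" "t dvd N" for t
  proof -
    obtain c where c: "N = t * c" using t by blast
    show t0: "t > 0" using t by (simp add: prime_gt_0_nat)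
    have ac: "a * N div t = a * c" using c t0 by (simp add: mult.left_commute)
    show 1: "order G = t * (a * N div t)" using ordG c ac by simp
    show "a dvd a * N div t" using ac by simp
    have "\<not> t dvd a" using t cop coprime_common_divisor_nat[of a N t] by auto
    moreover have "\<not> t dvd c"
      using squarefreeD[OF sqf, of t] t(1) c by (auto simp: power2_eq_square)
    ultimately show 2: "coprime t (a * N div t)"
      using t(1) ac by (simp add: prime_imp_coprime)
    from normal_index_torsion_subgroup[OF fin idx[OF t] 1 2 t0]
    show "torsion G (a * N div t) \<lhd> G" "card (torsion G (a * N div t)) * t = order G"
      using 1 by (simp_all add: mult.commute)
  qed
  have tors_iff: "x \<in> torsion G d \<longleftrightarrow> x \<in> carrier G \<and> local.ord x dvd d" for x d
    unfolding torsion_def using pow_eq_id by blast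
  have mem: "x \<in> torsion G a"
    if "x \<in> carrier G" "\<And>t. Factorial_Ring.prime t \<Longrightarrow> t dvd N \<Longrightarrow> x \<in> torsion G (a * N div t)" for x
  proof -
    have "local.ord x dvd a * N" using that(1) ord_dvd_group_order ordG by metis
    then have "local.ord x dvd a"
      using dvd_cofactor_if_dvd_all[OF _ cop sqf n0] that(2) tors_iff by blast
    then show ?thesis using that(1) tors_iff by blast
  qed
  have mem': "x \<in> torsion G (a * N div t)" if "x \<in> torsion G a" "Factorial_Ring.prime t" "t dvd N" for x t
    using that co(3)[OF that(2,3)] tors_iff by (meson dvd_trans)
  have sub: "subgroup (torsion G a) G"
  proof (rule subgroupI)
    show "torsion G a \<subseteq> carrier G" unfolding torsion_def by blast
    have "\<one> \<in> torsion G a" unfolding torsion_def by simp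
    then show "torsion G a \<noteq> {}" by blast
    show "inv x \<in> torsion G a" if "x \<in> torsion G a" for x
      using that unfolding torsion_def by (auto simp: nat_pow_inv)
    fix x z assume xz: "x \<in> torsion G a" "z \<in> torsion G a"
    show "x \<otimes> z \<in> torsion G a"
    proof (rule mem)
      show "x \<otimes> z \<in> carrier G" using xz tors_iff by simp
      fix t assume t: "Factorial_Ring.prime t" "t dvd N"
      have "subgroup (torsion G (a * N div t)) G" using co(6)[OF t] normal_imp_subgroup by blast
      then show "x \<otimes> z \<in> torsion G (a * N div t)" using mem' xz t subgroup.m_closed by metis
    qed
  qed
  have norm: "torsion G a \<lhd> G"
    unfolding normal_inv_iff using sub by (auto simp: torsion_def conj_pow_closed)
  define T where "T = {t. Factorial_Ring.prime t \<and> t dvd N}"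
  have finT: "finite T" unfolding T_def using N0 by (auto intro: finite_subset[OF _ finite_divisors_nat])
  \<comment> \<open>An element outside all these subgroups is built prime by prime: multiplying by
    an element of order \<open>t\<close> moves out of the subgroup for \<open>t\<close> and does not
    change membership for the other primes, since their subgroups contain that element.\<close>
  have "\<exists>y\<in>carrier G. \<forall>t\<in>S. y \<notin> torsion G (a * N div t)" if "S \<subseteq> T" for S
    using finite_subset[OF that finT] that
  proof (induction S rule: finite_induct)
    case empty
    show ?case by auto
  next
    case (insert t S)
    then obtain y where y: "y \<in> carrier G" "\<And>s. s \<in> S \<Longrightarrow> y \<notin> torsion G (a * N div s)" by auto
    have t: "Factorial_Ring.prime t" "t dvd N" using insert.prems unfolding T_def by auto
    show ?case
    proof (cases "y \<in> torsion G (a * N div t)")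
      case False
      then show ?thesis using y by auto
    next
      case True
      have "t dvd order G" using co(1)[OF t] by simp
      then obtain x where x: "x \<in> carrier G" "local.ord x = t" using Cauchy_prime[OF fin t(1)] by blast
      have sgt: "subgroup (torsion G (a * N div t)) G" using co(6)[OF t] normal_imp_subgroup by blast
      have "x \<notin> torsion G (a * N div t)"
        using x co(2)[OF t] t(1) tors_iff by (metis coprime_absorb_left not_prime_unit)
      then have 1: "y \<otimes> x \<notin> torsion G (a * N div t)"
        using True sgt x y by (metis l_one m_assoc l_inv inv_closed subgroup.m_closed subgroup.m_inv_closed)
      have 2: "y \<otimes> x \<notin> torsion G (a * N div s)" if s: "s \<in> S" for s
      proof
        assume yx: "y \<otimes> x \<in> torsion G (a * N div s)"
        have s': "Factorial_Ring.prime s" "s dvd N" "s \<noteq> t" using insert s unfolding T_def by auto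
        have sgs: "subgroup (torsion G (a * N div s)) G" using co(6)[OF s'(1,2)] normal_imp_subgroup by blast
        have "t dvd s * (a * N div s)" using co(1)[OF s'(1,2)] \<open>t dvd order G\<close> by simp
        then have "t dvd a * N div s" using t(1) s' by (metis prime_dvd_mult_nat primes_dvd_imp_eq)
        then have "x \<in> torsion G (a * N div s)" using x tors_iff by blast
        then have "y \<in> torsion G (a * N div s)"
          using yx sgs x y by (metis r_one m_assoc r_inv inv_closed subgroup.m_closed subgroup.m_inv_closed)
        then show False using y s by blast
      qed
      show ?thesis using 1 2 x y by (intro bexI[of _ "y \<otimes> x"]) auto
    qed
  qed
  then obtain y0 where y0: "y0 \<in> carrier G" "\<And>t. t \<in> T \<Longrightarrow> y0 \<notin> torsion G (a * N div t)" by blast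
  \<comment> \<open>The power \<open>a\<close> removes the part of the order that belongs to the
    kernel.\<close>
  define y where "y = y0 [^] a"
  have yG: "y \<in> carrier G" unfolding y_def using y0 by simp
  have "y [^] N = \<one>" unfolding y_def using y0 pow_order_eq_1[of y0] ordG by (simp add: nat_pow_pow)
  then have ordN: "local.ord y dvd N" using yG pow_eq_id by blast
  have ordy: "local.ord y = N"
  proof (rule ccontr)
    assume "local.ord y \<noteq> N"
    then obtain c where c: "N = local.ord y * c" "c \<noteq> 1" using ordN by auto
    then obtain t where t: "Factorial_Ring.prime t" "t dvd c" using prime_factor_nat by blast
    then obtain d where d: "c = t * d" by blast
    have tN: "t dvd N" using c d by simp
    have "a * N div t = a * (local.ord y * d)"
      using c d prime_gt_0_nat[OF t(1)] by (metis mult.left_commute nonzero_mult_div_cancel_left neq0_conv)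
    then have "y0 [^] (a * N div t) = y [^] (local.ord y * d)"
      unfolding y_def using y0 by (simp add: nat_pow_pow)
    also have "\<dots> = \<one>" using yG pow_eq_id by (metis dvd_triv_left)
    finally have "y0 \<in> torsion G (a * N div t)" unfolding torsion_def using y0 by simp
    then show False using y0(2) t tN unfolding T_def by blast
  qed
  let ?K = "torsion G a"
  let ?f = "\<lambda>(k, j::nat). k \<otimes> y [^] j"
  have finK: "finite ?K" using fin unfolding torsion_def by simp
  \<comment> \<open>Modulo each subgroup of index \<open>t\<close> the element \<open>g\<close> is a
    power of \<open>y\<close>, with an exponent that matters only modulo \<open>t\<close>; the
    Chinese remainder theorem joins these exponents into a single \<open>j\<close>.\<close>
  have surj: "\<exists>k\<in>?K. \<exists>j<N. g = k \<otimes> y [^] j" if g: "g \<in> carrier G" for g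
  proof -
    have "\<exists>j::nat. g \<otimes> inv (y [^] j) \<in> torsion G (a * N div t)" if t: "t \<in> T" for t
    proof -
      have t': "Factorial_Ring.prime t" "t dvd N" using t unfolding T_def by auto
      have yn: "y \<notin> torsion G (a * N div t)"
      proof
        assume "y \<in> torsion G (a * N div t)"
        then have "N dvd a * N div t" using ordy tors_iff by simp
        then have "t dvd a * N div t" using t' dvd_trans by blast
        then show False using co(2)[OF t'] t'(1) by (metis coprime_absorb_left not_prime_unit)
      qed
      obtain j :: nat where "g \<otimes> inv (y [^] j) \<in> torsion G (a * N div t)"
        using prime_index_coset[OF fin co(6)[OF t'] co(5)[OF t'] t'(1) yG yn g] .
      then show ?thesis by (rule exI)
    qed
    then obtain u where u: "\<And>t. t \<in> T \<Longrightarrow> g \<otimes> inv (y [^] (u t :: nat)) \<in> torsion G (a * N div t)" by metis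
    have "\<forall>i\<in>T. \<forall>j\<in>T. i \<noteq> j \<longrightarrow> coprime i j" unfolding T_def using primes_coprime by blast
    then obtain j0 where j0: "\<forall>t\<in>T. [j0 = u t] (mod t)" using chinese_remainder_nat[OF finT, of "\<lambda>t. t" u] by auto
    define j where "j = j0 mod N"
    have jlt: "j < N" unfolding j_def using N0 by simp
    have "g \<otimes> inv (y [^] j) \<in> ?K"
    proof (rule mem)
      show "g \<otimes> inv (y [^] j) \<in> carrier G" using g yG by simp
      fix t assume t: "Factorial_Ring.prime t" "t dvd N"
      have tT: "t \<in> T" using t unfolding T_def by simp
      have "[j = j0] (mod t)" unfolding j_def using t(2) by (simp add: cong_def mod_mod_cancel)
      then have jt: "[int (u t) = int j] (mod int t)" using j0 tT by (meson cong_int_iff cong_sym cong_trans)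
      then obtain c where c: "int (u t) - int j = int t * c" by (metis cong_iff_dvd_diff dvdE)
      have sgt: "subgroup (torsion G (a * N div t)) G" using co(6)[OF t] normal_imp_subgroup by blast
      have "y [^] t \<in> torsion G (a * N div t)" using normal_pow_index_mem[OF co(6)[OF t] fin co(5)[OF t] yG] .
      then have "(y [^] t) [^] c \<in> torsion G (a * N div t)" using sgt by (rule subgroup_int_pow_closed[rotated])
      moreover have "(y [^] t) [^] c = y [^] (int (u t) - int j)"
        using yG by (simp add: c int_pow_pow flip: int_pow_int)
      ultimately have "(g \<otimes> inv (y [^] u t)) \<otimes> y [^] (int (u t) - int j) \<in> torsion G (a * N div t)"
        using sgt u[OF tT] subgroup.m_closed by metis
      moreover have "(g \<otimes> inv (y [^] u t)) \<otimes> y [^] (int (u t) - int j) = g \<otimes> inv (y [^] j)"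
      proof -
        have "y [^] (int (u t) - int j) = y [^] u t \<otimes> inv (y [^] j)"
          using yG by (simp add: int_pow_diff int_pow_int)
        then show ?thesis
          using mult_inv_cancel_middle[of g "y [^] u t" "inv (y [^] j)"] g yG by simp
      qed
      ultimately show "g \<otimes> inv (y [^] j) \<in> torsion G (a * N div t)" by simp
    qed
    moreover have "g = (g \<otimes> inv (y [^] j)) \<otimes> y [^] j" using g yG by (simp add: m_assoc)
    ultimately show ?thesis using jlt by blast
  qed
  have inj: "inj_on ?f (?K \<times> {..<N})"
    using inj_on_mult_pow[OF sub yG, of a] cop ordy unfolding torsion_def by simp
  have "?f ` (?K \<times> {..<N}) = carrier G"
    using surj tors_iff yG by (auto simp: image_iff Bex_def) 
  then have "card (?K \<times> {..<N}) = order G" using card_image[OF inj] by (simp add: order_def)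
  then have cardK: "card ?K = a" using ordG N0 by (simp add: card_cartesian_product)
  have "splits G ?K y"
    unfolding splits_def using sub yG cardK ordy ordG cop normal_invE(2)[OF norm yG] by simp
  then show ?thesis using that ordy cardK norm by blast
qed

lemma splits_bij:
  assumes fin: "finite (carrier G)" and sp: "splits G K y"
  shows "bij_betw (\<lambda>(k, j::nat). k \<otimes> y [^] j) (K \<times> {..<local.ord y}) (carrier G)"
proof -
  let ?f = "\<lambda>(k, j::nat). k \<otimes> y [^] j" and ?N = "local.ord y"
  have sub: "subgroup K G" and yG: "y \<in> carrier G" and cop: "coprime (card K) ?N"
    and card: "card K * ?N = order G" using sp unfolding splits_def by auto
  have finK: "finite K" using sub fin by (meson finite_subset subgroup.subset)
  have inj: "inj_on ?f (K \<times> {..<?N})"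
    using inj_on_mult_pow[OF sub yG subgroup_pow_card[OF sub finK] cop] .
  have "?f ` (K \<times> {..<?N}) = carrier G"
  proof (rule card_subset_eq[OF fin])
    show "?f ` (K \<times> {..<?N}) \<subseteq> carrier G" using sub yG subgroup.mem_carrier by fastforce
    show "card (?f ` (K \<times> {..<?N})) = card (carrier G)"
      using card_image[OF inj] card by (simp add: order_def card_cartesian_product)
  qed
  then show ?thesis using inj unfolding bij_betw_def by blast
qed

end

text \<open>An isomorphism of the kernels that carries conjugation by \<open>y\<close> to
  conjugation by \<open>z\<close> extends by sending \<open>k y^j\<close> to
  \<open>(\<phi> k) z^j\<close>.\<close>

lemma splits_iso:
  assumes "group G" "finite (carrier G)" "splits G K y" and "group H" "finite (carrier H)" "splits H L z"
    and ord: "group.ord G y = group.ord H z" and bij: "bij_betw \<phi> K L"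
    and hom: "\<And>a b. a \<in> K \<Longrightarrow> b \<in> K \<Longrightarrow> \<phi> (a \<otimes>\<^bsub>G\<^esub> b) = \<phi> a \<otimes>\<^bsub>H\<^esub> \<phi> b"
    and conj: "\<And>a. a \<in> K \<Longrightarrow> \<phi> (y \<otimes>\<^bsub>G\<^esub> a \<otimes>\<^bsub>G\<^esub> inv\<^bsub>G\<^esub> y) = z \<otimes>\<^bsub>H\<^esub> \<phi> a \<otimes>\<^bsub>H\<^esub> inv\<^bsub>H\<^esub> z"
  shows "G \<cong> H"
proof -
  interpret G: group G by fact
  interpret H: group H by fact
  define N where "N = group.ord G y"
  let ?f = "\<lambda>(k, j::nat). k \<otimes>\<^bsub>G\<^esub> y [^]\<^bsub>G\<^esub> j" and ?g = "\<lambda>(k, j::nat). k \<otimes>\<^bsub>H\<^esub> z [^]\<^bsub>H\<^esub> j"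
  have bf: "bij_betw ?f (K \<times> {..<N}) (carrier G)" unfolding N_def by (rule G.splits_bij[OF assms(2,3)])
  have bg: "bij_betw ?g (L \<times> {..<N}) (carrier H)"
    unfolding N_def ord by (rule H.splits_bij[OF assms(5,6)])
  have subK: "subgroup K G" and yG: "y \<in> carrier G" and cK: "\<And>k. k \<in> K \<Longrightarrow> y \<otimes>\<^bsub>G\<^esub> k \<otimes>\<^bsub>G\<^esub> inv\<^bsub>G\<^esub> y \<in> K"
    and cardK: "card K * N = order G"
    using assms(3) unfolding splits_def N_def by auto
  have subL: "subgroup L H" and zH: "z \<in> carrier H" using assms(6) unfolding splits_def by auto
  have N0: "N > 0" using cardK assms(2) G.order_gt_0_iff_finite by (metis mult_0_right neq0_conv)
  have KG: "k \<in> carrier G" if "k \<in> K" for k using that subK by (rule subgroup.mem_carrier[rotated])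
  have phiL: "\<phi> k \<in> L" if "k \<in> K" for k using that bij by (auto simp: bij_betw_def)
  have LH: "\<phi> k \<in> carrier H" if "k \<in> K" for k using phiL[OF that] subL by (rule subgroup.mem_carrier[rotated])
  define \<Phi> where "\<Phi> g = ?g (map_prod \<phi> id (inv_into (K \<times> {..<N}) ?f g))" for g
  have "bij_betw \<Phi> (carrier G) (carrier H)"
  proof -
    have b1: "bij_betw (inv_into (K \<times> {..<N}) ?f) (carrier G) (K \<times> {..<N})"
      by (rule bij_betw_inv_into[OF bf])
    have b2: "bij_betw (map_prod \<phi> id) (K \<times> {..<N}) (L \<times> {..<N})"
      using bij by (intro bij_betw_map_prod) auto
    show ?thesis
      using bij_betw_trans[OF bij_betw_trans[OF b1 b2] bg] by (simp add: \<Phi>_def[abs_def] comp_def)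
  qed
  \<comment> \<open>Equal orders of \<open>y\<close> and \<open>z\<close> allow arbitrary exponents
    here, not only those below \<open>N\<close>; the product rule produces the exponent
    \<open>i + j\<close>.\<close>
  moreover have \<Phi>: "\<Phi> (k \<otimes>\<^bsub>G\<^esub> y [^]\<^bsub>G\<^esub> i) = \<phi> k \<otimes>\<^bsub>H\<^esub> z [^]\<^bsub>H\<^esub> i" if k: "k \<in> K" for k and i :: nat
  proof -
    have e: "y [^]\<^bsub>G\<^esub> i = y [^]\<^bsub>G\<^esub> (i mod N)" "z [^]\<^bsub>H\<^esub> i = z [^]\<^bsub>H\<^esub> (i mod N)"
      using G.pow_eq_pow_iff[OF yG, of i "i mod N"] H.pow_eq_pow_iff[OF zH, of i "i mod N"]
      by (simp_all add: N_def cong_def ord)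
    have "(k, i mod N) \<in> K \<times> {..<N}" using k N0 by simp
    from bij_betw_inv_into_left[OF bf this] have "inv_into (K \<times> {..<N}) ?f (k \<otimes>\<^bsub>G\<^esub> y [^]\<^bsub>G\<^esub> (i mod N)) = (k, i mod N)"
      by simp
    then show ?thesis unfolding e \<Phi>_def by simp
  qed
  have conj_iter: "y [^]\<^bsub>G\<^esub> i \<otimes>\<^bsub>G\<^esub> k \<otimes>\<^bsub>G\<^esub> inv\<^bsub>G\<^esub> (y [^]\<^bsub>G\<^esub> i) \<in> K \<and>
     \<phi> (y [^]\<^bsub>G\<^esub> i \<otimes>\<^bsub>G\<^esub> k \<otimes>\<^bsub>G\<^esub> inv\<^bsub>G\<^esub> (y [^]\<^bsub>G\<^esub> i)) = z [^]\<^bsub>H\<^esub> i \<otimes>\<^bsub>H\<^esub> \<phi> k \<otimes>\<^bsub>H\<^esub> inv\<^bsub>H\<^esub> (z [^]\<^bsub>H\<^esub> i)"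
    if k: "k \<in> K" for k and i :: nat
    using k
  proof (induction i arbitrary: k)
    case 0
    then show ?case using KG LH by simp
  next
    case (Suc i)
    let ?k = "y \<otimes>\<^bsub>G\<^esub> k \<otimes>\<^bsub>G\<^esub> inv\<^bsub>G\<^esub> y"
    have k': "?k \<in> K" using cK Suc.prems by blast
    have "y [^]\<^bsub>G\<^esub> Suc i \<otimes>\<^bsub>G\<^esub> k \<otimes>\<^bsub>G\<^esub> inv\<^bsub>G\<^esub> (y [^]\<^bsub>G\<^esub> Suc i) = y [^]\<^bsub>G\<^esub> i \<otimes>\<^bsub>G\<^esub> ?k \<otimes>\<^bsub>G\<^esub> inv\<^bsub>G\<^esub> (y [^]\<^bsub>G\<^esub> i)"
      using G.conj_conj[of "y [^]\<^bsub>G\<^esub> i" y k] yG KG[OF Suc.prems] by simp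
    moreover have "z [^]\<^bsub>H\<^esub> Suc i \<otimes>\<^bsub>H\<^esub> \<phi> k \<otimes>\<^bsub>H\<^esub> inv\<^bsub>H\<^esub> (z [^]\<^bsub>H\<^esub> Suc i) =
       z [^]\<^bsub>H\<^esub> i \<otimes>\<^bsub>H\<^esub> \<phi> ?k \<otimes>\<^bsub>H\<^esub> inv\<^bsub>H\<^esub> (z [^]\<^bsub>H\<^esub> i)"
      using H.conj_conj[of "z [^]\<^bsub>H\<^esub> i" z "\<phi> k"] zH LH[OF Suc.prems] conj[OF Suc.prems] by simp
    ultimately show ?case using Suc.IH[OF k'] by simp
  qed
  have "\<Phi> \<in> hom G H"
  proof (rule homI)
    show "\<Phi> g \<in> carrier H" if "g \<in> carrier G" for g
      using that \<open>bij_betw \<Phi> (carrier G) (carrier H)\<close> by (auto simp: bij_betw_def)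
    fix g h assume gh: "g \<in> carrier G" "h \<in> carrier G"
    obtain k i where k: "k \<in> K" "g = k \<otimes>\<^bsub>G\<^esub> y [^]\<^bsub>G\<^esub> (i::nat)" using gh(1) bf by (force simp: bij_betw_def image_iff)
    obtain l j where l: "l \<in> K" "h = l \<otimes>\<^bsub>G\<^esub> y [^]\<^bsub>G\<^esub> (j::nat)" using gh(2) bf by (force simp: bij_betw_def image_iff)
    let ?l = "y [^]\<^bsub>G\<^esub> i \<otimes>\<^bsub>G\<^esub> l \<otimes>\<^bsub>G\<^esub> inv\<^bsub>G\<^esub> (y [^]\<^bsub>G\<^esub> i)"
    have "g \<otimes>\<^bsub>G\<^esub> h = (k \<otimes>\<^bsub>G\<^esub> ?l) \<otimes>\<^bsub>G\<^esub> y [^]\<^bsub>G\<^esub> (i + j)"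
      using KG k l yG by (simp add: G.m_assoc flip: G.nat_pow_mult)
        (metis G.inv_closed G.l_inv G.l_one G.m_assoc G.m_closed G.nat_pow_closed)
    then have "\<Phi> (g \<otimes>\<^bsub>G\<^esub> h) = \<phi> (k \<otimes>\<^bsub>G\<^esub> ?l) \<otimes>\<^bsub>H\<^esub> z [^]\<^bsub>H\<^esub> (i + j)"
      using \<Phi> k(1) conj_iter[OF l(1), of i] subK by (simp add: subgroup.m_closed)
    also have "\<phi> (k \<otimes>\<^bsub>G\<^esub> ?l) = \<phi> k \<otimes>\<^bsub>H\<^esub> (z [^]\<^bsub>H\<^esub> i \<otimes>\<^bsub>H\<^esub> \<phi> l \<otimes>\<^bsub>H\<^esub> inv\<^bsub>H\<^esub> (z [^]\<^bsub>H\<^esub> i))"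
      using hom[OF k(1), of ?l] conj_iter[OF l(1), of i] by simp
    also have "\<dots> \<otimes>\<^bsub>H\<^esub> z [^]\<^bsub>H\<^esub> (i + j) = (\<phi> k \<otimes>\<^bsub>H\<^esub> z [^]\<^bsub>H\<^esub> i) \<otimes>\<^bsub>H\<^esub> (\<phi> l \<otimes>\<^bsub>H\<^esub> z [^]\<^bsub>H\<^esub> j)"
      using LH k l zH by (simp add: H.m_assoc flip: H.nat_pow_mult)
        (metis H.inv_closed H.l_inv H.l_one H.m_assoc H.m_closed H.nat_pow_closed)
    also have "\<dots> = \<Phi> g \<otimes>\<^bsub>H\<^esub> \<Phi> h" using \<Phi> k l by simp
    finally show "\<Phi> (g \<otimes>\<^bsub>G\<^esub> h) = \<Phi> g \<otimes>\<^bsub>H\<^esub> \<Phi> h" .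
  qed
  ultimately show ?thesis unfolding is_iso_def iso_def by blast
qed

subsection \<open>Squarefree order\<close>

lemma dvd_prime_if_squarefree:
  fixes d q :: nat
  assumes "squarefree d" and "\<And>t. Factorial_Ring.prime t \<Longrightarrow> t dvd d \<Longrightarrow> t = q"
  shows "d dvd q"
proof (cases "d = 1")
  case False
  then obtain t where "Factorial_Ring.prime t" "t dvd d" using prime_factor_nat by blast
  then have q: "Factorial_Ring.prime q" "q dvd d" using assms(2) by auto
  then obtain c where c: "d = q * c" by blast
  have "c = 1"
  proof (rule ccontr)
    assume "c \<noteq> 1"
    then obtain s where s: "Factorial_Ring.prime s" "s dvd c" using prime_factor_nat by blast
    then have "s = q" using assms(2) c by simp
    then have "q\<^sup>2 dvd d" using s c by (simp add: power2_eq_square)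
    then show False using squarefreeD[OF assms(1), of q] not_prime_unit[of q] q(1) by auto
  qed
  then show ?thesis using c by simp
qed simp

text \<open>The order of \<open>k\<close> divides \<open>gcd n (p - 1)\<close>, a squarefree number
  with no prime factor other than \<open>q\<close>.\<close>

lemma power_root_exponent_prime:
  fixes k n p q :: nat
  assumes p: "Factorial_Ring.prime p" and "[k ^ n = 1] (mod p)" and "squarefree n"
    and "\<And>t. Factorial_Ring.prime t \<Longrightarrow> t dvd n \<Longrightarrow> t dvd p - 1 \<Longrightarrow> t = q"
  shows "[k ^ q = 1] (mod p)"
proof -
  have n0: "n > 0" using assms(3) by (metis gr0I not_squarefree_0)
  have "coprime k p"
    using cong_imp_coprime[OF cong_sym[OF assms(2)]] n0 by simp
  then have "[k ^ (p - 1) = 1] (mod p)"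
    using p fermat_theorem[of p k] coprime_common_divisor_nat[of k p p] prime_gt_1_nat[OF p] by auto
  then have *: "[k ^ gcd n (p - 1) = 1] (mod p)"
    by (rule cong_power_gcd_eq_1[OF assms(2)])
  have "gcd n (p - 1) dvd q"
    by (rule dvd_prime_if_squarefree)
      (use assms(3,4) squarefree_mono in \<open>auto intro: squarefree_mono\<close>)
  then show ?thesis using * by (meson dvd_trans ord_divides)
qed

text \<open>\<open>x^q = 1\<close> has at most \<open>q\<close> solutions modulo \<open>p\<close>,
  and the powers of \<open>k\<close> already supply \<open>q\<close> of them.\<close>

lemma prime_order_roots_are_powers:
  fixes p q k l :: nat
  assumes p: "Factorial_Ring.prime p" and q: "Factorial_Ring.prime q"
    and k: "[k ^ q = 1] (mod p)" "[k \<noteq> 1] (mod p)" and l: "[l ^ q = 1] (mod p)"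
  shows "\<exists>j. [l = k ^ j] (mod p)"
proof -
  have "Pocklington.ord p k dvd q" using k(1) by (simp only: ord_divides)
  moreover have "Pocklington.ord p k \<noteq> 1" using k(2) ord_works[of k p] by (metis power_one_right)
  ultimately have ordk: "Pocklington.ord p k = q" using q by (metis prime_nat_iff)
  have cop: "coprime p k" using ordk q by (metis not_prime_0 ord_eq_0)
  let ?R = "{x \<in> {..<p}. [x ^ q = 1] (mod p)}"
  let ?f = "\<lambda>j. k ^ j mod p"
  have p0: "p > 0" "q > 0" using p q by (simp_all add: prime_gt_0_nat)
  have "inj_on ?f {..<q}"
  proof (rule inj_onI)
    fix i j assume "i \<in> {..<q}" "j \<in> {..<q}" "k ^ i mod p = k ^ j mod p"
    then show "i = j" using order_divides_expdiff[OF cop, of i j] ordk by (simp add: cong_def)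
  qed
  then have "card (?f ` {..<q}) = q" by (simp add: card_image)
  moreover have "card ?R \<le> q" using roots_mod_prime_bound[OF p p0(2)] .
  moreover have "?f ` {..<q} \<subseteq> ?R"
  proof
    fix x assume "x \<in> ?f ` {..<q}"
    then obtain j where j: "x = k ^ j mod p" by blast
    have "[(k ^ j) ^ q = 1] (mod p)"
      using cong_pow[OF k(1), of j] by (simp add: mult.commute flip: power_mult)
    then show "x \<in> ?R" using p0 by (simp add: j cong_def power_mod)
  qed
  ultimately have "?f ` {..<q} = ?R" by (intro card_seteq) auto
  moreover have "l mod p \<in> ?R" using l p0 by (simp add: cong_def power_mod)
  ultimately obtain j where "l mod p = k ^ j mod p" by auto
  then show ?thesis by (auto simp: cong_def)
qed

text \<open>Allows a generator of order \<open>N\<close> to be replaced by another one whose action,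
  of order \<open>q\<close>, is a prescribed power: \<open>i\<close> is chosen as \<open>j\<close>
  modulo \<open>q\<close> and as 1 modulo \<open>N / q\<close>.\<close>

lemma coprime_representative:
  fixes q N j :: nat
  assumes "Factorial_Ring.prime q" "q dvd N" "squarefree N" "\<not> q dvd j"
  obtains i where "[i = j] (mod q)" "coprime i N"
proof -
  obtain c where c: "N = q * c" using assms(2) by blast
  have "\<not> q dvd c" using squarefreeD[OF assms(3), of q] assms(1) c by (auto simp: power2_eq_square)
  then have qc: "coprime q c" using assms(1) by (simp add: prime_imp_coprime)
  obtain i where i: "[i = j] (mod q)" "[i = 1] (mod c)"
    using binary_chinese_remainder_nat[OF qc, of j 1] by blast
  have "coprime j q" using prime_imp_coprime[OF assms(1,4)] by (simp add: coprime_commute)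
  then have "coprime i q" using cong_imp_coprime[OF cong_sym[OF i(1)]] by simp
  moreover have "coprime i c" using cong_imp_coprime[OF cong_sym[OF i(2)]] by simp
  ultimately show ?thesis using that i(1) c by simp
qed

definition commuting :: "('a, 'b) monoid_scheme \<Rightarrow> bool" where
  "commuting G \<longleftrightarrow> (\<forall>x\<in>carrier G. \<forall>y\<in>carrier G. x \<otimes>\<^bsub>G\<^esub> y = y \<otimes>\<^bsub>G\<^esub> x)"

definition exponent_dvd :: "('a, 'b) monoid_scheme \<Rightarrow> nat \<Rightarrow> bool" where
  "exponent_dvd G d \<longleftrightarrow> torsion G d = carrier G"

text \<open>Stated for all solutions of \<open>x^d = 1\<close> rather than for a Sylow subgroup, so
  that its invariance under isomorphism is plain. For a prime \<open>d\<close> it tells whether the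
  elements of order \<open>d\<close> are central.\<close>

definition central_torsion :: "('a, 'b) monoid_scheme \<Rightarrow> nat \<Rightarrow> bool" where
  "central_torsion G d \<longleftrightarrow> (\<forall>x\<in>torsion G d. \<forall>y\<in>carrier G. x \<otimes>\<^bsub>G\<^esub> y = y \<otimes>\<^bsub>G\<^esub> x)"

context group
begin

lemma torsion_conj:
  assumes "x \<in> torsion G d" "g \<in> carrier G"
  shows "g \<otimes> x \<otimes> inv g \<in> torsion G d"
  using assms by (auto simp: torsion_def conj_pow_closed)

lemma torsion_normal:
  assumes "subgroup (torsion G d) G"
  shows "torsion G d \<lhd> G"
  using assms torsion_conj unfolding normal_inv_iff by blast

lemma torsion_cyclic:
  assumes p: "p > 0" and card: "card (torsion G p) = p"
    and x: "x \<in> carrier G" "local.ord x = p"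
  shows "torsion G p = {x [^] (i::nat) | i. True}"
proof -
  have fin: "finite (torsion G p)" using card p by (metis card.infinite less_irrefl)
  have sub: "(\<lambda>i. x [^] (i::nat)) ` {..<p} \<subseteq> torsion G p"
  proof -
    have "(x [^] i) [^] p = \<one>" for i :: nat
      using x pow_ord_eq_1[OF x(1)] by (metis nat_pow_comm nat_pow_one nat_pow_pow mult.commute)
    then show ?thesis using x unfolding torsion_def by auto
  qed
  have "inj_on (\<lambda>i. x [^] (i::nat)) {..<p}"
    by (rule inj_onI) (use pow_eq_pow_iff[OF x(1)] x(2) in \<open>auto simp: cong_def\<close>)
  then have "card ((\<lambda>i. x [^] (i::nat)) ` {..<p}) = p" by (simp add: card_image)
  then have "(\<lambda>i. x [^] (i::nat)) ` {..<p} = torsion G p" using sub fin card by (metis card_subset_eq)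
  moreover have "x [^] i \<in> (\<lambda>i. x [^] (i::nat)) ` {..<p}" for i :: nat
    by (rule image_eqI[of _ _ "i mod p"])
      (use pow_eq_pow_iff[OF x(1)] x(2) p in \<open>auto simp: cong_def\<close>)
  ultimately show ?thesis by blast
qed

text \<open>Centrality is a second source of the fusion condition, available also when an edge ends
  in \<open>t\<close>.\<close>

lemma normal_index_if_central:
  assumes fin: "finite (carrier G)" and t: "Factorial_Ring.prime t" "order G = t * m" "\<not> t dvd m"
    and "central_torsion G t"
  shows "normal_index G t"
proof -
  obtain x where x: "x \<in> carrier G" "local.ord x = t" using Cauchy_prime[OF fin t(1)] t(2) by auto
  have "x \<in> torsion G t" using x pow_ord_eq_1[OF x(1)] unfolding torsion_def by simp
  then have "\<exists>K. K \<lhd> G \<and> card K = m"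
    using transfer_normal_complement[OF fin t x] assms(5) x unfolding central_torsion_def
    by (metis conj_eq_iff_commute)
  then show ?thesis using t(2) unfolding normal_index_def by (metis mult.commute)
qed

lemma splits_commuting:
  assumes fin: "finite (carrier G)" and sp: "splits G K y"
    and K: "\<And>a b. a \<in> K \<Longrightarrow> b \<in> K \<Longrightarrow> a \<otimes> b = b \<otimes> a" and y: "\<And>a. a \<in> K \<Longrightarrow> y \<otimes> a = a \<otimes> y"
  shows "commuting G"
  unfolding commuting_def
proof (intro ballI)
  have sub: "subgroup K G" and yG: "y \<in> carrier G" using sp unfolding splits_def by auto
  have KG: "k \<in> carrier G" if "k \<in> K" for k using that sub by (rule subgroup.mem_carrier[rotated])
  have yp: "y [^] (j::nat) \<otimes> a = a \<otimes> y [^] j" if "a \<in> K" for a j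
    using group_commutes_pow[OF y[OF that] yG KG[OF that]] .
  fix g h assume gh: "g \<in> carrier G" "h \<in> carrier G"
  obtain k i where k: "k \<in> K" "g = k \<otimes> y [^] (i::nat)"
    using gh(1) splits_bij[OF fin sp] by (force simp: bij_betw_def image_iff)
  obtain l j where l: "l \<in> K" "h = l \<otimes> y [^] (j::nat)"
    using gh(2) splits_bij[OF fin sp] by (force simp: bij_betw_def image_iff)
  have eq: "(a \<otimes> y [^] i) \<otimes> (b \<otimes> y [^] j) = (a \<otimes> b) \<otimes> y [^] (i + j)" if "a \<in> K" "b \<in> K" for a b and i j :: nat
  proof -
    have "(a \<otimes> y [^] i) \<otimes> (b \<otimes> y [^] j) = a \<otimes> (y [^] i \<otimes> b) \<otimes> y [^] j"
      using KG that yG by (simp add: m_assoc)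
    also have "\<dots> = (a \<otimes> b) \<otimes> y [^] (i + j)"
      using KG that yG by (simp add: yp m_assoc nat_pow_mult)
    finally show ?thesis .
  qed
  show "g \<otimes> h = h \<otimes> g"
    using eq[OF k(1) l(1), of i j] eq[OF l(1) k(1), of j i] K[OF k(1) l(1)] k(2) l(2)
    by (simp add: add.commute)
qed

lemma splits_pow:
  assumes sp: "splits G K y" and norm: "K \<lhd> G" and "coprime i (local.ord y)" and "i > 0"
  shows "splits G K (y [^] i)" "local.ord (y [^] i) = local.ord y"
proof -
  have yG: "y \<in> carrier G" using sp unfolding splits_def by auto
  show o: "local.ord (y [^] i) = local.ord y"
    using ord_pow_gen[OF yG, of i] assms(3,4) by (simp add: gcd.commute)
  show "splits G K (y [^] i)"
    using sp normal_invE(2)[OF norm, of "y [^] i"] yG unfolding splits_def o by simp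
qed

end

lemma cyclic_bij:
  assumes "group G" "group H" "x \<in> carrier G" "z \<in> carrier H" "group.ord G x = group.ord H z"
    and K: "K = {x [^]\<^bsub>G\<^esub> (i::nat) | i. True}" and L: "L = {z [^]\<^bsub>H\<^esub> (i::nat) | i. True}"
  obtains \<phi> where "bij_betw \<phi> K L" "\<And>i::nat. \<phi> (x [^]\<^bsub>G\<^esub> i) = z [^]\<^bsub>H\<^esub> i"
proof -
  interpret G: group G by fact
  interpret H: group H by fact
  define \<phi> where "\<phi> a = z [^]\<^bsub>H\<^esub> (SOME i::nat. a = x [^]\<^bsub>G\<^esub> i)" for a
  have iff: "x [^]\<^bsub>G\<^esub> i = x [^]\<^bsub>G\<^esub> j \<longleftrightarrow> z [^]\<^bsub>H\<^esub> i = z [^]\<^bsub>H\<^esub> j" for i j :: nat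
    using G.pow_eq_pow_iff[OF assms(3)] H.pow_eq_pow_iff[OF assms(4)] assms(5) by simp
  have \<phi>: "\<phi> (x [^]\<^bsub>G\<^esub> i) = z [^]\<^bsub>H\<^esub> i" for i :: nat
  proof -
    have "x [^]\<^bsub>G\<^esub> i = x [^]\<^bsub>G\<^esub> (SOME j::nat. x [^]\<^bsub>G\<^esub> i = x [^]\<^bsub>G\<^esub> j)"
      by (rule someI[of "\<lambda>j. x [^]\<^bsub>G\<^esub> i = x [^]\<^bsub>G\<^esub> j" i]) simp
    then show ?thesis unfolding \<phi>_def using iff by metis
  qed
  have "bij_betw \<phi> K L"
    unfolding bij_betw_def
  proof
    show "inj_on \<phi> K" by (rule inj_onI) (use K \<phi> iff in auto)
    show "\<phi> ` K = L" unfolding K L using \<phi> by (auto simp: image_iff) (metis \<phi>)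
  qed
  then show ?thesis using that \<phi> by blast
qed

text \<open>With a cyclic kernel the action is recorded by the single exponent \<open>k\<close>;
  matching the generators of the kernels intertwines two actions with the same exponent.\<close>

lemma splits_iso_cyclic:
  assumes G: "group G" "finite (carrier G)" "splits G K y" and H: "group H" "finite (carrier H)" "splits H L z"
    and ord: "group.ord G y = group.ord H z"
    and x: "x \<in> carrier G" "K = {x [^]\<^bsub>G\<^esub> (i::nat) | i. True}"
    and w: "w \<in> carrier H" "L = {w [^]\<^bsub>H\<^esub> (i::nat) | i. True}"
    and xw: "group.ord G x = group.ord H w"
    and conj: "y \<otimes>\<^bsub>G\<^esub> x \<otimes>\<^bsub>G\<^esub> inv\<^bsub>G\<^esub> y = x [^]\<^bsub>G\<^esub> (k::nat)" "z \<otimes>\<^bsub>H\<^esub> w \<otimes>\<^bsub>H\<^esub> inv\<^bsub>H\<^esub> z = w [^]\<^bsub>H\<^esub> k"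
  shows "G \<cong> H"
proof -
  interpret G: group G by fact
  interpret H: group H by fact
  obtain \<phi> where bij: "bij_betw \<phi> K L" and \<phi>: "\<And>i::nat. \<phi> (x [^]\<^bsub>G\<^esub> i) = w [^]\<^bsub>H\<^esub> i"
    using cyclic_bij[OF G(1) H(1) x(1) w(1) xw x(2) w(2)] by blast
  have yG: "y \<in> carrier G" and zH: "z \<in> carrier H" using G(3) H(3) unfolding splits_def by auto
  show ?thesis
  proof (rule splits_iso[OF G H ord bij])
    show "\<phi> (a \<otimes>\<^bsub>G\<^esub> b) = \<phi> a \<otimes>\<^bsub>H\<^esub> \<phi> b" if "a \<in> K" "b \<in> K" for a b
      using that x w \<phi> by (auto simp: G.nat_pow_mult H.nat_pow_mult)
    fix a assume "a \<in> K"
    then obtain i :: nat where a: "a = x [^]\<^bsub>G\<^esub> i" using x(2) by blast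
    have "y \<otimes>\<^bsub>G\<^esub> a \<otimes>\<^bsub>G\<^esub> inv\<^bsub>G\<^esub> y = x [^]\<^bsub>G\<^esub> (k * i)"
      using G.conj_pow_closed[OF yG x(1), of i] conj(1) x(1) by (simp add: a G.nat_pow_pow)
    moreover have "z \<otimes>\<^bsub>H\<^esub> w [^]\<^bsub>H\<^esub> i \<otimes>\<^bsub>H\<^esub> inv\<^bsub>H\<^esub> z = w [^]\<^bsub>H\<^esub> (k * i)"
      using H.conj_pow_closed[OF zH w(1), of i] conj(2) w(1) by (simp add: H.nat_pow_pow)
    ultimately show "\<phi> (y \<otimes>\<^bsub>G\<^esub> a \<otimes>\<^bsub>G\<^esub> inv\<^bsub>G\<^esub> y) = z \<otimes>\<^bsub>H\<^esub> \<phi> a \<otimes>\<^bsub>H\<^esub> inv\<^bsub>H\<^esub> z"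
      using \<phi> a by simp
  qed
qed

text \<open>All Sylow subgroups are central, so every prime splits off and the kernel
  \<open>torsion G 1\<close> is trivial: such a group is cyclic, generated by
  \<open>y\<close>.\<close>

lemma (in group) commuting_squarefree_split:
  assumes fin: "finite (carrier G)" and "order G = n" "commuting G" and sqf: "squarefree n"
  obtains y where "splits G {\<one>} y" "local.ord y = n"
proof -
  have "normal_index G t" if t: "Factorial_Ring.prime t" "t dvd n" for t
  proof -
    obtain m where m: "n = t * m" using t(2) by blast
    have "\<not> t dvd m" using squarefreeD[OF sqf, of t] t(1) m by (auto simp: power2_eq_square)
    moreover have "central_torsion G t"
      using assms(3) unfolding central_torsion_def commuting_def torsion_def by blast
    ultimately show ?thesis using normal_index_if_central[OF fin t(1)] assms(2) m by blast
  qed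
  moreover have "torsion G 1 = {\<one>}" unfolding torsion_def by auto
  ultimately show ?thesis using split_structure[OF fin, of 1 n thesis] assms(2) sqf that by simp
qed

lemma commuting_squarefree_iso:
  assumes "group G" "finite (carrier G)" "order G = n" "commuting G"
    and "group H" "finite (carrier H)" "order H = n" "commuting H" and sqf: "squarefree n"
  shows "G \<cong> H"
proof -
  obtain y where y: "splits G {\<one>\<^bsub>G\<^esub>} y" "group.ord G y = n" using group.commuting_squarefree_split[OF assms(1-4) sqf] by blast
  obtain z where z: "splits H {\<one>\<^bsub>H\<^esub>} z" "group.ord H z = n" using group.commuting_squarefree_split[OF assms(5-8) sqf] by blast
  interpret G: group G by fact
  interpret H: group H by fact
  have yz: "y \<in> carrier G" "z \<in> carrier H" using y z unfolding splits_def by auto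
  show ?thesis
    by (rule splits_iso_cyclic[OF assms(1,2) y(1) assms(5,6) z(1), where x = "\<one>\<^bsub>G\<^esub>" and w = "\<one>\<^bsub>H\<^esub>" and k = 1])
      (use y z yz in simp_all)
qed

text \<open>Every prime but \<open>p\<close> splits off, leaving a kernel of order \<open>p\<close>
  on which \<open>y\<close> acts by an exponent \<open>k\<close>. Since \<open>q\<close> is the only
  possible source of an edge into \<open>p\<close>, \<open>k\<close> is a \<open>q\<close>-th root
  of unity, and \<open>k = 1\<close> would make the group abelian.\<close>

lemma (in group) noncommuting_squarefree_split:
  assumes fin: "finite (carrier G)" and ordG: "order G = n" and nc: "\<not> commuting G"
    and p: "Factorial_Ring.prime p" "p dvd n" and N: "n = p * N" and cop: "coprime p N" and sqfN: "squarefree N"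
    and q: "Factorial_Ring.prime q"
    and uniq: "\<And>t. Factorial_Ring.prime t \<Longrightarrow> t dvd n \<Longrightarrow> t dvd p - 1 \<Longrightarrow> t = q"
    and idx: "\<And>t. Factorial_Ring.prime t \<Longrightarrow> t dvd n \<Longrightarrow> t \<noteq> p \<Longrightarrow> normal_index G t"
  shows "\<exists>x y k. splits G (torsion G p) y \<and> torsion G p \<lhd> G \<and> local.ord y = N \<and> x \<in> carrier G \<and> local.ord x = p
      \<and> torsion G p = {x [^] (i::nat) | i. True} \<and> y \<otimes> x \<otimes> inv y = x [^] (k::nat)
      \<and> [k ^ q = 1] (mod p) \<and> [k \<noteq> 1] (mod p) \<and> q dvd N"
proof -
  have pN: "\<not> p dvd N" using p(1) cop by (metis coprime_absorb_left not_prime_unit)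
  have "normal_index G t" if "Factorial_Ring.prime t" "t dvd N" for t
    using idx[of t] that N pN by auto
  then obtain y where y: "splits G (torsion G p) y" "local.ord y = N" "card (torsion G p) = p" "torsion G p \<lhd> G"
    using split_structure[OF fin, of p N] ordG N cop sqfN by auto
  obtain x where x: "x \<in> carrier G" "local.ord x = p" using Cauchy_prime[OF fin p(1)] p(2) ordG by auto
  have pows: "torsion G p = {x [^] (i::nat) | i. True}" by (rule torsion_cyclic[OF prime_gt_0_nat[OF p(1)] y(3) x])
  have yG: "y \<in> carrier G" using y(1) unfolding splits_def by auto
  have "x \<in> torsion G p" using x pow_ord_eq_1[OF x(1)] unfolding torsion_def by simp
  then have "y \<otimes> x \<otimes> inv y \<in> torsion G p" by (rule torsion_conj[OF _ yG])
  then obtain k :: nat where k: "y \<otimes> x \<otimes> inv y = x [^] k" using pows by blast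
  have kN: "[k ^ N = 1] (mod p)"
    using conj_pow_exponent_cong[OF yG x(1) k, of N] pow_ord_eq_1[OF yG] x(2) y(2) by simp
  have kq: "[k ^ q = 1] (mod p)"
    by (rule power_root_exponent_prime[OF p(1) kN sqfN]) (use uniq N in auto)
  have k1: "[k \<noteq> 1] (mod p)"
  proof
    assume "[k = 1] (mod p)"
    then have "x [^] k = x [^] (1::nat)" using pow_eq_pow_iff[OF x(1)] x(2) by blast
    then have "x \<otimes> y = y \<otimes> x" using k conj_eq_iff_commute[OF yG x(1)] x(1) by simp
    then have "x [^] (i::nat) \<otimes> y = y \<otimes> x [^] i" for i
      using group_commutes_pow[OF _ x(1) yG] by blast
    then have "commuting G"
      by (intro splits_commuting[OF fin y(1)]) (auto simp: pows x nat_pow_comm)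
    then show False using nc by blast
  qed
  have "q dvd N"
  proof (rule ccontr)
    assume "\<not> q dvd N"
    then have "coprime N q" using prime_imp_coprime[OF q] by (simp add: coprime_commute)
    then have "[k = 1] (mod p)" using cong_power_gcd_eq_1[OF kN kq] by simp
    then show False using k1 by blast
  qed
  then show ?thesis using x y pows k kq k1 by blast
qed

text \<open>The two actions are nontrivial \<open>q\<close>-th roots of unity \<open>k\<close> and
  \<open>l\<close>, hence \<open>l = k^j\<close>. Replacing \<open>y\<close> by \<open>y^i\<close>
  with \<open>i = j\<close> modulo \<open>q\<close> and \<open>i\<close> prime to \<open>N\<close>
  gives both groups the exponent \<open>l\<close>.\<close>

lemma noncommuting_squarefree_iso:
  assumes G: "group G" "finite (carrier G)" "order G = n" "\<not> commuting G"
    and H: "group H" "finite (carrier H)" "order H = n" "\<not> commuting H"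
    and sqf: "squarefree n" and p: "Factorial_Ring.prime p" "p dvd n" and q: "Factorial_Ring.prime q"
    and uniq: "\<And>t. Factorial_Ring.prime t \<Longrightarrow> t dvd n \<Longrightarrow> t dvd p - 1 \<Longrightarrow> t = q"
    and idxG: "\<And>t. Factorial_Ring.prime t \<Longrightarrow> t dvd n \<Longrightarrow> t \<noteq> p \<Longrightarrow> normal_index G t"
    and idxH: "\<And>t. Factorial_Ring.prime t \<Longrightarrow> t dvd n \<Longrightarrow> t \<noteq> p \<Longrightarrow> normal_index H t"
  shows "G \<cong> H"
proof -
  obtain N where N: "n = p * N" using p(2) by blast
  have pN: "\<not> p dvd N" using squarefreeD[OF sqf, of p] p(1) N by (auto simp: power2_eq_square)
  then have cop: "coprime p N" using p(1) by (simp add: prime_imp_coprime)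
  have sqfN: "squarefree N" using sqf N by (metis dvd_triv_right squarefree_mono)
  obtain x y k where G': "splits G (torsion G p) y" "torsion G p \<lhd> G" "group.ord G y = N" "x \<in> carrier G" "group.ord G x = p"
     "torsion G p = {x [^]\<^bsub>G\<^esub> (i::nat) | i. True}" "y \<otimes>\<^bsub>G\<^esub> x \<otimes>\<^bsub>G\<^esub> inv\<^bsub>G\<^esub> y = x [^]\<^bsub>G\<^esub> (k::nat)"
     "[k ^ q = 1] (mod p)" "[k \<noteq> 1] (mod p)" "q dvd N"
    using group.noncommuting_squarefree_split[OF G p N cop sqfN q uniq idxG] by blast
  obtain w z l where H': "splits H (torsion H p) z" "torsion H p \<lhd> H" "group.ord H z = N" "w \<in> carrier H" "group.ord H w = p"
     "torsion H p = {w [^]\<^bsub>H\<^esub> (i::nat) | i. True}" "z \<otimes>\<^bsub>H\<^esub> w \<otimes>\<^bsub>H\<^esub> inv\<^bsub>H\<^esub> z = w [^]\<^bsub>H\<^esub> (l::nat)"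
     "[l ^ q = 1] (mod p)" "[l \<noteq> 1] (mod p)"
    using group.noncommuting_squarefree_split[OF H p N cop sqfN q uniq idxH] by blast
  interpret G: group G by fact
  interpret H: group H by fact
  obtain j where j: "[l = k ^ j] (mod p)"
    using prime_order_roots_are_powers[OF p(1) q G'(8,9) H'(8)] by blast
  have kper: "[k ^ i = k ^ i'] (mod p)" if "[i = i'] (mod q)" for i i'
  proof -
    have "Pocklington.ord p k dvd q" using G'(8) by (simp only: ord_divides)
    then have "[i = i'] (mod Pocklington.ord p k)" using that cong_dvd_modulus_nat by blast
    moreover have "coprime p k" using cong_imp_coprime[OF cong_sym[OF G'(8)]] q
      by (simp add: coprime_commute prime_gt_0_nat)
    ultimately show ?thesis by (simp add: order_divides_expdiff)
  qed
  have "\<not> q dvd j"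
  proof
    assume "q dvd j"
    then have "[k ^ j = k ^ 0] (mod p)" by (intro kper) (simp add: cong_0_iff)
    then have "[l = 1] (mod p)" using cong_trans[OF j] by simp
    then show False using H'(9) by blast
  qed
  then obtain i where i: "[i = j] (mod q)" "coprime i N"
    using coprime_representative[OF q G'(10) sqfN] by blast
  have "i > 0" using i(1) \<open>\<not> q dvd j\<close> by (metis cong_0_iff cong_sym gr0I)
  have yG: "y \<in> carrier G" using G'(1) unfolding splits_def by auto
  note sp = G.splits_pow[OF G'(1,2) _ \<open>i > 0\<close>, unfolded G'(3), OF i(2)]
  have "[k ^ i = l] (mod p)" using kper[OF i(1)] j by (meson cong_sym cong_trans)
  then have "x [^]\<^bsub>G\<^esub> (k ^ i) = x [^]\<^bsub>G\<^esub> l" using G.pow_eq_pow_iff[OF G'(4)] G'(5) by simp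
  then have conj: "y [^]\<^bsub>G\<^esub> i \<otimes>\<^bsub>G\<^esub> x \<otimes>\<^bsub>G\<^esub> inv\<^bsub>G\<^esub> (y [^]\<^bsub>G\<^esub> i) = x [^]\<^bsub>G\<^esub> l"
    using G.conj_iterate_pow[OF yG G'(4,7), of i] by simp
  show ?thesis
    by (rule splits_iso_cyclic[OF G(1,2) sp(1) H(1,2) H'(1) _ G'(4,6) H'(4,6) _ conj H'(7)])
      (use sp(2) H'(3,5) G'(5) in simp_all)
qed

subsection \<open>Squarefree order with a path of divisibilities; trace polynomials\<close>

text \<open>All primes except \<open>p\<close> and \<open>s\<close> split off, which leaves a normal
  subgroup of order \<open>p * s\<close>. Inside it no edge ends in \<open>p\<close>, because
  \<open>s > p\<close>, so it has a normal subgroup of index \<open>p\<close>; the description as a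
  torsion set makes this one normal in the whole group, although an edge of \<open>n\<close> may end
  in \<open>p\<close>.\<close>

lemma (in group) path_torsion_normal:
  assumes fin: "finite (carrier G)" and ordG: "order G = n" and sqf: "squarefree n"
    and p: "Factorial_Ring.prime p" "p dvd n" and s: "Factorial_Ring.prime s" "s dvd n" and ps: "p dvd s - 1"
    and other: "\<And>t. Factorial_Ring.prime t \<Longrightarrow> t dvd n \<Longrightarrow> t \<noteq> p \<Longrightarrow> t \<noteq> s \<Longrightarrow> coprime n (t - 1)"
  shows "torsion G s \<lhd> G \<and> card (torsion G s) = s"
proof -
  have s1: "s > 1" "p > 1" using prime_gt_1_nat[OF s(1)] prime_gt_1_nat[OF p(1)] by auto
  have lt: "p < s" using dvd_imp_le[OF ps] s1 by simp
  have "p * s dvd n" using p s lt by (metis divides_mult less_irrefl primes_coprime)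
  then obtain N where N: "n = p * s * N" by blast
  have n0: "n > 0" using sqf by (metis gr0I not_squarefree_0)
  have idx: "normal_index G t" if t: "Factorial_Ring.prime t" "t dvd n" "t \<noteq> p" "t \<noteq> s" for t
  proof -
    obtain m where m: "n = t * m" using t(2) by blast
    have "\<not> t dvd m" using squarefreeD[OF sqf, of t] t(1) m by (auto simp: power2_eq_square)
    then show ?thesis
      by (intro normal_index_coprime[OF fin t(1), of m]) (use m ordG other[OF t] in simp_all)
  qed
  have pN: "\<not> p dvd N" using squarefreeD[OF sqf, of p] p(1) N by (auto simp: power2_eq_square)
  have sN: "\<not> s dvd N" using squarefreeD[OF sqf, of s] s(1) N by (auto simp: power2_eq_square)
  have cop: "coprime (p * s) N" using prime_imp_coprime[OF p(1) pN] prime_imp_coprime[OF s(1) sN] by simp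
  have sqfN: "squarefree N" using sqf N by (metis dvd_triv_right squarefree_mono)
  have idxN: "normal_index G t" if "Factorial_Ring.prime t" "t dvd N" for t
    using idx[of t] that N pN sN by auto
  obtain y where K: "card (torsion G (p * s)) = p * s" "torsion G (p * s) \<lhd> G"
    using split_structure[OF fin _ cop sqfN idxN] ordG N by blast
  let ?K = "torsion G (p * s)"
  let ?GK = "G\<lparr>carrier := ?K\<rparr>"
  have subK: "subgroup ?K G" using K(2) normal_imp_subgroup by blast
  interpret GK: group ?GK using subgroup_imp_group[OF subK] .
  have finK: "finite (carrier ?GK)" using fin by (simp add: torsion_def)
  have ordK: "order ?GK = p * s" using K(1) by (simp add: order_def)
  have "\<not> p dvd s" using p(1) s(1) lt primes_dvd_imp_eq by blast
  moreover have "coprime (order ?GK) (p - 1)"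
  proof -
    have "\<not> p dvd p - 1" "\<not> s dvd p - 1" using s1 lt by (auto dest: dvd_imp_le)
    then show ?thesis unfolding ordK using prime_imp_coprime[OF p(1)] prime_imp_coprime[OF s(1)] by simp
  qed
  ultimately have "normal_index ?GK p" using GK.normal_index_coprime[OF finK p(1) ordK] by blast
  moreover have "coprime p s" using prime_imp_coprime[OF p(1) \<open>\<not> p dvd s\<close>] .
  ultimately have S: "torsion ?GK s \<lhd> ?GK" "card (torsion ?GK s) = s"
    using GK.normal_index_torsion_subgroup[OF finK _ ordK] s1 by auto
  have eq: "torsion ?GK s = torsion G s"
  proof -
    have "x [^] (p * s) = \<one>" if "x \<in> carrier G" "x [^] s = \<one>" for x
      using that by (metis mult.commute nat_pow_one nat_pow_pow)
    then show ?thesis unfolding torsion_def by (auto simp flip: nat_pow_consistent)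
  qed
  have "subgroup (torsion G s) G"
    using incl_subgroup[OF subK] normal_imp_subgroup[OF S(1)] eq by simp
  then show ?thesis using torsion_normal S(2) eq by simp
qed

text \<open>If the elements of order \<open>s\<close> are central, \<open>s\<close> splits off in
  spite of an edge into it, and \<open>p\<close> is the only target left.\<close>

lemma (in group) path_central_index:
  assumes fin: "finite (carrier G)" and ordG: "order G = n" and sqf: "squarefree n"
    and s: "Factorial_Ring.prime s" "s dvd n"
    and other: "\<And>t. Factorial_Ring.prime t \<Longrightarrow> t dvd n \<Longrightarrow> t \<noteq> p \<Longrightarrow> t \<noteq> s \<Longrightarrow> coprime n (t - 1)"
    and central: "central_torsion G s" and t: "Factorial_Ring.prime t" "t dvd n" "t \<noteq> p"
  shows "normal_index G t"
proof -
  obtain m where m: "n = t * m" using t(2) by blast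
  have tm: "\<not> t dvd m" using squarefreeD[OF sqf, of t] t(1) m by (auto simp: power2_eq_square)
  show ?thesis
  proof (cases "t = s")
    case True
    then show ?thesis using normal_index_if_central[OF fin t(1) _ tm] m ordG central by simp
  next
    case False
    then show ?thesis using normal_index_coprime[OF fin t(1) _ tm] m ordG other[OF t] by simp
  qed
qed

text \<open>An edge may end in \<open>p\<close>, so the coprimality argument fails for
  \<open>t = p\<close>. Instead the centralizer of the Sylow subgroup of \<open>s\<close> serves:
  the group acts on that subgroup by \<open>p\<close>-th roots of unity, since \<open>p\<close> is
  the only prime with an edge into \<open>s\<close>, and the action is nontrivial, so the
  centralizer has index \<open>p\<close>.\<close>

lemma (in group) path_noncentral_index:
  assumes fin: "finite (carrier G)" and ordG: "order G = n" and sqf: "squarefree n"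
    and p: "Factorial_Ring.prime p" "p dvd n" and s: "Factorial_Ring.prime s" "s dvd n" and ps: "p dvd s - 1"
    and uniq: "\<And>t. Factorial_Ring.prime t \<Longrightarrow> t dvd n \<Longrightarrow> t dvd s - 1 \<Longrightarrow> t = p"
    and other: "\<And>t. Factorial_Ring.prime t \<Longrightarrow> t dvd n \<Longrightarrow> t \<noteq> p \<Longrightarrow> t \<noteq> s \<Longrightarrow> coprime n (t - 1)"
    and noncentral: "\<not> central_torsion G s" and t: "Factorial_Ring.prime t" "t dvd n" "t \<noteq> s"
  shows "normal_index G t"
proof (cases "t = p")
  case False
  obtain m where m: "n = t * m" using t(2) by blast
  have tm: "\<not> t dvd m" using squarefreeD[OF sqf, of t] t(1) m by (auto simp: power2_eq_square)
  then show ?thesis using normal_index_coprime[OF fin t(1) _ tm] m ordG other[OF t(1,2) False t(3)] by simp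
next
  case True
  have n0: "n > 0" using sqf by (metis gr0I not_squarefree_0)
  have S: "torsion G s \<lhd> G" "card (torsion G s) = s"
    using path_torsion_normal[OF fin ordG sqf p s ps other] by auto
  obtain x where x: "x \<in> carrier G" "local.ord x = s" using Cauchy_prime[OF fin s(1)] s(2) ordG by auto
  have pows: "torsion G s = {x [^] (i::nat) | i. True}" by (rule torsion_cyclic[OF prime_gt_0_nat[OF s(1)] S(2) x])
  have xS: "x \<in> torsion G s" using x pow_ord_eq_1[OF x(1)] unfolding torsion_def by simp
  have conj: "\<exists>k::nat. g \<otimes> x \<otimes> inv g = x [^] k" if "g \<in> carrier G" for g
    using torsion_conj[OF xS that] pows by blast
  define C where "C = {g \<in> carrier G. g \<otimes> x \<otimes> inv g = x}"
  have Csub: "subgroup C G"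
  proof (rule subgroupI)
    show "C \<subseteq> carrier G" "C \<noteq> {}" unfolding C_def using x(1) by auto
    show "inv g \<in> C" if "g \<in> C" for g
      using that x(1) conj_conj[of "inv g" g x] unfolding C_def by auto
    show "g \<otimes> h \<in> C" if "g \<in> C" "h \<in> C" for g h
      using that x(1) conj_conj[of g h x] unfolding C_def by auto
  qed
  \<comment> \<open>All conjugates of \<open>x\<close> are powers of \<open>x\<close>, and
    \<open>C\<close> fixes every power of \<open>x\<close>.\<close>
  have Cnorm: "C \<lhd> G"
    unfolding normal_inv_iff
  proof (intro conjI ballI Csub)
    fix h g assume h: "h \<in> carrier G" and g: "g \<in> C"
    have gG: "g \<in> carrier G" and gx: "g \<otimes> x \<otimes> inv g = x"
      using g unfolding C_def by auto
    obtain k :: nat where k: "inv h \<otimes> x \<otimes> inv (inv h) = x [^] k" using conj[of "inv h"] h by auto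
    have "(h \<otimes> g \<otimes> inv h) \<otimes> x \<otimes> inv (h \<otimes> g \<otimes> inv h) = h \<otimes> (g \<otimes> (inv h \<otimes> x \<otimes> inv (inv h)) \<otimes> inv g) \<otimes> inv h"
      using h gG x(1) by (simp add: m_assoc inv_mult_group)
    also have "\<dots> = h \<otimes> x [^] k \<otimes> inv h"
      using conj_pow_closed[OF gG x(1), of k] by (simp add: k gx)
    also have "\<dots> = h \<otimes> (inv h \<otimes> x \<otimes> inv (inv h)) \<otimes> inv h" by (simp add: k)
    also have "\<dots> = (h \<otimes> inv h) \<otimes> x \<otimes> inv (h \<otimes> inv h)" by (rule conj_conj) (use h x(1) in auto)
    also have "\<dots> = x" using h x(1) by simp
    finally show "h \<otimes> g \<otimes> inv h \<in> C"
      using h gG unfolding C_def by simp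
  qed
  interpret C: normal C G by (rule Cnorm)
  interpret Q: group "G Mod C" by (rule C.factorgroup_is_group)
  have powC: "g [^] p \<in> C" if g: "g \<in> carrier G" for g
  proof -
    obtain k :: nat where k: "g \<otimes> x \<otimes> inv g = x [^] k" using conj[OF g] by blast
    have "[k ^ n = 1] (mod s)"
      using conj_pow_exponent_cong[OF g x(1) k pow_order_eq_1[OF g]] x(2) ordG by simp
    then have "[k ^ p = 1] (mod s)"
      using power_root_exponent_prime[OF s(1) _ sqf uniq] by blast
    then have "x [^] (k ^ p) = x [^] (1::nat)" using pow_eq_pow_iff[OF x(1)] x(2) by blast
    then have "g [^] p \<otimes> x \<otimes> inv (g [^] p) = x" using conj_iterate_pow[OF g x(1) k, of p] x(1) by simp
    then show ?thesis unfolding C_def using g by simp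
  qed
  define d where "d = order (G Mod C)"
  have d: "card C * d = n"
    using lagrange[OF Csub] ordG unfolding d_def by (simp add: order_def FactGroup_def mult.commute)
  have finQ: "finite (carrier (G Mod C))" using fin by (simp add: carrier_FactGroup)
  \<comment> \<open>\<open>d\<close> divides the squarefree \<open>n\<close>, and every element of
    the quotient is annihilated by \<open>p\<close>, so no other prime can divide
    \<open>d\<close>.\<close>
  have "d dvd p"
  proof (rule dvd_prime_if_squarefree)
    show "squarefree d" using sqf d by (metis dvd_triv_right squarefree_mono)
    fix t assume t: "Factorial_Ring.prime t" "t dvd d"
    obtain X' where X': "X' \<in> carrier (G Mod C)" "Q.ord X' = t"
      using Q.Cauchy_prime[OF finQ t(1)] t(2) unfolding d_def by blast
    then obtain g where g: "g \<in> carrier G" "X' = C #> g" by (auto simp: carrier_FactGroup)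
    have "X' [^]\<^bsub>G Mod C\<^esub> t = C" using Q.pow_ord_eq_1[OF X'(1)] X'(2) by simp
    then have "C #> (g [^] t) = C" using C.FactGroup_pow[OF g(1), of t] g(2) by simp
    then have gt: "g [^] t \<in> C" using g(1) rcos_self[OF _ Csub, of "g [^] t"] by simp
    show "t = p"
    proof (rule ccontr)
      assume "t \<noteq> p"
      then have "coprime t p" using t(1) p(1) by (simp add: primes_coprime)
      then have "g \<in> C" using subgroup_mem_coprime_pows[OF Csub g(1) gt powC[OF g(1)]] by blast
      then have "X' = \<one>\<^bsub>G Mod C\<^esub>" using g coset_join2[OF g(1) Csub] by simp
      then have "t = 1" using X'(2) Q.ord_id by simp
      then show False using t(1) by simp
    qed
  qed
  moreover have "d \<noteq> 1"
  proof
    assume "d = 1"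
    then have "C = carrier G"
      using d ordG fin C.subset by (intro card_subset_eq) (auto simp: order_def)
    then have "x \<otimes> y = y \<otimes> x" if "y \<in> carrier G" for y
      using that conj_eq_iff_commute[OF that x(1)] unfolding C_def by auto
    then have "x [^] (i::nat) \<otimes> y = y \<otimes> x [^] i" if "y \<in> carrier G" for y i
      using that group_commutes_pow[OF _ x(1)] by blast
    then have "central_torsion G s" unfolding central_torsion_def pows by blast
    then show False using noncentral by blast
  qed
  ultimately have "d = p" using p(1) by (metis prime_nat_iff)
  then have "card C * t = order G" using d ordG True by simp
  then show ?thesis using Cnorm unfolding normal_index_def by (intro exI[of _ C]) simp
qed

section \<open>Roots of monic polynomials modulo a prime, and traces of powers\<close>

lemma card_poly_roots_mod_prime:
  fixes f :: "int poly"
  assumes p: "Factorial_Ring.prime p" and "Polynomial.degree f \<le> d" and "Polynomial.coeff f d = 1"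
  shows "card {x \<in> {0..<int p}. int p dvd poly f x} \<le> d"
  using assms(2,3)
proof (induction d arbitrary: f)
  case 0
  then obtain c where "f = [:c:]" by (metis degree_eq_zeroE le_zero_eq)
  then have "f = 1" using 0 by (simp add: one_pCons)
  moreover have "\<not> int p dvd 1" using prime_gt_1_nat[OF p] by simp
  ultimately show ?case by simp
next
  case (Suc d)
  show ?case
  proof (cases "{x \<in> {0..<int p}. int p dvd poly f x} = {}")
    case True
    then show ?thesis by (metis card.empty le0)
  next
    case False
    then obtain r where r: "r \<in> {0..<int p}" "int p dvd poly f r" by blast
    \<comment> \<open>Division by \<open>x - r\<close> keeps the leading coefficient 1 and leaves
      the remainder \<open>poly f r\<close>, which \<open>p\<close> divides; every root of
      \<open>f\<close> other than \<open>r\<close> is a root of the quotient.\<close>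
    define g where "g = synthetic_div f r"
    have fg: "f = [:-r, 1:] * g + [:poly f r:]" unfolding g_def by (rule synthetic_div_correct'[symmetric])
    have dg: "Polynomial.degree g \<le> d" unfolding g_def using Suc.prems(1) by (simp add: degree_synthetic_div)
    have "Polynomial.coeff f (Suc d) = Polynomial.coeff g d"
    proof -
      have "Polynomial.coeff f (Suc d) = Polynomial.coeff ([:-r, 1:] * g) (Suc d)" by (subst fg) simp
      also have "\<dots> = Polynomial.coeff g d - r * Polynomial.coeff g (Suc d)" by simp
      finally show ?thesis using dg by (simp add: coeff_eq_0)
    qed
    then have "Polynomial.coeff g d = 1" using Suc.prems(2) by simp
    then have IH: "card {x \<in> {0..<int p}. int p dvd poly g x} \<le> d" using Suc.IH dg by blast
    have "{x \<in> {0..<int p}. int p dvd poly f x} \<subseteq> insert r {x \<in> {0..<int p}. int p dvd poly g x}"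
    proof
      fix x assume x: "x \<in> {x \<in> {0..<int p}. int p dvd poly f x}"
      have "poly f x = (x - r) * poly g x + poly f r" by (subst fg) (simp add: algebra_simps)
      then have "int p dvd (x - r) * poly g x" using x r by (simp add: dvd_add_left_iff)
      then have "int p dvd x - r \<or> int p dvd poly g x" using p by (simp add: prime_dvd_mult_iff)
      moreover have "x = r" if "int p dvd x - r"
      proof -
        have "x mod int p = r mod int p" using that by (simp add: mod_eq_dvd_iff)
        then show ?thesis using x r by simp
      qed
      ultimately show "x \<in> insert r {x \<in> {0..<int p}. int p dvd poly g x}" using x by blast
    qed
    then have "card {x \<in> {0..<int p}. int p dvd poly f x} \<le> card (insert r {x \<in> {0..<int p}. int p dvd poly g x})"
      by (intro card_mono finite.insertI) (auto intro: finite_subset[of _ "{0..<int p}"])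
    also have "\<dots> \<le> Suc (card {x \<in> {0..<int p}. int p dvd poly g x})"
      by (rule card_insert_le_m1[THEN le_trans, of "Suc (card {x \<in> {0..<int p}. int p dvd poly g x})"]) simp_all
    also have "\<dots> \<le> Suc d" using IH by simp
    finally show ?thesis .
  qed
qed

text \<open>
  \<open>trace_poly j\<close> is the trace of the \<open>j\<close>-th power of a \<open>2 \<times> 2\<close> matrix of determinant \<open>1\<close>,
  as a polynomial in the trace of the matrix.
\<close>

fun trace_poly :: "nat \<Rightarrow> int poly" where
  "trace_poly 0 = [:2:]"
| "trace_poly (Suc 0) = [:0, 1:]"
| "trace_poly (Suc (Suc j)) = [:0, 1:] * trace_poly (Suc j) - trace_poly j"

text \<open>If the matrix has eigenvalues \<open>\<zeta>\<close> and \<open>\<zeta>^-1\<close>, the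
  value at its trace is the sum of \<open>\<zeta>^j\<close> for \<open>j\<close> from
  \<open>-h\<close> to \<open>h\<close>. It vanishes when \<open>\<zeta> \<noteq> 1\<close> and
  \<open>\<zeta>^(2 h + 1) = 1\<close>.\<close>

definition trace_sum_poly :: "nat \<Rightarrow> int poly" where
  "trace_sum_poly h = 1 + (\<Sum>j=1..h. trace_poly j)"

lemma trace_poly_degree: "Polynomial.degree (trace_poly j) \<le> j \<and> Polynomial.coeff (trace_poly (Suc j)) (Suc j) = 1"
proof (induction j rule: trace_poly.induct)
  case (3 j)
  have "Polynomial.degree ([:0, 1:] * trace_poly (Suc j)) \<le> Suc (Suc j)"
    using 3 degree_pCons_le[of 0 "trace_poly (Suc j)"] by simp
  then have d: "Polynomial.degree (trace_poly (Suc (Suc j))) \<le> Suc (Suc j)"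
    using 3 by (simp add: degree_diff_le)
  have "Polynomial.coeff (trace_poly (Suc j)) (Suc (Suc (Suc j))) = 0" using 3 by (intro coeff_eq_0) simp
  moreover have "Polynomial.coeff (trace_poly (Suc (Suc j))) (Suc (Suc j)) = 1" using 3 by simp
  ultimately show ?case using d by simp
qed (simp_all add: numeral_2_eq_2)

lemma trace_sum_poly_monic:
  assumes "h \<ge> 1"
  shows "Polynomial.degree (trace_sum_poly h) \<le> h" "Polynomial.coeff (trace_sum_poly h) h = 1"
proof -
  have "Polynomial.degree (\<Sum>j=1..h. trace_poly j) \<le> h"
    by (rule degree_sum_le) (auto intro: order_trans[OF conjunct1[OF trace_poly_degree]])
  then show "Polynomial.degree (trace_sum_poly h) \<le> h" unfolding trace_sum_poly_def
    using degree_add_le[of 1 h] by simp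
  obtain h' where h: "h = Suc h'" using assms by (metis Suc_le_D One_nat_def)
  have "Polynomial.coeff (trace_poly j) h = 0" if "j \<in> {1..h'}" for j
    using trace_poly_degree[of j] that h by (intro coeff_eq_0) auto
  then have "Polynomial.coeff (\<Sum>j=1..h. trace_poly j) h = 1"
    using trace_poly_degree[of h'] by (simp add: h coeff_sum)
  moreover have "Polynomial.coeff 1 h = (0::int)" using h by simp
  ultimately show "Polynomial.coeff (trace_sum_poly h) h = 1" unfolding trace_sum_poly_def by simp
qed

context comm_group
begin

text \<open>The identity \<open>\<zeta>^(i+j) + \<zeta>^(i-j) = \<zeta>^i (\<zeta>^j +
  \<zeta>^-j)\<close> in multiplicative notation; it follows from the three-term recurrence alone,
  so the eigenvalues never have to exist in the prime field.\<close>

lemma trace_power_sequence: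
  fixes z :: "int \<Rightarrow> 'a"
  assumes z: "\<And>i. z i \<in> carrier G" and rec: "\<And>i. z (i + 1) \<otimes> z (i - 1) = z i [^] (a::int)"
  shows "z (i + int j) \<otimes> z (i - int j) = z i [^] poly (trace_poly j) a"
proof (induction j arbitrary: i rule: trace_poly.induct)
  case 1
  show ?case using z[of i] int_pow_mult[of "z i" 1 1] by simp
next
  case 2
  show ?case using rec[of i] by simp
next
  case (3 j)
  have m: "z (i + int (Suc (Suc j))) \<otimes> z (i + int j) = z (i + int (Suc j)) [^] a"
    "z (i - int j) \<otimes> z (i - int (Suc (Suc j))) = z (i - int (Suc j)) [^] a"
    using rec[of "i + int (Suc j)"] rec[of "i - int (Suc j)"] by (simp_all add: algebra_simps)
  have "(z (i + int (Suc (Suc j))) \<otimes> z (i - int (Suc (Suc j)))) \<otimes> (z (i + int j) \<otimes> z (i - int j)) =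
    (z (i + int (Suc (Suc j))) \<otimes> z (i + int j)) \<otimes> (z (i - int j) \<otimes> z (i - int (Suc (Suc j))))"
    using z by (simp add: m_ac)
  also have "\<dots> = (z (i + int (Suc j)) \<otimes> z (i - int (Suc j))) [^] a"
    using z m by (simp add: int_pow_distrib)
  also have "\<dots> = z i [^] (poly (trace_poly (Suc j)) a * a)"
    using z by (simp only: 3(1) int_pow_pow)
  finally have "(z (i + int (Suc (Suc j))) \<otimes> z (i - int (Suc (Suc j)))) \<otimes> z i [^] poly (trace_poly j) a =
    z i [^] (poly (trace_poly (Suc j)) a * a)" by (simp only: 3(2))
  moreover have "z i [^] (poly (trace_poly (Suc j)) a * a) =
    z i [^] poly (trace_poly (Suc (Suc j))) a \<otimes> z i [^] poly (trace_poly j) a"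
    using z by (simp add: algebra_simps flip: int_pow_mult)
  ultimately show ?case using z by (metis right_cancel int_pow_closed m_closed)
qed

primrec window :: "(int \<Rightarrow> 'a) \<Rightarrow> int \<Rightarrow> nat \<Rightarrow> 'a" where
  "window z m 0 = \<one>"
| "window z m (Suc j) = window z m j \<otimes> z (m + int j)"

lemma window_closed [simp]: "(\<And>i. z i \<in> carrier G) \<Longrightarrow> window z m j \<in> carrier G"
  by (induction j) auto

lemma window_Suc_left:
  assumes z: "\<And>i. z i \<in> carrier G"
  shows "window z m (Suc j) = z m \<otimes> window z (m + 1) j"
proof (induction j)
  case (Suc j)
  have "window z m (Suc (Suc j)) = (z m \<otimes> window z (m + 1) j) \<otimes> z (m + int (Suc j))"
    using Suc by simp
  then show ?case using z by (simp add: m_assoc algebra_simps)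
qed (use z in simp)

text \<open>Moving the window by one drops \<open>z m\<close> and adds \<open>z (m + l)\<close>,
  which is the same element. A product over a full period is therefore fixed by the shift.\<close>

lemma window_periodic:
  assumes z: "\<And>i. z i \<in> carrier G" and per: "\<And>i. z (i + int l) = z i"
  shows "window z (m + 1) l = window z m l"
proof -
  have "window z m l \<otimes> z m = z m \<otimes> window z (m + 1) l"
    using window_Suc_left[of z m l, OF z] per by simp
  then have "z m \<otimes> window z m l = z m \<otimes> window z (m + 1) l" using z by (simp add: m_comm)
  then show ?thesis using z by simp
qed

text \<open>The window has odd length and is centred at \<open>i\<close>; its other elements pair
  off as \<open>z (i + j)\<close> and \<open>z (i - j)\<close>, and each pair is a power of
  \<open>z i\<close> by \<open>trace_power_sequence\<close>.\<close>

lemma window_trace_sum: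
  assumes z: "\<And>i. z i \<in> carrier G" and rec: "\<And>i. z (i + 1) \<otimes> z (i - 1) = z i [^] (a::int)"
  shows "window z (i - int h) (Suc (2 * h)) = z i [^] poly (trace_sum_poly h) a"
proof (induction h)
  case 0
  then show ?case using z by (simp add: trace_sum_poly_def)
next
  case (Suc h)
  have "window z (i - int (Suc h)) (Suc (2 * Suc h)) =
    z (i - int (Suc h)) \<otimes> (window z (i - int h) (Suc (2 * h)) \<otimes> z (i + int (Suc h)))"
    using window_Suc_left[of z "i - int (Suc h)" "Suc (Suc (2 * h))", OF z] by (simp add: algebra_simps)
  also have "\<dots> = z i [^] poly (trace_sum_poly h) a \<otimes> (z (i + int (Suc h)) \<otimes> z (i - int (Suc h)))"
    using z Suc by (simp add: m_ac)
  also have "\<dots> = z i [^] poly (trace_sum_poly (Suc h)) a"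
    using z trace_power_sequence[of z, OF z rec, of i "Suc h"]
    by (simp add: int_pow_mult trace_sum_poly_def m_assoc)
  finally show ?case .
qed

end

subsection \<open>Automorphisms of elementary abelian groups of order a prime square\<close>

text \<open>Let \<open>P\<close> be generated by \<open>x\<close> of order \<open>p\<close>. The
  number of cosets of \<open>P\<close> fixed by \<open>x\<close> is divisible by \<open>p\<close>
  and not 0, so all \<open>p\<close> cosets are fixed and \<open>P\<close> is normal. Conjugation on
  \<open>P\<close> is then an exponent \<open>k\<close> with \<open>k^p = 1\<close> modulo
  \<open>p\<close>, and \<open>p\<close> is prime to \<open>p - 1\<close>.\<close>

lemma (in group) order_prime_square_cases:
  assumes fin: "finite (carrier G)" and p: "Factorial_Ring.prime p" and ordG: "order G = p\<^sup>2"
    and nc: "\<And>x. x \<in> carrier G \<Longrightarrow> local.ord x \<noteq> p\<^sup>2"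
  shows "\<And>x. x \<in> carrier G \<Longrightarrow> x [^] p = \<one>" "commuting G"
proof -
  have p1: "p > 1" using p by (rule prime_gt_1_nat)
  have ord: "local.ord x = 1 \<or> local.ord x = p" if "x \<in> carrier G" for x
  proof -
    have "local.ord x dvd p ^ 2" using ord_dvd_group_order[OF that] ordG by simp
    then obtain i where "i \<le> 2" "local.ord x = p ^ i" using p by (auto simp: divides_primepow_nat)
    then show ?thesis using nc[OF that] by (auto simp: le_Suc_eq numeral_2_eq_2)
  qed
  show exp: "x [^] p = \<one>" if "x \<in> carrier G" for x
    using ord[OF that] that by (metis ord_eq_1 nat_pow_one pow_ord_eq_1)
  have central: "g \<otimes> x \<otimes> inv g = x" if x: "x \<in> carrier G" "x \<noteq> \<one>" and g: "g \<in> carrier G" for x g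
  proof -
    have ordx: "local.ord x = p" using ord[OF x(1)] x ord_eq_1 by blast
    define P where "P = generate G {x}"
    have P_eq: "P = {x [^] (k::nat) | k. True}"
      unfolding P_def using generate_pow_on_finite_carrier[OF fin x(1)] by auto
    have subP: "subgroup P G" unfolding P_def using x by (simp add: generate_is_subgroup)
    then interpret P: subgroup P G .
    have xP: "x \<in> P" unfolding P_eq using x by (metis (mono_tags) mem_Collect_eq nat_pow_eone)
    have "card P = p" unfolding P_def using generate_pow_card[OF x(1)] ordx by simp
    then have "card (rcosets P) * p = p * p"
      using lagrange[OF subP] ordG by (simp add: power2_eq_square)
    then have cardA: "card (rcosets P) = p" using p1 by simp
    have finA: "finite (rcosets P)" using fin by (simp add: RCOSETS_def)
    let ?f = "\<lambda>C. C #> x"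
    have sub: "?f ` (rcosets P) \<subseteq> rcosets P"
      unfolding RCOSETS_def using x P.subset by (auto simp: coset_mult_assoc)
    have iter: "(?f ^^ i) C = C #> x [^] i" if "C \<in> rcosets P" for i :: nat and C
      using that x P.rcosets_carrier[OF is_group that] by (induction i) (simp_all add: coset_mult_assoc)
    have "[card (rcosets P) = card {C \<in> rcosets P. ?f C = C}] (mod p)"
    proof (rule card_fixpoints_cong[OF p finA sub])
      show "(?f ^^ p) C = C" if "C \<in> rcosets P" for C
        using iter[OF that] exp[OF x(1)] P.rcosets_carrier[OF is_group that] by simp
    qed
    then have "p dvd card {C \<in> rcosets P. ?f C = C}" using cardA by (simp add: cong_def dvd_eq_mod_eq_0)
    moreover have "P \<in> {C \<in> rcosets P. ?f C = C}"
      using P.subgroup_in_rcosets[OF is_group] coset_join2[OF x(1) subP xP] by simp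
    then have "card {C \<in> rcosets P. ?f C = C} > 0" using finA by (auto simp: card_gt_0_iff)
    ultimately have "p \<le> card {C \<in> rcosets P. ?f C = C}" by (rule dvd_imp_le)
    then have "{C \<in> rcosets P. ?f C = C} = rcosets P" using finA cardA by (intro card_seteq) auto
    moreover have "P #> g \<in> rcosets P" using g P.subset by (simp add: rcosetsI)
    ultimately have "P #> g #> x = P #> g" by blast
    then have "P #> (g \<otimes> x) = P #> g" using g x P.subset by (simp add: coset_mult_assoc)
    then have "g \<otimes> x \<in> P #> g" using g x rcos_self[OF _ subP, of "g \<otimes> x"] by simp
    then have "g \<otimes> x \<otimes> inv g \<in> P" using P.rcos_module_imp[OF is_group g] by blast
    then obtain k :: nat where k: "g \<otimes> x \<otimes> inv g = x [^] k" unfolding P_eq by blast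
    have "[k ^ p = 1] (mod p)" using conj_pow_exponent_cong[OF g x(1) k exp[OF g]] ordx by simp
    then have "[k = 1] (mod p)"
      by (rule prime_power_eq_1_coprime[OF p])
        (use p1 in \<open>auto intro!: prime_imp_coprime[OF p] dest: dvd_imp_le\<close>)
    then have "x [^] k = x [^] (1::nat)" using pow_eq_pow_iff[OF x(1)] ordx by blast
    then show ?thesis using k x by simp
  qed
  show "commuting G"
    unfolding commuting_def
  proof (intro ballI)
    fix x y assume xy: "x \<in> carrier G" "y \<in> carrier G"
    show "x \<otimes> y = y \<otimes> x"
    proof (cases "x = \<one>")
      case False
      then show ?thesis using central[OF xy(1) False xy(2)] conj_eq_iff_commute[OF xy(2,1)] by simp
    qed (use xy in simp)
  qed
qed

text \<open>\<open>K\<close> plays the part of a plane over the integers modulo \<open>p\<close>,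
  written multiplicatively: exponents are scalars, and conjugation by elements of the group gives
  linear maps.\<close>

locale prime_square_kernel = group +
  fixes K :: "'a set" and p :: nat
  assumes p: "Factorial_Ring.prime p" and norm: "K \<lhd> G" and cardK: "card K = p\<^sup>2"
    and exp: "\<And>k. k \<in> K \<Longrightarrow> k [^] p = \<one>"
    and comm: "\<And>a b. a \<in> K \<Longrightarrow> b \<in> K \<Longrightarrow> a \<otimes> b = b \<otimes> a"
begin

definition basis_pair :: "'a \<Rightarrow> 'a \<Rightarrow> bool" where
  "basis_pair x z \<longleftrightarrow> x \<in> K \<and> x \<noteq> \<one> \<and> z \<in> K \<and> (\<forall>i::nat. z \<noteq> x [^] i)"

lemma sub: "subgroup K G" using norm normal_imp_subgroup by blast

lemma KG: "k \<in> K \<Longrightarrow> k \<in> carrier G" using sub by (rule subgroup.mem_carrier)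

lemma finK: "finite K" using cardK p by (metis card.infinite not_prime_0 power_not_zero)

lemma K_pow: "k \<in> K \<Longrightarrow> k [^] (i::nat) \<in> K"
  using sub by (induction i) (simp_all add: subgroup.one_closed subgroup.m_closed)

lemma K_ord: "k \<in> K \<Longrightarrow> k \<noteq> \<one> \<Longrightarrow> local.ord k = p"
  using exp[of k] KG[of k] ord_eq_1[of k] pow_eq_id[of k p] p by (metis prime_nat_iff)

lemma K_pow_eq_iff: "k \<in> K \<Longrightarrow> k \<noteq> \<one> \<Longrightarrow> k [^] (i::nat) = k [^] j \<longleftrightarrow> [i = j] (mod p)"
  using pow_eq_pow_iff[OF KG] K_ord by simp

lemma K_conj: "k \<in> K \<Longrightarrow> g \<in> carrier G \<Longrightarrow> g \<otimes> k \<otimes> inv g \<in> K"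
  using normal_invE(2)[OF norm] by blast

lemma conj_mult:
  assumes "a \<in> K" "b \<in> K" "g \<in> carrier G"
  shows "g \<otimes> (a \<otimes> b) \<otimes> inv g = (g \<otimes> a \<otimes> inv g) \<otimes> (g \<otimes> b \<otimes> inv g)"
proof -
  have "(g \<otimes> a \<otimes> inv g) \<otimes> (g \<otimes> (b \<otimes> inv g)) = (g \<otimes> a) \<otimes> (b \<otimes> inv g)"
    by (rule mult_inv_cancel_middle) (use assms KG in auto)
  then show ?thesis using assms KG by (simp add: m_assoc)
qed

lemma basis_mult:
  assumes "x \<in> K" "z \<in> K"
  shows "(x [^] (i::nat) \<otimes> z [^] (j::nat)) \<otimes> (x [^] (i'::nat) \<otimes> z [^] (j'::nat)) = x [^] (i + i') \<otimes> z [^] (j + j')"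
proof -
  have "(x [^] i \<otimes> z [^] j) \<otimes> (x [^] i' \<otimes> z [^] j') = x [^] i \<otimes> (z [^] j \<otimes> x [^] i') \<otimes> z [^] j'"
    using assms KG by (simp add: m_assoc)
  also have "\<dots> = x [^] i \<otimes> (x [^] i' \<otimes> z [^] j) \<otimes> z [^] j'"
    using comm[OF K_pow K_pow] assms by simp
  also have "\<dots> = (x [^] i \<otimes> x [^] i') \<otimes> (z [^] j \<otimes> z [^] j')"
    using assms KG by (simp add: m_assoc)
  finally show ?thesis using assms KG by (simp add: nat_pow_mult)
qed

lemma basis_pow:
  assumes "x \<in> K" "z \<in> K"
  shows "(x [^] (i::nat) \<otimes> z [^] (j::nat)) [^] (m::nat) = x [^] (i * m) \<otimes> z [^] (j * m)"
proof (induction m)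
  case (Suc m)
  then show ?case
    using basis_mult[OF assms, of "i * m" "j * m" i j] by (simp add: add.commute)
qed simp

text \<open>If the exponents of \<open>z\<close> differed modulo \<open>p\<close>, a power of
  \<open>z\<close> with exponent prime to \<open>p\<close> would be a power of \<open>x\<close>, and
  then so would \<open>z\<close>, against the independence in \<open>basis_pair\<close>.\<close>

lemma basis_eq_iff:
  assumes b: "basis_pair x z"
  shows "x [^] (i::nat) \<otimes> z [^] (j::nat) = x [^] (i'::nat) \<otimes> z [^] (j'::nat) \<longleftrightarrow> [i = i'] (mod p) \<and> [j = j'] (mod p)"
proof -
  have xK: "x \<in> K" "x \<noteq> \<one>" and zK: "z \<in> K" and ind: "\<And>i::nat. z \<noteq> x [^] i" using b unfolding basis_pair_def by auto
  have z1: "z \<noteq> \<one>" using ind[of 0] by simp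
  have xG: "x \<in> carrier G" and zG: "z \<in> carrier G" using xK zK KG by auto
  have imp: "[j = j'] (mod p)" if "x [^] i \<otimes> z [^] j = x [^] i' \<otimes> z [^] j'" "j \<le> j'" for i j i' j' :: nat
  proof (rule ccontr)
    assume nj: "\<not> [j = j'] (mod p)"
    have eq: "x [^] int i \<otimes> z [^] int j = x [^] int i' \<otimes> z [^] int j'" using that(1) by (simp add: int_pow_int)
    have "z [^] (int j' - int j) = inv (x [^] int i') \<otimes> (x [^] int i' \<otimes> z [^] int j') \<otimes> inv (z [^] int j)"
      using xG zG by (simp add: int_pow_diff m_assoc[symmetric])
    also have "\<dots> = inv (x [^] int i') \<otimes> x [^] int i" using xG zG by (simp add: m_assoc flip: eq)
    also have "\<dots> = x [^] (int i - int i')"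
      using xG by (metis int_pow_diff int_pow_mult int_pow_neg add.commute uminus_add_conv_diff)
    finally have e: "z [^] (int j' - int j) = x [^] (int i - int i')" .
    define P where "P = {x [^] (k::int) | k. True}"
    have subP: "subgroup P G" unfolding P_def using subgroup_of_powers[OF xG] by (simp add: full_SetCompr_eq)
    have "z [^] (j' - j) \<in> P" using e that(2) unfolding P_def by (metis (mono_tags, lifting) int_ops(6) int_pow_int mem_Collect_eq not_le of_nat_le_iff)
    moreover have "z [^] p \<in> P" using exp[OF zK] subP by (simp add: subgroup.one_closed)
    moreover have "coprime (j' - j) p"
    proof -
      have "\<not> p dvd j' - j" using nj that(2) by (metis cong_altdef_nat cong_sym)
      then show ?thesis using prime_imp_coprime[OF p] coprime_commute by blast
    qed
    ultimately have "z \<in> P" using subgroup_mem_coprime_pows[OF subP zG] by blast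
    then obtain k where k: "z = x [^] (k::int)" unfolding P_def by blast
    have "x [^] k = x [^] int (nat (k mod int p))"
      using int_pow_eq[OF xG] K_ord[OF xK] prime_gt_0_nat[OF p] by (simp add: mod_eq_dvd_iff[symmetric])
    then show False using k ind by (metis int_pow_int)
  qed
  show ?thesis
  proof
    assume eq: "x [^] i \<otimes> z [^] j = x [^] i' \<otimes> z [^] j'"
    then have j: "[j = j'] (mod p)"
      using imp[of i j i' j'] imp[of i' j' i j] by (metis cong_sym linear)
    then have "z [^] j = z [^] j'" using K_pow_eq_iff[OF zK z1] by blast
    then have "x [^] i = x [^] i'" using eq xG zG by simp
    then show "[i = i'] (mod p) \<and> [j = j'] (mod p)" using K_pow_eq_iff[OF xK] j by blast
  next
    assume "[i = i'] (mod p) \<and> [j = j'] (mod p)"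
    then have "x [^] i = x [^] i'" "z [^] j = z [^] j'"
      using K_pow_eq_iff[OF xK] K_pow_eq_iff[OF zK z1] by blast+
    then show "x [^] i \<otimes> z [^] j = x [^] i' \<otimes> z [^] j'" by simp
  qed
qed

lemma basis_span:
  assumes b: "basis_pair x z"
  shows "K = {x [^] (i::nat) \<otimes> z [^] (j::nat) | i j. True}"
proof -
  have xK: "x \<in> K" and zK: "z \<in> K" using b unfolding basis_pair_def by auto
  let ?f = "\<lambda>(i::nat, j::nat). x [^] i \<otimes> z [^] j"
  have sb: "?f ` ({..<p} \<times> {..<p}) \<subseteq> K"
    using K_pow xK zK subgroup.m_closed[OF sub] by auto
  have "inj_on ?f ({..<p} \<times> {..<p})"
    by (rule inj_onI) (auto simp: basis_eq_iff[OF b] cong_def)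
  then have "card (?f ` ({..<p} \<times> {..<p})) = p\<^sup>2"
    by (simp add: card_image card_cartesian_product power2_eq_square)
  then have "?f ` ({..<p} \<times> {..<p}) = K" using sb finK cardK by (intro card_subset_eq) auto
  then have "K \<subseteq> {x [^] (i::nat) \<otimes> z [^] (j::nat) | i j. True}" by auto
  moreover have "{x [^] (i::nat) \<otimes> z [^] (j::nat) | i j. True} \<subseteq> K"
    using K_pow xK zK subgroup.m_closed[OF sub] by auto
  ultimately show ?thesis by blast
qed

lemma basis_extend:
  assumes x: "x \<in> K" "x \<noteq> \<one>"
  obtains z where "basis_pair x z"
proof -
  have p1: "p > 1" using p by (rule prime_gt_1_nat)
  have "(\<lambda>i. x [^] (i::nat)) ` {..<p} \<subseteq> K" using K_pow x by auto
  moreover have "card ((\<lambda>i. x [^] (i::nat)) ` {..<p}) < card K"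
  proof -
    have "card ((\<lambda>i. x [^] (i::nat)) ` {..<p}) \<le> p" using card_image_le[of "{..<p}"] by simp
    also have "p < p\<^sup>2" using p1 by (simp add: power2_eq_square)
    finally show ?thesis using cardK by simp
  qed
  ultimately obtain z where z: "z \<in> K" "z \<notin> (\<lambda>i. x [^] (i::nat)) ` {..<p}"
    by (metis card_mono finite_imageI finite_lessThan linorder_not_less subsetI)
  have "z \<noteq> x [^] i" for i :: nat
  proof
    assume "z = x [^] i"
    then have "z = x [^] (i mod p)" using K_pow_eq_iff[OF x, of i "i mod p"] by (simp add: cong_def)
    then show False using z(2) p1 by auto
  qed
  then show ?thesis using that x z(1) unfolding basis_pair_def by blast
qed

lemma basis_exists: "\<exists>x z. basis_pair x z"
proof -
  have "p\<^sup>2 > 1" using prime_gt_1_nat[OF p] by (intro one_less_power) simp_all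
  then have "\<not> K \<subseteq> {\<one>}" using cardK card_mono[of "{\<one>}" K] by auto
  then obtain x where x: "x \<in> K" "x \<noteq> \<one>" by blast
  obtain z where "basis_pair x z" by (rule basis_extend[OF x])
  then show ?thesis by blast
qed

definition centralizes :: "'a \<Rightarrow> bool" where
  "centralizes g \<longleftrightarrow> g \<in> carrier G \<and> (\<forall>k\<in>K. g \<otimes> k \<otimes> inv g = k)"

lemma centralizes_subgroup: "subgroup {g. centralizes g} G"
proof (rule subgroupI)
  show "{g. centralizes g} \<subseteq> carrier G" "{g. centralizes g} \<noteq> {}"
    unfolding centralizes_def using KG by (auto intro!: exI[of _ \<one>])
  show "inv g \<in> {g. centralizes g}" if "g \<in> {g. centralizes g}" for g
    using that KG conj_conj[of "inv g" g] unfolding centralizes_def by auto (metis KG r_inv inv_one l_inv l_one r_one)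
  show "g \<otimes> h \<in> {g. centralizes g}" if "g \<in> {g. centralizes g}" "h \<in> {g. centralizes g}" for g h
    using that KG by (auto simp: centralizes_def simp flip: conj_conj)
qed

lemma conj_basis:
  assumes "x \<in> K" "z \<in> K" "g \<in> carrier G"
  shows "g \<otimes> (x [^] (i::nat) \<otimes> z [^] (j::nat)) \<otimes> inv g = (g \<otimes> x \<otimes> inv g) [^] i \<otimes> (g \<otimes> z \<otimes> inv g) [^] j"
  using conj_mult[OF K_pow K_pow] assms KG by (simp add: conj_pow_closed)

lemma centralizes_basis:
  assumes b: "basis_pair x z" and g: "g \<in> carrier G" and "g \<otimes> x \<otimes> inv g = x" "g \<otimes> z \<otimes> inv g = z"
  shows "centralizes g"
  unfolding centralizes_def
proof (intro conjI ballI g)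
  fix k assume "k \<in> K"
  then obtain i j where k: "k = x [^] (i::nat) \<otimes> z [^] (j::nat)" using basis_span[OF b] by blast
  show "g \<otimes> k \<otimes> inv g = k"
    unfolding k by (subst conj_basis) (use b g assms(3,4) in \<open>auto simp: basis_pair_def\<close>)
qed

text \<open>
  An automorphism of order prime to \<open>p\<close> and \<open>p - 1\<close> with an eigenvector is unipotent, hence trivial.
\<close>

lemma centralizes_if_eigenvector:
  assumes g: "g \<in> carrier G" "g [^] N = \<one>" and N: "N > 0" "coprime N p" "coprime N (p - 1)"
    and x: "x \<in> K" "x \<noteq> \<one>" and eig: "g \<otimes> x \<otimes> inv g = x [^] (k::nat)"
  shows "centralizes g"
proof -
  obtain z where b: "basis_pair x z" using basis_extend[OF x] by blast
  have zK: "z \<in> K" using b unfolding basis_pair_def by blast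
  have "[k ^ N = 1] (mod p)" using conj_pow_exponent_cong[OF g(1) KG[OF x(1)] eig g(2)] K_ord[OF x] by simp
  then have "[k = 1] (mod p)" using prime_power_eq_1_coprime[OF p] N by blast
  then have "x [^] k = x [^] (1::nat)" using K_pow_eq_iff[OF x] by blast
  then have fx: "g \<otimes> x \<otimes> inv g = x" using eig x KG by simp
  obtain d c where dc: "g \<otimes> z \<otimes> inv g = x [^] (d::nat) \<otimes> z [^] (c::nat)"
    using K_conj[OF zK g(1)] basis_span[OF b] by blast
  \<comment> \<open>In the basis \<open>x\<close>, \<open>z\<close> the action is triangular with
    diagonal 1 and \<open>c\<close>. The corner entry \<open>e\<close> of its powers can stay open
    here; the exponent \<open>N\<close> already gives \<open>c^N = 1\<close>.\<close>
  have "\<exists>e::nat. g [^] (i::nat) \<otimes> z \<otimes> inv (g [^] i) = x [^] e \<otimes> z [^] (c ^ i)" for i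
  proof (induction i)
    case 0
    show ?case using zK KG by (intro exI[of _ 0]) simp
  next
    case (Suc i)
    then obtain e :: nat where e: "g [^] i \<otimes> z \<otimes> inv (g [^] i) = x [^] e \<otimes> z [^] (c ^ i)" by blast
    have "g [^] Suc i \<otimes> z \<otimes> inv (g [^] Suc i) = g \<otimes> (g [^] i \<otimes> z \<otimes> inv (g [^] i)) \<otimes> inv g"
      using conj_conj[OF g(1), of "g [^] i" z] g(1) zK KG nat_pow_Suc2[OF g(1)] by simp
    also have "\<dots> = x [^] e \<otimes> (x [^] d \<otimes> z [^] c) [^] (c ^ i)"
      unfolding e by (subst conj_basis) (use x zK g fx dc in auto)
    also have "\<dots> = (x [^] e \<otimes> z [^] (0::nat)) \<otimes> (x [^] (d * c ^ i) \<otimes> z [^] (c * c ^ i))"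
      using basis_pow[OF x(1) zK] x KG by simp
    also have "\<dots> = x [^] (e + d * c ^ i) \<otimes> z [^] (c ^ Suc i)"
      using basis_mult[OF x(1) zK, of e 0 "d * c ^ i" "c * c ^ i"] by simp
    finally show ?case by blast
  qed
  from this[of N] obtain e :: nat where "z = x [^] e \<otimes> z [^] (c ^ N)" using g zK KG by auto
  then have "x [^] (0::nat) \<otimes> z [^] (1::nat) = x [^] e \<otimes> z [^] (c ^ N)" using zK KG by simp
  then have "[c ^ N = 1] (mod p)" using basis_eq_iff[OF b] by (meson cong_sym)
  then have "[c = 1] (mod p)" using prime_power_eq_1_coprime[OF p] N by blast
  then have dc': "g \<otimes> z \<otimes> inv g = x [^] d \<otimes> z [^] (1::nat)"
    unfolding dc using basis_eq_iff[OF b] by blast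
  \<comment> \<open>With \<open>c = 1\<close> the corner entry of the \<open>i\<close>-th power is
    \<open>d * i\<close>; the power \<open>N\<close> acts trivially and \<open>N\<close> is prime to
    \<open>p\<close>, which forces \<open>d = 0\<close>.\<close>
  have "g [^] (i::nat) \<otimes> z \<otimes> inv (g [^] i) = x [^] (d * i) \<otimes> z [^] (1::nat)" for i
  proof (induction i)
    case 0
    show ?case using zK KG by simp
  next
    case (Suc i)
    have "g [^] Suc i \<otimes> z \<otimes> inv (g [^] Suc i) = g \<otimes> (g [^] i \<otimes> z \<otimes> inv (g [^] i)) \<otimes> inv g"
      using conj_conj[OF g(1), of "g [^] i" z] g(1) zK KG nat_pow_Suc2[OF g(1)] by simp
    also have "\<dots> = x [^] (d * i) \<otimes> (x [^] d \<otimes> z [^] (1::nat)) [^] (1::nat)"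
      unfolding Suc by (subst conj_basis) (use x zK g fx dc' in auto)
    also have "\<dots> = (x [^] (d * i) \<otimes> z [^] (0::nat)) \<otimes> (x [^] d \<otimes> z [^] (1::nat))"
      using x zK KG by simp
    also have "\<dots> = x [^] (d * Suc i) \<otimes> z [^] (1::nat)"
      using basis_mult[OF x(1) zK, of "d * i" 0 d 1] by (simp add: add.commute)
    finally show ?case .
  qed
  from this[of N] have "x [^] (0::nat) \<otimes> z [^] (1::nat) = x [^] (d * N) \<otimes> z [^] (1::nat)"
    using g zK KG by simp
  then have "[d * N = 0] (mod p)" using basis_eq_iff[OF b] by (meson cong_sym)
  then have "p dvd d * N" by (simp add: cong_0_iff)
  then have "p dvd d" using N(2) by (simp add: coprime_commute coprime_dvd_mult_left_iff)
  then have "[d = 0] (mod p)" by (simp add: cong_0_iff)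
  then have "x [^] d \<otimes> z [^] (1::nat) = x [^] (0::nat) \<otimes> z [^] (1::nat)"
    using basis_eq_iff[OF b] by (meson cong_refl)
  then have "g \<otimes> z \<otimes> inv g = z" using dc' zK KG by simp
  then show ?thesis using centralizes_basis[OF b g(1) fx] by blast
qed

text \<open>The power \<open>y^(N div t)\<close> has order dividing \<open>t\<close>. If it moved
  some element of \<open>K\<close>, it could have no nontrivial fixed point, for that would be an
  eigenvector, and counting orbits would give \<open>p\<^sup>2 = 1\<close> modulo
  \<open>t\<close>.\<close>

lemma centralizes_pow_cofactor:
  assumes y: "y \<in> carrier G" "y [^] N = \<one>" and N: "N > 0" "coprime N p" "coprime N (p - 1)"
    and t: "Factorial_Ring.prime t" "t dvd N" "\<not> t dvd p\<^sup>2 - 1"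
  shows "centralizes (y [^] (N div t))"
proof (rule ccontr)
  assume nc: "\<not> centralizes (y [^] (N div t))"
  define g where "g = y [^] (N div t)"
  have gG: "g \<in> carrier G" unfolding g_def using y by simp
  have gt: "g [^] t = \<one>" unfolding g_def using y t(2) by (simp add: nat_pow_pow)
  have gN: "g [^] N = \<one>" using gt t(2) gG by (metis dvdE nat_pow_one nat_pow_pow)
  let ?f = "\<lambda>k. g \<otimes> k \<otimes> inv g"
  have iter: "(?f ^^ i) k = g [^] i \<otimes> k \<otimes> inv (g [^] i)" if "k \<in> K" for i k
  proof (induction i)
    case (Suc i)
    have "?f ((?f ^^ i) k) = g \<otimes> (g [^] i \<otimes> k \<otimes> inv (g [^] i)) \<otimes> inv g" by (simp add: Suc)
    also have "\<dots> = g [^] Suc i \<otimes> k \<otimes> inv (g [^] Suc i)"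
      using conj_conj[OF gG, of "g [^] i" k] gG KG[OF that] nat_pow_Suc2[OF gG] by simp
    finally show ?case by simp
  qed (use KG[OF that] in simp)
  have "[card K = card {k \<in> K. ?f k = k}] (mod t)"
  proof (rule card_fixpoints_cong[OF t(1) finK])
    show "?f ` K \<subseteq> K" using K_conj gG by blast
    show "(?f ^^ t) k = k" if "k \<in> K" for k using iter[OF that, of t] gt KG[OF that] by simp
  qed
  moreover have "{k \<in> K. ?f k = k} = {\<one>}"
  proof -
    have "k = \<one>" if "k \<in> K" "?f k = k" for k
    proof (rule ccontr)
      assume "k \<noteq> \<one>"
      then have "centralizes g"
        using centralizes_if_eigenvector[OF gG gN N that(1), of 1] that KG by simp
      then show False using nc g_def by blast
    qed
    then show ?thesis using gG sub by (auto simp: subgroup.one_closed)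
  qed
  ultimately have "[1 = p\<^sup>2] (mod t)" using cardK by (simp add: cong_sym)
  then have "t dvd p\<^sup>2 - 1" using cong_altdef_nat[of 1 "p\<^sup>2" t] prime_gt_0_nat[OF p]
    by (metis One_nat_def Suc_leI cong_sym cong_altdef_nat zero_less_power)
  then show False using t by blast
qed

text \<open>\<open>d\<close> is the order of the automorphism induced by \<open>y\<close>. For a
  prime \<open>t\<close> dividing \<open>d\<close> but not \<open>p\<^sup>2 - 1\<close>, the power
  \<open>y^(N div t)\<close> centralizes \<open>K\<close>, so \<open>d\<close>, and with it
  \<open>t\<close>, divides \<open>N div t\<close>, against squarefreeness.\<close>

lemma centralizes_period:
  assumes y: "y \<in> carrier G" "y [^] N = \<one>" and N: "N > 0" "coprime N p" "coprime N (p - 1)" "squarefree N"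
  obtains d where "d > 0" "d dvd N" "\<And>i. centralizes (y [^] (i::nat)) \<longleftrightarrow> d dvd i"
    "\<And>t. Factorial_Ring.prime t \<Longrightarrow> t dvd d \<Longrightarrow> t dvd p\<^sup>2 - 1"
proof -
  let ?C = "{g. centralizes g}"
  define d where "d = (LEAST d. d > 0 \<and> centralizes (y [^] (d::nat)))"
  have "centralizes (y [^] N)" using y subgroup.one_closed[OF centralizes_subgroup] by simp
  then have d: "d > 0" "centralizes (y [^] d)" and least: "\<And>e. e > 0 \<Longrightarrow> centralizes (y [^] e) \<Longrightarrow> d \<le> e"
    unfolding d_def using N(1) LeastI[of "\<lambda>d. d > 0 \<and> centralizes (y [^] (d::nat))" N]
    by (auto intro: Least_le)
  have mult: "centralizes (y [^] (d * i))" for i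
  proof (induction i)
    case 0
    then show ?case using subgroup.one_closed[OF centralizes_subgroup] by simp
  next
    case (Suc i)
    have "y [^] (d * Suc i) = y [^] d \<otimes> y [^] (d * i)" using y(1) by (simp add: nat_pow_mult)
    then show ?case using subgroup.m_closed[OF centralizes_subgroup, of "y [^] d" "y [^] (d * i)"] d(2) Suc by simp
  qed
  have iff: "centralizes (y [^] (i::nat)) \<longleftrightarrow> d dvd i" for i
  proof
    assume i: "centralizes (y [^] i)"
    have "y [^] i = y [^] (d * (i div d)) \<otimes> y [^] (i mod d)" using y(1) by (simp add: nat_pow_mult)
    then have "y [^] (i mod d) = inv (y [^] (d * (i div d))) \<otimes> y [^] i"
      using y(1) by (simp add: inv_solve_left)
    then have "centralizes (y [^] (i mod d))"
      using subgroup.m_closed[OF centralizes_subgroup] subgroup.m_inv_closed[OF centralizes_subgroup] mult i by simp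
    then have "i mod d = 0" using least[of "i mod d"] mod_less_divisor[OF d(1), of i] by linarith
    then show "d dvd i" by blast
  qed (use mult in auto)
  have dN: "d dvd N" using iff \<open>centralizes (y [^] N)\<close> by blast
  have "t dvd p\<^sup>2 - 1" if t: "Factorial_Ring.prime t" "t dvd d" for t
  proof (rule ccontr)
    assume "\<not> t dvd p\<^sup>2 - 1"
    then have "centralizes (y [^] (N div t))"
      using centralizes_pow_cofactor[OF y N(1-3) t(1)] t(2) dN dvd_trans by blast
    then have "t dvd N div t" using iff t(2) dvd_trans by blast
    then have "t\<^sup>2 dvd N" using t dN by (metis dvd_mult_div_cancel dvd_trans mult_dvd_mono dvd_refl power2_eq_square)
    then show False using squarefreeD[OF N(4)] t(1) not_prime_unit by blast
  qed
  then show ?thesis using that d(1) dN iff by blast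
qed

end

text \<open>Sending one basis to the other intertwines the two actions, because both have the same
  matrix of exponents \<open>a\<close>, \<open>b\<close>, \<open>c\<close>,
  \<open>d\<close>.\<close>

lemma splits_iso_elementary:
  assumes G: "prime_square_kernel G K p" "finite (carrier G)" "splits G K y"
    and H: "prime_square_kernel H L p" "finite (carrier H)" "splits H L w"
    and ord: "group.ord G y = group.ord H w"
    and bx: "prime_square_kernel.basis_pair G K x z" and bu: "prime_square_kernel.basis_pair H L u v"
    and cx: "y \<otimes>\<^bsub>G\<^esub> x \<otimes>\<^bsub>G\<^esub> inv\<^bsub>G\<^esub> y = x [^]\<^bsub>G\<^esub> (a::nat) \<otimes>\<^bsub>G\<^esub> z [^]\<^bsub>G\<^esub> (b::nat)"
      "y \<otimes>\<^bsub>G\<^esub> z \<otimes>\<^bsub>G\<^esub> inv\<^bsub>G\<^esub> y = x [^]\<^bsub>G\<^esub> (c::nat) \<otimes>\<^bsub>G\<^esub> z [^]\<^bsub>G\<^esub> (d::nat)"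
    and cu: "w \<otimes>\<^bsub>H\<^esub> u \<otimes>\<^bsub>H\<^esub> inv\<^bsub>H\<^esub> w = u [^]\<^bsub>H\<^esub> a \<otimes>\<^bsub>H\<^esub> v [^]\<^bsub>H\<^esub> b"
      "w \<otimes>\<^bsub>H\<^esub> v \<otimes>\<^bsub>H\<^esub> inv\<^bsub>H\<^esub> w = u [^]\<^bsub>H\<^esub> c \<otimes>\<^bsub>H\<^esub> v [^]\<^bsub>H\<^esub> d"
  shows "G \<cong> H"
proof -
  interpret A: prime_square_kernel G K p by fact
  interpret B: prime_square_kernel H L p by fact
  have xz: "x \<in> K" "z \<in> K" and uv: "u \<in> L" "v \<in> L"
    using bx bu unfolding A.basis_pair_def B.basis_pair_def by auto
  have yG: "y \<in> carrier G" and wH: "w \<in> carrier H" using G(3) H(3) unfolding splits_def by auto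
  define \<phi> where "\<phi> k = (\<lambda>(i, j). u [^]\<^bsub>H\<^esub> i \<otimes>\<^bsub>H\<^esub> v [^]\<^bsub>H\<^esub> j) (SOME (i::nat, j::nat). k = x [^]\<^bsub>G\<^esub> i \<otimes>\<^bsub>G\<^esub> z [^]\<^bsub>G\<^esub> j)" for k
  have iff: "x [^]\<^bsub>G\<^esub> i \<otimes>\<^bsub>G\<^esub> z [^]\<^bsub>G\<^esub> j = x [^]\<^bsub>G\<^esub> i' \<otimes>\<^bsub>G\<^esub> z [^]\<^bsub>G\<^esub> j' \<longleftrightarrow>
      u [^]\<^bsub>H\<^esub> i \<otimes>\<^bsub>H\<^esub> v [^]\<^bsub>H\<^esub> j = u [^]\<^bsub>H\<^esub> i' \<otimes>\<^bsub>H\<^esub> v [^]\<^bsub>H\<^esub> j'" for i j i' j' :: nat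
    using A.basis_eq_iff[OF bx] B.basis_eq_iff[OF bu] by simp
  have \<phi>: "\<phi> (x [^]\<^bsub>G\<^esub> i \<otimes>\<^bsub>G\<^esub> z [^]\<^bsub>G\<^esub> j) = u [^]\<^bsub>H\<^esub> i \<otimes>\<^bsub>H\<^esub> v [^]\<^bsub>H\<^esub> j" for i j :: nat
  proof -
    define q where "q = (SOME (i'::nat, j'::nat). x [^]\<^bsub>G\<^esub> i \<otimes>\<^bsub>G\<^esub> z [^]\<^bsub>G\<^esub> j = x [^]\<^bsub>G\<^esub> i' \<otimes>\<^bsub>G\<^esub> z [^]\<^bsub>G\<^esub> j')"
    have "case q of (i', j') \<Rightarrow> x [^]\<^bsub>G\<^esub> i \<otimes>\<^bsub>G\<^esub> z [^]\<^bsub>G\<^esub> j = x [^]\<^bsub>G\<^esub> i' \<otimes>\<^bsub>G\<^esub> z [^]\<^bsub>G\<^esub> j'"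
      unfolding q_def by (rule someI[of _ "(i, j)"]) simp
    then have "u [^]\<^bsub>H\<^esub> i \<otimes>\<^bsub>H\<^esub> v [^]\<^bsub>H\<^esub> j = u [^]\<^bsub>H\<^esub> fst q \<otimes>\<^bsub>H\<^esub> v [^]\<^bsub>H\<^esub> snd q"
      using iff by (simp add: case_prod_unfold)
    then show ?thesis unfolding \<phi>_def q_def by (simp add: case_prod_unfold)
  qed
  have bij: "bij_betw \<phi> K L"
    unfolding bij_betw_def
  proof
    show "inj_on \<phi> K"
      unfolding A.basis_span[OF bx] by (rule inj_onI) (auto simp: \<phi> iff)
    show "\<phi> ` K = L"
      unfolding A.basis_span[OF bx] B.basis_span[OF bu] by (auto simp: \<phi> image_iff) (metis \<phi>)+
  qed
  show ?thesis
  proof (rule splits_iso[OF A.is_group G(2,3) B.is_group H(2,3) ord bij])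
    fix k l assume "k \<in> K" "l \<in> K"
    then obtain i j i' j' where "k = x [^]\<^bsub>G\<^esub> (i::nat) \<otimes>\<^bsub>G\<^esub> z [^]\<^bsub>G\<^esub> (j::nat)" "l = x [^]\<^bsub>G\<^esub> (i'::nat) \<otimes>\<^bsub>G\<^esub> z [^]\<^bsub>G\<^esub> (j'::nat)"
      using A.basis_span[OF bx] by blast
    then show "\<phi> (k \<otimes>\<^bsub>G\<^esub> l) = \<phi> k \<otimes>\<^bsub>H\<^esub> \<phi> l"
      by (simp add: A.basis_mult[OF xz] B.basis_mult[OF uv] \<phi>)
  next
    fix k assume "k \<in> K"
    then obtain i j where k: "k = x [^]\<^bsub>G\<^esub> (i::nat) \<otimes>\<^bsub>G\<^esub> z [^]\<^bsub>G\<^esub> (j::nat)"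
      using A.basis_span[OF bx] by blast
    show "\<phi> (y \<otimes>\<^bsub>G\<^esub> k \<otimes>\<^bsub>G\<^esub> inv\<^bsub>G\<^esub> y) = w \<otimes>\<^bsub>H\<^esub> \<phi> k \<otimes>\<^bsub>H\<^esub> inv\<^bsub>H\<^esub> w"
      unfolding k \<phi> A.conj_basis[OF xz yG] B.conj_basis[OF uv wH] cx cu
      by (simp add: A.basis_pow[OF xz] A.basis_mult[OF xz] B.basis_pow[OF uv] B.basis_mult[OF uv] \<phi>)
  qed
qed

context prime_square_kernel
begin

text \<open>Without eigenvectors any nontrivial \<open>x\<close> and its image are independent. In
  this basis the action is a companion matrix, determined by trace and determinant.\<close>

lemma conj_basis_pair:
  assumes y: "y \<in> carrier G" "y [^] N = \<one>" and N: "N > 0" "coprime N p" "coprime N (p - 1)"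
    and nc: "\<not> centralizes y" and x: "x \<in> K" "x \<noteq> \<one>"
  shows "basis_pair x (y \<otimes> x \<otimes> inv y)"
  using centralizes_if_eigenvector[OF y N x] nc x K_conj[OF x(1) y(1)] unfolding basis_pair_def by blast

text \<open>
  The determinant of the action of \<open>y\<close> is a root of unity of order prime to \<open>p - 1\<close>, so it is \<open>1\<close>.
\<close>

lemma conj_trace:
  assumes y: "y \<in> carrier G" "y [^] N = \<one>" and N: "N > 0" "coprime N p" "coprime N (p - 1)"
    and b: "basis_pair x (y \<otimes> x \<otimes> inv y)"
  obtains a :: nat where "a < p"
    "y \<otimes> (y \<otimes> x \<otimes> inv y) \<otimes> inv y = x [^] (p - 1) \<otimes> (y \<otimes> x \<otimes> inv y) [^] a"
proof -
  define z where "z = y \<otimes> x \<otimes> inv y"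
  have b': "basis_pair x z" using b z_def by simp
  have xz: "x \<in> K" "z \<in> K" using b' unfolding basis_pair_def by auto
  obtain c a where ca: "y \<otimes> z \<otimes> inv y = x [^] (c::nat) \<otimes> z [^] (a::nat)"
    using K_conj[OF xz(2) y(1)] basis_span[OF b'] by blast
  \<comment> \<open>Coordinates of the \<open>i\<close>-th image of \<open>x\<close> in the basis
    \<open>x\<close>, \<open>z\<close>, following the action that sends \<open>x\<close> to
    \<open>z\<close> and \<open>z\<close> to \<open>x^c z^a\<close>.\<close>
  define uv where "uv = rec_nat (1::nat, 0::nat) (\<lambda>_ (u, v). (c * v, u + a * v))"
  define u v where "u i = fst (uv i)" and "v i = snd (uv i)" for i
  have uv0: "u 0 = 1" "v 0 = 0" and uvS: "u (Suc i) = c * v i" "v (Suc i) = u i + a * v i" for i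
    unfolding u_def v_def uv_def by (simp_all add: case_prod_unfold)
  have orb: "y [^] i \<otimes> x \<otimes> inv (y [^] i) = x [^] u i \<otimes> z [^] v i" for i
  proof (induction i)
    case 0
    show ?case using xz KG by (simp add: uv0)
  next
    case (Suc i)
    have "y [^] Suc i \<otimes> x \<otimes> inv (y [^] Suc i) = y \<otimes> (y [^] i \<otimes> x \<otimes> inv (y [^] i)) \<otimes> inv y"
      using conj_conj[OF y(1), of "y [^] i" x] y(1) xz KG nat_pow_Suc2[OF y(1)] by simp
    also have "\<dots> = z [^] u i \<otimes> (x [^] c \<otimes> z [^] a) [^] v i"
      unfolding Suc conj_basis[OF xz y(1)] by (simp add: ca flip: z_def)
    also have "\<dots> = (x [^] (0::nat) \<otimes> z [^] u i) \<otimes> (x [^] (c * v i) \<otimes> z [^] (a * v i))"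
      using basis_pow[OF xz] xz KG by simp
    also have "\<dots> = x [^] u (Suc i) \<otimes> z [^] v (Suc i)"
      by (simp only: basis_mult[OF xz] uvS add_0)
    finally show ?case .
  qed
  \<comment> \<open>\<open>- c\<close> is the determinant of the action; consecutive coordinate
    pairs are the columns of its powers.\<close>
  have det: "int (u i) * int (v (Suc i)) - int (v i) * int (u (Suc i)) = (- int c) ^ i" for i
  proof (induction i)
    case (Suc i)
    have "int (u (Suc i)) * int (v (Suc (Suc i))) - int (v (Suc i)) * int (u (Suc (Suc i))) =
      - int c * (int (u i) * int (v (Suc i)) - int (v i) * int (u (Suc i)))"
      by (simp add: uvS algebra_simps)
    then show ?case using Suc by simp
  qed (simp add: uv0 uvS)
  have "x [^] u N \<otimes> z [^] v N = x [^] (1::nat) \<otimes> z [^] (0::nat)"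
    using orb[of N] y xz KG by simp
  then have 1: "[u N = 1] (mod p)" "[v N = 0] (mod p)" using basis_eq_iff[OF b'] by blast+
  have "x [^] u (Suc N) \<otimes> z [^] v (Suc N) = x [^] (0::nat) \<otimes> z [^] (1::nat)"
    using orb[of "Suc N"] y xz KG by (simp add: z_def)
  then have 2: "[u (Suc N) = 0] (mod p)" "[v (Suc N) = 1] (mod p)" using basis_eq_iff[OF b'] by blast+
  have i: "[int (u N) = 1] (mod int p)" "[int (v N) = 0] (mod int p)" "[int (u (Suc N)) = 0] (mod int p)"
    "[int (v (Suc N)) = 1] (mod int p)"
    using 1 2 cong_int_iff by (metis of_nat_0 of_nat_1)+
  have "[int (u N) * int (v (Suc N)) - int (v N) * int (u (Suc N)) = 1 * 1 - 0 * 0] (mod int p)"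
    by (intro cong_diff cong_mult i)
  then have det1: "[(- int c) ^ N = 1] (mod int p)" unfolding det by simp
  have p1: "p > 1" using p by (rule prime_gt_1_nat)
  \<comment> \<open>\<open>(p - 1) * c\<close> is a natural number congruent to \<open>- c\<close>,
    as required by the lemma on roots of unity, which speaks of naturals.\<close>
  have cc: "[int ((p - 1) * c) = - int c] (mod int p)"
  proof -
    have "int ((p - 1) * c) - (- int c) = int p * int c" using p1 by (simp add: of_nat_diff algebra_simps)
    then show ?thesis by (simp add: cong_iff_dvd_diff)
  qed
  have "[int (((p - 1) * c) ^ N) = 1] (mod int p)"
    using cong_trans[OF cong_pow[OF cc, of N] det1] by simp
  then have "[((p - 1) * c) ^ N = 1] (mod p)" by (metis cong_int_iff of_nat_1)
  \<comment> \<open>The determinant is 1, so \<open>c\<close> is -1, which appears as the exponent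
    \<open>p - 1\<close>.\<close>
  then have "[(p - 1) * c = 1] (mod p)" using prime_power_eq_1_coprime[OF p _ N(3,1)] by blast
  then have "[int ((p - 1) * c) = 1] (mod int p)" by (metis cong_int_iff of_nat_1)
  then have "[- int c = 1] (mod int p)" using cc cong_sym cong_trans by blast
  then have "int p dvd int c + 1" by (metis cong_iff_dvd_diff dvd_minus_iff minus_diff_eq diff_minus_eq_add add.commute)
  then have "int p dvd int c - int (p - 1)" using p1 by (simp add: of_nat_diff algebra_simps dvd_diff_right_iff)
  then have "[c = p - 1] (mod p)" by (simp add: cong_iff_dvd_diff flip: cong_int_iff)
  moreover have "[a = a mod p] (mod p)" by (simp add: cong_def)
  ultimately have "x [^] c \<otimes> z [^] a = x [^] (p - 1) \<otimes> z [^] (a mod p)" using basis_eq_iff[OF b'] by blast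
  then show ?thesis using that[of "a mod p"] ca p1 unfolding z_def by simp
qed

lemma comm_group_kernel: "comm_group (G\<lparr>carrier := K\<rparr>)"
proof -
  interpret KK: group "G\<lparr>carrier := K\<rparr>" using subgroup_imp_group[OF sub] .
  show ?thesis by (rule KK.group_comm_groupI) (simp add: comm)
qed

lemma kernel_int_pow:
  assumes "k \<in> K"
  shows "k [^]\<^bsub>G\<lparr>carrier := K\<rparr>\<^esub> (i::int) = k [^] i"
proof -
  have nat: "k [^]\<^bsub>G\<lparr>carrier := K\<rparr>\<^esub> n = k [^] n" for n :: nat
    by (rule nat_pow_consistent[symmetric])
  show ?thesis
    unfolding int_pow_def2[of "G\<lparr>carrier := K\<rparr>"] int_pow_def2[of G] nat
    using m_inv_consistent[OF sub K_pow[OF assms], of "nat (- i)"]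
    by (cases "i < 0") (simp_all only: if_True if_False)
qed

text \<open>Indexed by integers, since the trace identities pair the indices \<open>i + j\<close>
  and \<open>i - j\<close>.\<close>

definition orbit_seq :: "'a \<Rightarrow> 'a \<Rightarrow> int \<Rightarrow> 'a" where
  "orbit_seq y x i = y [^] i \<otimes> x \<otimes> inv (y [^] i)"

lemma orbit_seq_closed: "y \<in> carrier G \<Longrightarrow> x \<in> K \<Longrightarrow> orbit_seq y x i \<in> K"
  unfolding orbit_seq_def using K_conj by simp

lemma orbit_seq_0: "x \<in> K \<Longrightarrow> orbit_seq y x 0 = x"
  unfolding orbit_seq_def using KG by simp

lemma orbit_seq_shift:
  assumes "y \<in> carrier G" "x \<in> K"
  shows "y [^] m \<otimes> orbit_seq y x i \<otimes> inv (y [^] m) = orbit_seq y x (m + i)"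
  unfolding orbit_seq_def
  using conj_conj[of "y [^] m" "y [^] i" x] assms KG by (simp add: int_pow_mult)

text \<open>The Cayley-Hamilton relation of a matrix of determinant 1 and trace \<open>a\<close>,
  moved along the orbit by conjugation with a power of \<open>y\<close>; the exponent
  \<open>p - 1\<close> is the scalar -1 and goes to the other side as a factor
  \<open>x\<close>.\<close>

lemma orbit_seq_recurrence:
  assumes y: "y \<in> carrier G" and x: "x \<in> K"
    and tr: "y \<otimes> (y \<otimes> x \<otimes> inv y) \<otimes> inv y = x [^] (p - 1) \<otimes> (y \<otimes> x \<otimes> inv y) [^] (a::nat)"
  shows "orbit_seq y x (i + 1) \<otimes> orbit_seq y x (i - 1) = orbit_seq y x i [^] int a"
proof -
  let ?z = "orbit_seq y x"
  have z1: "?z 1 = y \<otimes> x \<otimes> inv y" using y by (simp add: orbit_seq_def)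
  have z2: "?z 2 = y \<otimes> ?z 1 \<otimes> inv y" using orbit_seq_shift[OF y x, of 1 1] y by simp
  have z1K: "?z 1 \<in> K" using orbit_seq_closed[OF y x] .
  have "?z 2 = ?z 1 [^] a \<otimes> x [^] (p - 1)"
    using tr comm[OF K_pow[OF x] K_pow[OF z1K]] by (simp add: z2 z1)
  then have "?z 2 \<otimes> x = ?z 1 [^] a \<otimes> x [^] Suc (p - 1)"
    using KG[OF x] KG[OF z1K] by (simp add: m_assoc)
  also have "\<dots> = ?z 1 [^] a" using exp[OF x] prime_gt_0_nat[OF p] KG[OF z1K] by simp
  finally have e: "?z 2 \<otimes> x = ?z 1 [^] a" .
  let ?g = "y [^] (i - 1)"
  have gG: "?g \<in> carrier G" using y by simp
  have "?z (i + 1) \<otimes> ?z (i - 1) = ?g \<otimes> (?z 2 \<otimes> x) \<otimes> inv ?g"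
    using conj_mult[OF orbit_seq_closed[OF y x] x gG, of 2] orbit_seq_shift[OF y x, of "i - 1" 2]
      orbit_seq_shift[OF y x, of "i - 1" 0] orbit_seq_0[OF x] by (simp add: add.commute)
  also have "\<dots> = (?g \<otimes> ?z 1 \<otimes> inv ?g) [^] a"
    unfolding e using conj_pow_closed[OF gG KG[OF z1K], of a] by simp
  also have "\<dots> = ?z i [^] int a"
    using orbit_seq_shift[OF y x, of "i - 1" 1] by (simp add: int_pow_int)
  finally show ?thesis .
qed

text \<open>The product of the orbit over a full period is fixed by \<open>y\<close>, hence trivial
  because \<open>y\<close> has no eigenvector in \<open>K\<close>. The same product is
  \<open>x\<close> raised to the value of \<open>trace_sum_poly h\<close> at
  \<open>a\<close>.\<close>

lemma trace_is_root:
  assumes y: "y \<in> carrier G" "y [^] N = \<one>" and N: "N > 0" "coprime N p" "coprime N (p - 1)"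
    and nc: "\<not> centralizes y" and per: "centralizes (y [^] Suc (2 * h))" and x: "x \<in> K" "x \<noteq> \<one>"
    and tr: "y \<otimes> (y \<otimes> x \<otimes> inv y) \<otimes> inv y = x [^] (p - 1) \<otimes> (y \<otimes> x \<otimes> inv y) [^] (a::nat)"
  shows "int p dvd poly (trace_sum_poly h) (int a)"
proof -
  interpret KK: comm_group "G\<lparr>carrier := K\<rparr>" by (rule comm_group_kernel)
  let ?z = "orbit_seq y x" and ?l = "Suc (2 * h)"
  have zK: "?z i \<in> carrier (G\<lparr>carrier := K\<rparr>)" for i using orbit_seq_closed[OF y(1) x(1)] by simp
  have rec: "?z (i + 1) \<otimes>\<^bsub>G\<lparr>carrier := K\<rparr>\<^esub> ?z (i - 1) = ?z i [^]\<^bsub>G\<lparr>carrier := K\<rparr>\<^esub> int a" for i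
    using orbit_seq_recurrence[OF y(1) x(1) tr, of i] kernel_int_pow[OF orbit_seq_closed[OF y(1) x(1)]] by simp
  have zper: "?z (i + int ?l) = ?z i" for i
  proof -
    have "?z (int ?l + i) = y [^] int ?l \<otimes> ?z i \<otimes> inv (y [^] int ?l)"
      using orbit_seq_shift[OF y(1) x(1)] by simp
    also have "\<dots> = y [^] ?l \<otimes> ?z i \<otimes> inv (y [^] ?l)" by (simp only: int_pow_int)
    also have "\<dots> = ?z i" using per orbit_seq_closed[OF y(1) x(1)] unfolding centralizes_def by blast
    finally show ?thesis by (simp add: add.commute)
  qed
  define W where "W m = KK.window ?z m ?l" for m
  have wK: "KK.window ?z m j \<in> K" for m j using KK.window_closed[of ?z, OF zK] by simp
  have shift: "y \<otimes> KK.window ?z m j \<otimes> inv y = KK.window ?z (m + 1) j" for m j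
  proof (induction j)
    case 0
    show ?case using y by simp
  next
    case (Suc j)
    have "y \<otimes> ?z (m + int j) \<otimes> inv y = ?z (m + 1 + int j)"
      using orbit_seq_shift[OF y(1) x(1), of 1 "m + int j"] y(1) by (simp add: algebra_simps)
    then show ?case
      using conj_mult[OF wK orbit_seq_closed[OF y(1) x(1)] y(1), of m j "m + int j"] Suc by simp
  qed
  have "y \<otimes> W m \<otimes> inv y = W m" for m
    unfolding W_def shift by (rule KK.window_periodic) (use zK zper in auto)
  moreover have WG: "W m \<in> carrier G" for m unfolding W_def using wK KG by blast
  ultimately have "y \<otimes> W m \<otimes> inv y = W m [^] (1::nat)" for m by (metis nat_pow_eone)
  then have "W m = \<one>" for m
    using centralizes_if_eigenvector[OF y N, of "W m" 1] wK nc unfolding W_def by blast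
  moreover have "W (0 - int h) = ?z 0 [^]\<^bsub>G\<lparr>carrier := K\<rparr>\<^esub> poly (trace_sum_poly h) (int a)"
    unfolding W_def by (rule KK.window_trace_sum) (use zK rec in auto)
  ultimately have "x [^] poly (trace_sum_poly h) (int a) = \<one>"
    using kernel_int_pow[OF x(1)] orbit_seq_0[OF x(1)] by simp
  then show ?thesis using int_pow_eq_id[OF KG[OF x(1)]] K_ord[OF x] by simp
qed

text \<open>The assumption says that \<open>y^i\<close> has trace \<open>a\<close>; the claim is the
  recurrence for \<open>y^i\<close> at index 0.\<close>

lemma trace_symmetric_product:
  assumes y: "y \<in> carrier G" and x: "x \<in> K"
    and tr: "(y [^] (i::nat)) \<otimes> ((y [^] i) \<otimes> x \<otimes> inv (y [^] i)) \<otimes> inv (y [^] i) =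
      x [^] (p - 1) \<otimes> ((y [^] i) \<otimes> x \<otimes> inv (y [^] i)) [^] (a::nat)"
  shows "orbit_seq y x (int i) \<otimes> orbit_seq y x (- int i) = x [^] a"
proof -
  have seq: "orbit_seq (y [^] i) x j = orbit_seq y x (int i * j)" for j
    unfolding orbit_seq_def using y by (simp add: int_pow_pow flip: int_pow_int)
  show ?thesis
    using orbit_seq_recurrence[OF _ x tr, of 0] y orbit_seq_0[OF x] unfolding seq
    by (simp add: int_pow_int)
qed

text \<open>For equal traces, \<open>\<zeta>^i + \<zeta>^-i = \<zeta>^j + \<zeta>^-j\<close> would
  factor as \<open>(\<zeta>^j - \<zeta>^i) (1 - \<zeta>^-(i+j)) = 0\<close>. The element
  \<open>w\<close> represents the first factor up to sign: it is fixed by \<open>y^(i+j)\<close>,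
  hence trivial, and then \<open>y^(j-i)\<close> fixes \<open>x\<close>; both exponents lie strictly
  between 0 and \<open>l\<close>.\<close>

lemma traces_distinct:
  assumes y: "y \<in> carrier G" "y [^] N = \<one>" and N: "N > 0" "coprime N p" "coprime N (p - 1)"
    and per: "\<And>i::nat. centralizes (y [^] i) \<longleftrightarrow> l dvd i" and x: "x \<in> K" "x \<noteq> \<one>"
    and ij: "0 < i" "i < j" "i + j < l"
    and tri: "(y [^] (i::nat)) \<otimes> ((y [^] i) \<otimes> x \<otimes> inv (y [^] i)) \<otimes> inv (y [^] i) =
      x [^] (p - 1) \<otimes> ((y [^] i) \<otimes> x \<otimes> inv (y [^] i)) [^] (a::nat)"
    and trj: "(y [^] (j::nat)) \<otimes> ((y [^] j) \<otimes> x \<otimes> inv (y [^] j)) \<otimes> inv (y [^] j) =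
      x [^] (p - 1) \<otimes> ((y [^] j) \<otimes> x \<otimes> inv (y [^] j)) [^] (a::nat)"
  shows False
proof -
  interpret KK: comm_group "G\<lparr>carrier := K\<rparr>" by (rule comm_group_kernel)
  let ?z = "orbit_seq y x"
  have zK: "?z m \<in> K" for m using orbit_seq_closed[OF y(1) x(1)] .
  have zG: "?z m \<in> carrier G" for m using zK KG by blast
  have powN: "(y [^] (m::nat)) [^] N = \<one>" for m
    using y by (metis mult.commute nat_pow_one nat_pow_pow)
  have eq: "?z (int i) \<otimes> ?z (- int i) = ?z (int j) \<otimes> ?z (- int j)"
    using trace_symmetric_product[OF y(1) x(1) tri] trace_symmetric_product[OF y(1) x(1) trj] by simp
  define w where "w = ?z (- int j) \<otimes> inv (?z (- int i))"
  have invK: "inv (?z m) \<in> K" for m using zK subgroup.m_inv_closed[OF sub] by blast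
  have wK: "w \<in> K" unfolding w_def using zK invK subgroup.m_closed[OF sub] by blast
  have w2: "w = ?z (int i) \<otimes> inv (?z (int j))"
  proof -
    have "?z (int i) = (?z (int j) \<otimes> ?z (- int j)) \<otimes> inv (?z (- int i))"
      using eq zG by (metis inv_solve_right m_closed)
    also have "\<dots> = ?z (int j) \<otimes> w" unfolding w_def using zG by (simp add: m_assoc)
    also have "\<dots> = w \<otimes> ?z (int j)" using comm[OF zK wK] .
    finally show ?thesis using zG KG[OF wK] by (simp add: inv_solve_right)
  qed
  have conj_inv: "g \<otimes> inv k \<otimes> inv g = inv (g \<otimes> k \<otimes> inv g)" if "g \<in> carrier G" "k \<in> carrier G" for g k
    using that by (simp add: inv_mult_group m_assoc)
  let ?g = "y [^] (i + j)"
  have gG: "?g \<in> carrier G" using y by simp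
  have g_int: "?g = y [^] (int i + int j)" by (simp flip: int_pow_int)
  have "?g \<otimes> w \<otimes> inv ?g = (?g \<otimes> ?z (- int j) \<otimes> inv ?g) \<otimes> inv (?g \<otimes> ?z (- int i) \<otimes> inv ?g)"
    unfolding w_def using conj_mult[OF zK invK gG] conj_inv[OF gG zG] by simp
  also have "\<dots> = w"
    unfolding g_int orbit_seq_shift[OF y(1) x(1)] by (simp add: w2)
  finally have fixw: "?g \<otimes> w \<otimes> inv ?g = w [^] (1::nat)" using KG[OF wK] by simp
  have "w = \<one>"
  proof (rule ccontr)
    assume "w \<noteq> \<one>"
    then have "centralizes ?g" using centralizes_if_eigenvector[OF gG powN N wK _ fixw] by blast
    then have "l dvd i + j" using per by blast
    then show False using ij by (auto dest: dvd_imp_le)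
  qed
  then have "?z (int i) = ?z (int j)" using w2 zG by (metis inv_closed inv_inv inv_equality)
  then have "y [^] (- int i) \<otimes> ?z (int i) \<otimes> inv (y [^] (- int i)) = y [^] (- int i) \<otimes> ?z (int j) \<otimes> inv (y [^] (- int i))"
    by simp
  then have "x = ?z (int j - int i)"
    unfolding orbit_seq_shift[OF y(1) x(1)] by (simp add: orbit_seq_0[OF x(1)])
  then have e: "y [^] (j - i) \<otimes> x \<otimes> inv (y [^] (j - i)) = x"
    unfolding orbit_seq_def using ij KG[OF x(1)] by (simp flip: int_pow_int)
  have "centralizes (y [^] (j - i))"
    by (rule centralizes_if_eigenvector[OF _ powN N x, of _ 1]) (use y e KG[OF x(1)] in simp_all)
  then have "l dvd j - i" using per by blast
  then show False using ij by (auto dest: dvd_imp_le)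
qed

end

text \<open>In companion bases only the trace distinguishes the two actions. The trace of
  \<open>w\<close> is a root of \<open>trace_sum_poly h\<close>, and the traces of
  \<open>y^1\<close> to \<open>y^h\<close> exhaust its at most \<open>h\<close> roots modulo
  \<open>p\<close>, so some \<open>y^i\<close> has the trace of \<open>w\<close>; it remains to make
  the exponent prime to \<open>N\<close>.\<close>

lemma noncentral_elementary_iso:
  assumes G: "prime_square_kernel G K p" "finite (carrier G)" "splits G K y" "group.ord G y = N"
    and H: "prime_square_kernel H L p" "finite (carrier H)" "splits H L w" "group.ord H w = N"
    and N: "N > 0" "coprime N p" "coprime N (p - 1)" "squarefree N"
    and l: "Factorial_Ring.prime l" "l dvd N" "l = Suc (2 * h)"
    and perG: "\<And>i::nat. prime_square_kernel.centralizes G K (y [^]\<^bsub>G\<^esub> i) \<longleftrightarrow> l dvd i"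
    and perH: "\<And>i::nat. prime_square_kernel.centralizes H L (w [^]\<^bsub>H\<^esub> i) \<longleftrightarrow> l dvd i"
  shows "G \<cong> H"
proof -
  interpret A: prime_square_kernel G K p by fact
  interpret B: prime_square_kernel H L p by fact
  have yG: "y \<in> carrier G" and wH: "w \<in> carrier H" using G(3) H(3) unfolding splits_def by auto
  have yN: "(y [^]\<^bsub>G\<^esub> (m::nat)) [^]\<^bsub>G\<^esub> N = \<one>\<^bsub>G\<^esub>" for m
    using yG G(4) A.pow_ord_eq_1[OF yG] by (metis A.nat_pow_one A.nat_pow_pow mult.commute)
  have wN: "w [^]\<^bsub>H\<^esub> N = \<one>\<^bsub>H\<^esub>" using H(4) B.pow_ord_eq_1[OF wH] by simp
  have h1: "h \<ge> 1" using l prime_gt_1_nat[OF l(1)] by simp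
  obtain x where x: "x \<in> K" "x \<noteq> \<one>\<^bsub>G\<^esub>" using A.basis_exists unfolding A.basis_pair_def by blast
  obtain u where u: "u \<in> L" "u \<noteq> \<one>\<^bsub>H\<^esub>" using B.basis_exists unfolding B.basis_pair_def by blast
  let ?tr = "\<lambda>i::nat. \<lambda>a::nat. (y [^]\<^bsub>G\<^esub> i) \<otimes>\<^bsub>G\<^esub> ((y [^]\<^bsub>G\<^esub> i) \<otimes>\<^bsub>G\<^esub> x \<otimes>\<^bsub>G\<^esub> inv\<^bsub>G\<^esub> (y [^]\<^bsub>G\<^esub> i)) \<otimes>\<^bsub>G\<^esub> inv\<^bsub>G\<^esub> (y [^]\<^bsub>G\<^esub> i) =
      x [^]\<^bsub>G\<^esub> (p - 1) \<otimes>\<^bsub>G\<^esub> ((y [^]\<^bsub>G\<^esub> i) \<otimes>\<^bsub>G\<^esub> x \<otimes>\<^bsub>G\<^esub> inv\<^bsub>G\<^esub> (y [^]\<^bsub>G\<^esub> i)) [^]\<^bsub>G\<^esub> a"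
  have nci: "\<not> A.centralizes (y [^]\<^bsub>G\<^esub> i)" if "i \<in> {1..h}" for i
    using that perG l(3) by (auto dest: dvd_imp_le)
  have bi: "A.basis_pair x (y [^]\<^bsub>G\<^esub> i \<otimes>\<^bsub>G\<^esub> x \<otimes>\<^bsub>G\<^esub> inv\<^bsub>G\<^esub> (y [^]\<^bsub>G\<^esub> i))" if "i \<in> {1..h}" for i
    using A.conj_basis_pair[OF _ yN N(1-3) nci[OF that] x] yG by simp
  have "\<exists>a<p. ?tr i a" if "i \<in> {1..h}" for i
    using A.conj_trace[OF _ yN N(1-3) bi[OF that]] yG by (metis A.nat_pow_closed)
  then obtain a where a: "\<And>i. i \<in> {1..h} \<Longrightarrow> a i < p" "\<And>i. i \<in> {1..h} \<Longrightarrow> ?tr i (a i)" by metis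
  have ncw: "\<not> B.centralizes w"
    using perH[of 1] wH l(1) by auto
  have bw: "B.basis_pair u (w \<otimes>\<^bsub>H\<^esub> u \<otimes>\<^bsub>H\<^esub> inv\<^bsub>H\<^esub> w)" by (rule B.conj_basis_pair[OF wH wN N(1-3) ncw u])
  obtain b where b: "b < p" "w \<otimes>\<^bsub>H\<^esub> (w \<otimes>\<^bsub>H\<^esub> u \<otimes>\<^bsub>H\<^esub> inv\<^bsub>H\<^esub> w) \<otimes>\<^bsub>H\<^esub> inv\<^bsub>H\<^esub> w = u [^]\<^bsub>H\<^esub> (p - 1) \<otimes>\<^bsub>H\<^esub> (w \<otimes>\<^bsub>H\<^esub> u \<otimes>\<^bsub>H\<^esub> inv\<^bsub>H\<^esub> w) [^]\<^bsub>H\<^esub> b"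
    by (rule B.conj_trace[OF wH wN N(1-3) bw])
  let ?R = "{r \<in> {0..<int p}. int p dvd poly (trace_sum_poly h) r}"
  have finR: "finite ?R" by (rule finite_subset[of _ "{0..<int p}"]) auto
  have cardR: "card ?R \<le> h"
    by (rule card_poly_roots_mod_prime[OF A.p trace_sum_poly_monic[OF h1]])
  have bR: "int b \<in> ?R"
    using B.trace_is_root[OF wH wN N(1-3) ncw _ u b(2), of h] b(1) perH[of l] l(3) by simp
  have aR: "int (a i) \<in> ?R" if i: "i \<in> {1..h}" for i
  proof -
    have "A.centralizes ((y [^]\<^bsub>G\<^esub> i) [^]\<^bsub>G\<^esub> Suc (2 * h))"
      using perG[of "i * l"] yG l(3) by (simp only: A.nat_pow_pow dvd_triv_right)
    then have "int p dvd poly (trace_sum_poly h) (int (a i))"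
      using A.trace_is_root[OF _ yN N(1-3) nci[OF i] _ x a(2)[OF i], of h] yG by simp
    then show ?thesis using a(1)[OF i] by simp
  qed
  have neq: "a i \<noteq> a j" if "i \<in> {1..h}" "j \<in> {1..h}" "i < j" for i j
  proof
    assume "a i = a j"
    then have trj: "?tr j (a i)" using a(2)[OF that(2)] by simp
    show False
      by (rule A.traces_distinct[OF yG _ N(1-3) perG x _ that(3) _ a(2)[OF that(1)] trj])
        (use yN[of 1] yG that l(3) in auto)
  qed
  have "inj_on (\<lambda>i. int (a i)) {1..h}"
    by (rule inj_onI) (metis neq nat_neq_iff of_nat_eq_iff)
  then have "card ((\<lambda>i. int (a i)) ` {1..h}) = h" by (simp add: card_image)
  then have "(\<lambda>i. int (a i)) ` {1..h} = ?R"
    using aR cardR by (intro card_seteq[OF finR]) auto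
  then obtain i where i: "i \<in> {1..h}" "a i = b" using bR by (metis (no_types, lifting) imageE of_nat_eq_iff)
  have "\<not> l dvd i" using i l(3) by (auto dest: dvd_imp_le)
  then obtain i0 where i0: "[i0 = i] (mod l)" "coprime i0 N" using coprime_representative[OF l(1,2) N(4)] by blast
  \<comment> \<open>Adding \<open>N * i\<close> changes neither the residue modulo \<open>N\<close>
    nor the one modulo \<open>l\<close>, and ensures \<open>i' \<ge> i\<close>, so that
    \<open>i' - i\<close> is a natural multiple of \<open>l\<close>.\<close>
  define i' where "i' = i0 + N * i"
  have "[i0 = i'] (mod N)" unfolding i'_def by (simp add: cong_def)
  then have i'N: "coprime i' N" using i0(2) by (rule cong_imp_coprime)
  have "i' \<ge> i" unfolding i'_def using N(1) by (simp add: trans_le_add2)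
  have "[i0 = i'] (mod l)" unfolding i'_def using l(2) by (auto simp: cong_def mult.assoc elim!: dvdE)
  then have "[i' = i] (mod l)" using i0(1) cong_sym cong_trans by blast
  then obtain m where m: "i' = i + l * m" using \<open>i' \<ge> i\<close>
    by (metis cong_altdef_nat cong_sym dvdE le_add_diff_inverse)
  have "i' > 0" using \<open>i' \<ge> i\<close> i by simp
  note sp = A.splits_pow[OF G(3) A.norm _ \<open>i' > 0\<close>, unfolded G(4), OF i'N]
  \<comment> \<open>The two powers of \<open>y\<close> differ by a power of \<open>y^l\<close>,
    which centralizes \<open>K\<close>.\<close>
  have conj_eq: "y [^]\<^bsub>G\<^esub> i' \<otimes>\<^bsub>G\<^esub> k \<otimes>\<^bsub>G\<^esub> inv\<^bsub>G\<^esub> (y [^]\<^bsub>G\<^esub> i') = y [^]\<^bsub>G\<^esub> i \<otimes>\<^bsub>G\<^esub> k \<otimes>\<^bsub>G\<^esub> inv\<^bsub>G\<^esub> (y [^]\<^bsub>G\<^esub> i)" if "k \<in> K" for k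
  proof -
    have "y [^]\<^bsub>G\<^esub> i' = y [^]\<^bsub>G\<^esub> i \<otimes>\<^bsub>G\<^esub> y [^]\<^bsub>G\<^esub> (l * m)" using yG m by (simp add: A.nat_pow_mult)
    moreover have "y [^]\<^bsub>G\<^esub> (l * m) \<otimes>\<^bsub>G\<^esub> k \<otimes>\<^bsub>G\<^esub> inv\<^bsub>G\<^esub> (y [^]\<^bsub>G\<^esub> (l * m)) = k"
      using perG[of "l * m"] that unfolding A.centralizes_def by simp
    ultimately show ?thesis
      using A.conj_conj[of "y [^]\<^bsub>G\<^esub> i" "y [^]\<^bsub>G\<^esub> (l * m)" k] yG A.KG[OF that] by simp
  qed
  let ?z = "y [^]\<^bsub>G\<^esub> i \<otimes>\<^bsub>G\<^esub> x \<otimes>\<^bsub>G\<^esub> inv\<^bsub>G\<^esub> (y [^]\<^bsub>G\<^esub> i)"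
  have zK: "?z \<in> K" using A.K_conj x yG by simp
  have c1: "y [^]\<^bsub>G\<^esub> i' \<otimes>\<^bsub>G\<^esub> x \<otimes>\<^bsub>G\<^esub> inv\<^bsub>G\<^esub> (y [^]\<^bsub>G\<^esub> i') = x [^]\<^bsub>G\<^esub> (0::nat) \<otimes>\<^bsub>G\<^esub> ?z [^]\<^bsub>G\<^esub> (1::nat)"
    using conj_eq[OF x(1)] A.KG[OF zK] by simp
  have c2: "y [^]\<^bsub>G\<^esub> i' \<otimes>\<^bsub>G\<^esub> ?z \<otimes>\<^bsub>G\<^esub> inv\<^bsub>G\<^esub> (y [^]\<^bsub>G\<^esub> i') = x [^]\<^bsub>G\<^esub> (p - 1) \<otimes>\<^bsub>G\<^esub> ?z [^]\<^bsub>G\<^esub> b"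
    using conj_eq[OF zK] a(2)[OF i(1)] i(2) by simp
  let ?v = "w \<otimes>\<^bsub>H\<^esub> u \<otimes>\<^bsub>H\<^esub> inv\<^bsub>H\<^esub> w"
  have vL: "?v \<in> L" using B.K_conj u wH by simp
  have d1: "w \<otimes>\<^bsub>H\<^esub> u \<otimes>\<^bsub>H\<^esub> inv\<^bsub>H\<^esub> w = u [^]\<^bsub>H\<^esub> (0::nat) \<otimes>\<^bsub>H\<^esub> ?v [^]\<^bsub>H\<^esub> (1::nat)"
    using B.KG[OF vL] by simp
  show ?thesis
    by (rule splits_iso_elementary[OF G(1,2) sp(1) H(1-3) _ bi[OF i(1)] bw c1 c2 d1 b(2)])
      (use sp(2) H(4) in simp)
qed

subsection \<open>Groups of order a prime square times a squarefree number\<close>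

lemma (in group) prime_square_structure:
  assumes fin: "finite (carrier G)" and p: "Factorial_Ring.prime p" and ordG: "order G = p\<^sup>2 * N"
    and sqf: "squarefree N" and pN: "\<not> p dvd N"
    and no_edge: "\<And>t. Factorial_Ring.prime t \<Longrightarrow> t dvd p * N \<Longrightarrow> coprime (p * N) (t - 1)"
  obtains y where "splits G (torsion G (p\<^sup>2)) y" "local.ord y = N"
    "card (torsion G (p\<^sup>2)) = p\<^sup>2" "torsion G (p\<^sup>2) \<lhd> G"
proof -
  have cop: "coprime (p\<^sup>2) N" using prime_imp_coprime[OF p pN] by simp
  have "normal_index G t" if t: "Factorial_Ring.prime t" "t dvd N" for t
  proof -
    obtain m where m: "N = t * m" using t(2) by blast
    have "\<not> t dvd m" using squarefreeD[OF sqf, of t] t(1) m by (auto simp: power2_eq_square)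
    moreover have "\<not> t dvd p\<^sup>2" using t p pN primes_dvd_imp_eq prime_dvd_power by blast
    ultimately have "\<not> t dvd p\<^sup>2 * m" using t(1) by (simp add: prime_dvd_mult_iff)
    then show ?thesis
      by (intro normal_index_coprime[OF fin t(1), of "p\<^sup>2 * m"])
        (use m ordG no_edge[OF t(1)] t(2) in \<open>simp_all add: power2_eq_square\<close>)
  qed
  then show ?thesis using split_structure[OF fin ordG cop sqf] that by blast
qed

lemma (in group) prime_square_kernel_cases:
  assumes fin: "finite (carrier G)" and p: "Factorial_Ring.prime p"
    and K: "card (torsion G (p\<^sup>2)) = p\<^sup>2" "torsion G (p\<^sup>2) \<lhd> G"
  shows "(\<exists>x\<in>carrier G. local.ord x = p\<^sup>2) \<or> prime_square_kernel G (torsion G (p\<^sup>2)) p"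
proof (cases "\<forall>k\<in>torsion G (p\<^sup>2). k [^] p = \<one>")
  case True
  let ?K = "torsion G (p\<^sup>2)" and ?GK = "G\<lparr>carrier := torsion G (p\<^sup>2)\<rparr>"
  have subK: "subgroup ?K G" using K(2) normal_imp_subgroup by blast
  interpret GK: group ?GK using subgroup_imp_group[OF subK] .
  have finK: "finite (carrier ?GK)" using fin by (simp add: torsion_def)
  have "GK.ord x \<noteq> p\<^sup>2" if "x \<in> carrier ?GK" for x
  proof
    assume o: "GK.ord x = p\<^sup>2"
    have "x [^]\<^bsub>?GK\<^esub> p = \<one>\<^bsub>?GK\<^esub>" using True that by (simp flip: nat_pow_consistent)
    then have "p\<^sup>2 dvd p" using GK.pow_eq_id[OF that] o by metis
    then show False using prime_gt_1_nat[OF p] by (auto simp: power2_eq_square dest: dvd_imp_le)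
  qed
  then have "commuting ?GK"
    using GK.order_prime_square_cases(2)[OF finK p] K(1) by (simp add: order_def)
  then have "prime_square_kernel G ?K p"
    using True p K
    by (intro prime_square_kernel.intro prime_square_kernel_axioms.intro is_group)
      (auto simp: commuting_def)
  then show ?thesis by blast
next
  case False
  then obtain x where x: "x \<in> carrier G" "x [^] (p\<^sup>2) = \<one>" "x [^] p \<noteq> \<one>" unfolding torsion_def by blast
  have "local.ord x dvd p ^ 2" "\<not> local.ord x dvd p" using x pow_eq_id by blast+
  then obtain i where "i \<le> 2" "local.ord x = p ^ i" "\<not> p ^ i dvd p" using p by (auto simp: divides_primepow_nat)
  then have "local.ord x = p\<^sup>2" by (auto simp: le_Suc_eq numeral_2_eq_2)
  then show ?thesis using x by blast
qed

text \<open>A cyclic group of order \<open>p\<^sup>2\<close> has \<open>p (p - 1)\<close>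
  automorphisms, a number prime to \<open>N\<close>, so \<open>y\<close> acts trivially on the
  kernel.\<close>

lemma (in group) prime_square_cyclic_kernel:
  assumes fin: "finite (carrier G)" and p: "Factorial_Ring.prime p"
    and sp: "splits G (torsion G (p\<^sup>2)) y" "local.ord y = N"
    and K: "card (torsion G (p\<^sup>2)) = p\<^sup>2"
    and cop: "coprime N p" "coprime N (p - 1)"
    and x: "x \<in> carrier G" "local.ord x = p\<^sup>2"
  shows "torsion G (p\<^sup>2) = {x [^] (i::nat) | i. True}" "y \<otimes> x \<otimes> inv y = x [^] (1::nat)" "commuting G"
proof -
  have yG: "y \<in> carrier G" using sp(1) unfolding splits_def by auto
  have p0: "p\<^sup>2 > 0" using prime_gt_0_nat[OF p] by simp
  show pows: "torsion G (p\<^sup>2) = {x [^] (i::nat) | i. True}"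
    by (rule torsion_cyclic[OF p0 K x])
  have "x \<in> torsion G (p\<^sup>2)" using x pow_ord_eq_1[OF x(1)] unfolding torsion_def by simp
  then have "y \<otimes> x \<otimes> inv y \<in> torsion G (p\<^sup>2)" by (rule torsion_conj[OF _ yG])
  then obtain k :: nat where k: "y \<otimes> x \<otimes> inv y = x [^] k" using pows by blast
  have kN: "[k ^ N = 1] (mod p\<^sup>2)"
    using conj_pow_exponent_cong[OF yG x(1) k, of N] pow_ord_eq_1[OF yG] x(2) sp(2) by simp
  have "N > 0" using fin yG sp(2) ord_ge_1 by fastforce
  then have "coprime k (p\<^sup>2)" using cong_imp_coprime[OF cong_sym[OF kN]] by simp
  then have "[k ^ totient (p\<^sup>2) = 1] (mod p\<^sup>2)" by (rule euler_theorem)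
  then have "[k ^ gcd N (totient (p\<^sup>2)) = 1] (mod p\<^sup>2)" by (rule cong_power_gcd_eq_1[OF kN])
  moreover have "totient (p\<^sup>2) = p * (p - 1)"
    using totient_prime_power[OF p, of 2] by (simp add: power2_eq_square)
  then have "coprime N (totient (p\<^sup>2))" using cop by simp
  ultimately have "[k = 1] (mod p\<^sup>2)" by simp
  then have "x [^] k = x [^] (1::nat)" by (simp only: pow_eq_pow_iff[OF x(1)] x(2))
  then show c: "y \<otimes> x \<otimes> inv y = x [^] (1::nat)" using k by simp
  then have "x \<otimes> y = y \<otimes> x" using conj_eq_iff_commute[OF yG x(1)] x(1) by simp
  then have "x [^] (i::nat) \<otimes> y = y \<otimes> x [^] i" for i
    using group_commutes_pow[OF _ x(1) yG] by blast
  then show "commuting G"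
    by (intro splits_commuting[OF fin sp(1)]) (auto simp: pows x nat_pow_comm)
qed

text \<open>With an elementary kernel the exponent divides \<open>p * N\<close>, while an element of
  order \<open>p\<^sup>2\<close> prevents this if \<open>p\<close> does not divide \<open>N\<close>;
  the exponent thus tells the two kinds of kernel apart.\<close>

lemma (in group) exponent_dvd_prime_square_kernel:
  assumes fin: "finite (carrier G)" and K: "prime_square_kernel G K p" and "card K * N = order G"
  shows "exponent_dvd G (p * N)"
proof -
  interpret prime_square_kernel G K p by fact
  have "g [^] (p * N) = \<one>" if g: "g \<in> carrier G" for g
    using exp[OF normal_pow_index_mem[OF norm fin assms(3) g]] g by (simp add: nat_pow_pow mult.commute)
  then show ?thesis unfolding exponent_dvd_def torsion_def by blast
qed

lemma (in group) not_exponent_dvd_if_ord: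
  assumes "x \<in> carrier G" "\<not> local.ord x dvd d"
  shows "\<not> exponent_dvd G d"
  using assms pow_eq_id unfolding exponent_dvd_def torsion_def by blast

text \<open>The absence of edges is stated with \<open>p * N\<close>, which has the same prime
  divisors as the order \<open>p\<^sup>2 * N\<close>; it covers edges out of \<open>p\<close> and
  into \<open>p\<close> as well.\<close>

locale prime_square_order =
  fixes p N :: nat
  assumes p: "Factorial_Ring.prime p" and sqf: "squarefree N" and pN: "\<not> p dvd N"
    and no_edge: "\<And>t. Factorial_Ring.prime t \<Longrightarrow> t dvd p * N \<Longrightarrow> coprime (p * N) (t - 1)"
begin

lemma N_facts: "N > 0" "coprime N p" "coprime N (p - 1)"
proof -
  show "N > 0" using sqf by (metis gr0I not_squarefree_0)
  show "coprime N p" using prime_imp_coprime[OF p pN] coprime_commute by blast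
  have "coprime (p * N) (p - 1)" using no_edge[OF p] by simp
  then show "coprime N (p - 1)" by simp
qed

lemma not_sq_dvd: "\<not> p\<^sup>2 dvd p * N"
  using pN prime_gt_0_nat[OF p] by (simp add: power2_eq_square)

lemma structure_cases:
  assumes G: "group G" "finite (carrier G)" "order G = p\<^sup>2 * N"
  shows "\<exists>y. splits G (torsion G (p\<^sup>2)) y \<and> group.ord G y = N \<and>
    ((\<exists>x\<in>carrier G. group.ord G x = p\<^sup>2 \<and> torsion G (p\<^sup>2) = {x [^]\<^bsub>G\<^esub> (i::nat) | i. True} \<and>
        y \<otimes>\<^bsub>G\<^esub> x \<otimes>\<^bsub>G\<^esub> inv\<^bsub>G\<^esub> y = x [^]\<^bsub>G\<^esub> (1::nat)) \<and> commuting G \<and> \<not> exponent_dvd G (p * N)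
     \<or> prime_square_kernel G (torsion G (p\<^sup>2)) p \<and> exponent_dvd G (p * N))"
proof -
  interpret group G by fact
  obtain y where y: "splits G (torsion G (p\<^sup>2)) y" "local.ord y = N"
    "card (torsion G (p\<^sup>2)) = p\<^sup>2" "torsion G (p\<^sup>2) \<lhd> G"
    using prime_square_structure[OF G(2) p G(3) sqf pN no_edge] by blast
  from prime_square_kernel_cases[OF G(2) p y(3,4)] show ?thesis
  proof
    assume "\<exists>x\<in>carrier G. local.ord x = p\<^sup>2"
    then obtain x where x: "x \<in> carrier G" "local.ord x = p\<^sup>2" by blast
    then have "\<not> exponent_dvd G (p * N)" using not_exponent_dvd_if_ord not_sq_dvd by metis
    then show ?thesis
      using prime_square_cyclic_kernel[OF G(2) p y(1-3) N_facts(2,3) x] x y(1,2) by blast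
  next
    assume "prime_square_kernel G (torsion G (p\<^sup>2)) p"
    then show ?thesis
      using exponent_dvd_prime_square_kernel[OF G(2), of _ p N] y G(3) by (intro exI[of _ y]) simp
  qed
qed

lemma cyclic_type_iso:
  assumes G: "group G" "finite (carrier G)" "order G = p\<^sup>2 * N" "\<not> exponent_dvd G (p * N)"
    and H: "group H" "finite (carrier H)" "order H = p\<^sup>2 * N" "\<not> exponent_dvd H (p * N)"
  shows "G \<cong> H"
proof -
  obtain x y where G': "splits G (torsion G (p\<^sup>2)) y" "group.ord G y = N" "x \<in> carrier G" "group.ord G x = p\<^sup>2"
    "torsion G (p\<^sup>2) = {x [^]\<^bsub>G\<^esub> (i::nat) | i. True}" "y \<otimes>\<^bsub>G\<^esub> x \<otimes>\<^bsub>G\<^esub> inv\<^bsub>G\<^esub> y = x [^]\<^bsub>G\<^esub> (1::nat)"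
    using structure_cases[OF G(1-3)] G(4) by blast
  obtain u w where H': "splits H (torsion H (p\<^sup>2)) w" "group.ord H w = N" "u \<in> carrier H" "group.ord H u = p\<^sup>2"
    "torsion H (p\<^sup>2) = {u [^]\<^bsub>H\<^esub> (i::nat) | i. True}" "w \<otimes>\<^bsub>H\<^esub> u \<otimes>\<^bsub>H\<^esub> inv\<^bsub>H\<^esub> w = u [^]\<^bsub>H\<^esub> (1::nat)"
    using structure_cases[OF H(1-3)] H(4) by blast
  show ?thesis
    by (rule splits_iso_cyclic[OF G(1,2) G'(1) H(1,2) H'(1) _ G'(3,5) H'(3,5) _ G'(6) H'(6)])
      (simp_all only: G'(2,4) H'(2,4))
qed

lemma elementary_structure:
  assumes G: "group G" "finite (carrier G)" "order G = p\<^sup>2 * N" "exponent_dvd G (p * N)"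
  obtains y where "splits G (torsion G (p\<^sup>2)) y" "group.ord G y = N" "prime_square_kernel G (torsion G (p\<^sup>2)) p"
  using structure_cases[OF G(1-3)] G(4) by blast

lemma elementary_commuting_iso:
  assumes G: "group G" "finite (carrier G)" "order G = p\<^sup>2 * N" "exponent_dvd G (p * N)" "commuting G"
    and H: "group H" "finite (carrier H)" "order H = p\<^sup>2 * N" "exponent_dvd H (p * N)" "commuting H"
  shows "G \<cong> H"
proof -
  obtain y where y: "splits G (torsion G (p\<^sup>2)) y" "group.ord G y = N" "prime_square_kernel G (torsion G (p\<^sup>2)) p"
    using elementary_structure[OF G(1-4)] by blast
  obtain w where w: "splits H (torsion H (p\<^sup>2)) w" "group.ord H w = N" "prime_square_kernel H (torsion H (p\<^sup>2)) p"
    using elementary_structure[OF H(1-4)] by blast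
  interpret A: prime_square_kernel G "torsion G (p\<^sup>2)" p by fact
  interpret B: prime_square_kernel H "torsion H (p\<^sup>2)" p by fact
  obtain x z where x: "A.basis_pair x z" using A.basis_exists by blast
  obtain u v where u: "B.basis_pair u v" using B.basis_exists by blast
  have yG: "y \<in> carrier G" and wH: "w \<in> carrier H" using y(1) w(1) unfolding splits_def by auto
  have xz: "x \<in> carrier G" "z \<in> carrier G" "u \<in> carrier H" "v \<in> carrier H"
    using x u A.KG B.KG unfolding A.basis_pair_def B.basis_pair_def by auto
  have cG: "y \<otimes>\<^bsub>G\<^esub> k \<otimes>\<^bsub>G\<^esub> inv\<^bsub>G\<^esub> y = k" if "k \<in> carrier G" for k
    using G(5) yG that A.conj_eq_iff_commute unfolding commuting_def by blast
  have cH: "w \<otimes>\<^bsub>H\<^esub> k \<otimes>\<^bsub>H\<^esub> inv\<^bsub>H\<^esub> w = k" if "k \<in> carrier H" for k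
    using H(5) wH that B.conj_eq_iff_commute unfolding commuting_def by blast
  \<comment> \<open>The constants 1, 0, 0, 1 are the identity matrix of the trivial action.\<close>
  show ?thesis
    by (rule splits_iso_elementary[OF y(3) G(2) y(1) w(3) H(2) w(1) _ x u, of 1 0 0 1])
      (use cG cH xz y(2) w(2) in simp_all)
qed

lemma commuting_if_centralizes:
  assumes G: "group G" "finite (carrier G)"
    and y: "splits G (torsion G (p\<^sup>2)) y" "prime_square_kernel G (torsion G (p\<^sup>2)) p"
    and c: "prime_square_kernel.centralizes G (torsion G (p\<^sup>2)) y"
  shows "commuting G"
proof -
  interpret A: prime_square_kernel G "torsion G (p\<^sup>2)" p by fact
  have yG: "y \<in> carrier G" using y(1) unfolding splits_def by auto
  show ?thesis
    by (rule A.splits_commuting[OF G(2) y(1) A.comm])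
      (use c A.conj_eq_iff_commute[OF yG A.KG] A.centralizes_def in auto)
qed

lemma action_period:
  assumes G: "group G" "finite (carrier G)"
    and y: "splits G (torsion G (p\<^sup>2)) y" "group.ord G y = N" "prime_square_kernel G (torsion G (p\<^sup>2)) p"
    and "\<not> commuting G"
  shows "\<exists>d. d \<noteq> 1 \<and> squarefree d \<and> d dvd N \<and>
    (\<forall>i::nat. prime_square_kernel.centralizes G (torsion G (p\<^sup>2)) (y [^]\<^bsub>G\<^esub> i) \<longleftrightarrow> d dvd i) \<and>
    (\<forall>t. Factorial_Ring.prime t \<longrightarrow> t dvd d \<longrightarrow> t dvd p\<^sup>2 - 1)"
proof -
  interpret A: prime_square_kernel G "torsion G (p\<^sup>2)" p by fact
  have yG: "y \<in> carrier G" using y(1) unfolding splits_def by auto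
  have yN: "y [^]\<^bsub>G\<^esub> N = \<one>\<^bsub>G\<^esub>" using A.pow_ord_eq_1[OF yG] y(2) by simp
  obtain d where d: "d > 0" "d dvd N" "\<And>i::nat. A.centralizes (y [^]\<^bsub>G\<^esub> i) \<longleftrightarrow> d dvd i"
    "\<And>t. Factorial_Ring.prime t \<Longrightarrow> t dvd d \<Longrightarrow> t dvd p\<^sup>2 - 1"
    using A.centralizes_period[OF yG yN N_facts sqf] by blast
  have "d \<noteq> 1"
  proof
    assume "d = 1"
    then have "A.centralizes y" using d(3)[of 1] yG by simp
    then show False using commuting_if_centralizes[OF G y(1,3)] assms(6) by blast
  qed
  moreover have "squarefree d" using sqf d(2) squarefree_mono by blast
  ultimately show ?thesis using d by (intro exI[of _ d]) simp
qed

text \<open>A nontrivial action would have a period with a prime factor dividing both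
  \<open>N\<close> and \<open>p\<^sup>2 - 1\<close>.\<close>

lemma commuting_if_no_divisor:
  assumes none: "\<And>t. Factorial_Ring.prime t \<Longrightarrow> t dvd N \<Longrightarrow> \<not> t dvd p\<^sup>2 - 1"
    and G: "group G" "finite (carrier G)" "order G = p\<^sup>2 * N"
  shows "commuting G"
proof (rule ccontr)
  assume nc: "\<not> commuting G"
  then obtain y where y: "splits G (torsion G (p\<^sup>2)) y" "group.ord G y = N" "prime_square_kernel G (torsion G (p\<^sup>2)) p"
    using structure_cases[OF G] by blast
  obtain d where d: "d \<noteq> 1" "d dvd N" "\<forall>t. Factorial_Ring.prime t \<longrightarrow> t dvd d \<longrightarrow> t dvd p\<^sup>2 - 1"
    using action_period[OF G(1,2) y nc] by blast
  obtain t where "Factorial_Ring.prime t" "t dvd d" using prime_factor_nat[OF d(1)] by blast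
  then show False using none d(2,3) dvd_trans by blast
qed

text \<open>In either group the period of the action is squarefree, different from 1 and without a
  prime factor other than \<open>l\<close>, so it is \<open>l\<close>; actions of the same odd prime
  period are compared by their traces.\<close>

lemma noncommuting_iso:
  assumes l: "Factorial_Ring.prime l" "l dvd N"
    and uniq: "\<And>t. Factorial_Ring.prime t \<Longrightarrow> t dvd N \<Longrightarrow> t dvd p\<^sup>2 - 1 \<Longrightarrow> t = l"
    and G: "group G" "finite (carrier G)" "order G = p\<^sup>2 * N" "\<not> commuting G"
    and H: "group H" "finite (carrier H)" "order H = p\<^sup>2 * N" "\<not> commuting H"
  shows "G \<cong> H"
proof -
  obtain y where y: "splits G (torsion G (p\<^sup>2)) y" "group.ord G y = N" "prime_square_kernel G (torsion G (p\<^sup>2)) p"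
    using structure_cases[OF G(1-3)] G(4) by blast
  obtain w where w: "splits H (torsion H (p\<^sup>2)) w" "group.ord H w = N" "prime_square_kernel H (torsion H (p\<^sup>2)) p"
    using structure_cases[OF H(1-3)] H(4) by blast
  have dl: "d = l" if "d \<noteq> 1" "squarefree d" "d dvd N" "\<And>t. Factorial_Ring.prime t \<Longrightarrow> t dvd d \<Longrightarrow> t dvd p\<^sup>2 - 1" for d
  proof -
    have "d dvd l" by (rule dvd_prime_if_squarefree[OF that(2)]) (use uniq that(3,4) dvd_trans in blast)
    then show ?thesis using that(1) l(1) by (metis prime_nat_iff)
  qed
  have perG: "prime_square_kernel.centralizes G (torsion G (p\<^sup>2)) (y [^]\<^bsub>G\<^esub> i) \<longleftrightarrow> l dvd i" for i :: nat
    using action_period[OF G(1,2) y G(4)] dl by metis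
  have perH: "prime_square_kernel.centralizes H (torsion H (p\<^sup>2)) (w [^]\<^bsub>H\<^esub> i) \<longleftrightarrow> l dvd i" for i :: nat
    using action_period[OF H(1,2) w H(4)] dl by metis
  \<comment> \<open>If \<open>l\<close> were 2, \<open>p\<close> would be odd and 2 would have an
    edge into \<open>p\<close>. Oddness permits \<open>l = 2 h + 1\<close> in the trace
    polynomial.\<close>
  have "l \<noteq> 2"
  proof
    assume "l = 2"
    then have "p \<noteq> 2" using l pN by auto
    then have "odd p" using p primes_dvd_imp_eq two_is_prime_nat by blast
    then have "2 dvd p - 1" by simp
    then show False using N_facts(3) l(2) \<open>l = 2\<close> coprime_common_divisor_nat[of N "p - 1" 2] by simp
  qed
  then have "odd l" using l(1) primes_dvd_imp_eq two_is_prime_nat by blast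
  then obtain h where h: "l = Suc (2 * h)" by (metis oddE Suc_eq_plus1)
  show ?thesis
    by (rule noncentral_elementary_iso[OF y(3) G(2) y(1,2) w(3) H(2) w(1,2) N_facts sqf l h perG perH])
qed

end

subsection \<open>Semidirect products and isomorphism invariants\<close>

text \<open>The cyclic factor acts through iterates of the single map \<open>\<sigma>\<close>;
  reducing the second coordinate modulo \<open>N\<close> is compatible with this once the
  \<open>N\<close>-th iterate is the identity, which is the assumption \<open>period\<close>
  below.\<close>

definition semidirect :: "('a, 'b) monoid_scheme \<Rightarrow> ('a \<Rightarrow> 'a) \<Rightarrow> nat \<Rightarrow> ('a \<times> nat) monoid" where
  "semidirect K \<sigma> N = \<lparr>carrier = carrier K \<times> {..<N},
     monoid.mult = (\<lambda>(a, i) (b, j). (a \<otimes>\<^bsub>K\<^esub> (\<sigma> ^^ i) b, (i + j) mod N)), one = (\<one>\<^bsub>K\<^esub>, 0)\<rparr>"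

locale semidirect_data = comm_group K for K (structure) +
  fixes \<sigma> :: "'a \<Rightarrow> 'a" and N :: nat
  assumes fin: "finite (carrier K)" and N: "N > 0" and hom: "\<sigma> \<in> hom K K"
    and period: "\<And>a. a \<in> carrier K \<Longrightarrow> (\<sigma> ^^ N) a = a"
begin

abbreviation S where "S \<equiv> semidirect K \<sigma> N"

lemma iter_closed: "a \<in> carrier K \<Longrightarrow> (\<sigma> ^^ i) a \<in> carrier K"
  using hom by (induction i) (auto simp: hom_def)

lemma iter_mult: "a \<in> carrier K \<Longrightarrow> b \<in> carrier K \<Longrightarrow> (\<sigma> ^^ i) (a \<otimes> b) = (\<sigma> ^^ i) a \<otimes> (\<sigma> ^^ i) b"
  using iter_closed hom by (induction i) (auto simp: hom_def)

lemma iter_mod: "a \<in> carrier K \<Longrightarrow> (\<sigma> ^^ (i mod N)) a = (\<sigma> ^^ i) a"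
  using funpow_mod_eq period by metis

lemma iter_one: "(\<sigma> ^^ i) \<one> = \<one>"
proof -
  have "\<sigma> \<one> = \<one>" using hom_one[OF hom is_group is_group] .
  then show ?thesis by (induction i) auto
qed

lemma carrier_S: "carrier S = carrier K \<times> {..<N}"
  and mult_S: "(a, i) \<otimes>\<^bsub>S\<^esub> (b, j) = (a \<otimes> (\<sigma> ^^ i) b, (i + j) mod N)"
  and one_S: "\<one>\<^bsub>S\<^esub> = (\<one>, 0)"
  by (simp_all add: semidirect_def)

lemma group_S: "group S"
proof (rule groupI)
  show "\<one>\<^bsub>S\<^esub> \<in> carrier S" using N by (simp add: carrier_S one_S)
  show "g \<otimes>\<^bsub>S\<^esub> h \<in> carrier S" if "g \<in> carrier S" "h \<in> carrier S" for g h
    using that N by (cases g; cases h) (auto simp: carrier_S mult_S iter_closed)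
  show "(g \<otimes>\<^bsub>S\<^esub> h) \<otimes>\<^bsub>S\<^esub> k = g \<otimes>\<^bsub>S\<^esub> (h \<otimes>\<^bsub>S\<^esub> k)"
    if "g \<in> carrier S" "h \<in> carrier S" "k \<in> carrier S" for g h k
  proof -
    obtain a i b j c m where e: "g = (a, i)" "h = (b, j)" "k = (c, m)" by (cases g; cases h; cases k)
    have c: "a \<in> carrier K" "b \<in> carrier K" "c \<in> carrier K" using that by (auto simp: e carrier_S)
    have "(\<sigma> ^^ ((i + j) mod N)) c = (\<sigma> ^^ i) ((\<sigma> ^^ j) c)"
      using iter_mod[OF c(3)] by (simp add: funpow_add)
    then show ?thesis
      using c by (simp add: e mult_S iter_closed iter_mult m_assoc mod_simps add.assoc)
  qed
  show "\<one>\<^bsub>S\<^esub> \<otimes>\<^bsub>S\<^esub> g = g" if "g \<in> carrier S" for g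
    using that by (cases g) (auto simp: carrier_S mult_S one_S)
  show "\<exists>h\<in>carrier S. h \<otimes>\<^bsub>S\<^esub> g = \<one>\<^bsub>S\<^esub>" if "g \<in> carrier S" for g
  proof -
    obtain a i where e: "g = (a, i)" by (cases g)
    have c: "a \<in> carrier K" "i < N" using that by (auto simp: e carrier_S)
    let ?j = "(N - i) mod N"
    have "(inv ((\<sigma> ^^ ?j) a), ?j) \<in> carrier S" using c N by (simp add: carrier_S iter_closed)
    moreover have "(inv ((\<sigma> ^^ ?j) a), ?j) \<otimes>\<^bsub>S\<^esub> g = \<one>\<^bsub>S\<^esub>"
      using c by (simp add: e mult_S one_S iter_closed mod_simps)
    ultimately show ?thesis by blast
  qed
qed

sublocale S: group S by (rule group_S)

lemma finite_S: "finite (carrier S)" using fin by (simp add: carrier_S)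

lemma order_S: "order S = order K * N" by (simp add: order_def carrier_S card_cartesian_product)

lemma pow_S: "\<exists>b\<in>carrier K. (a, i) [^]\<^bsub>S\<^esub> (m::nat) = (b, (m * i) mod N)" if "(a, i) \<in> carrier S"
proof (induction m)
  case 0
  show ?case by (simp add: one_S)
next
  case (Suc m)
  then obtain b where "b \<in> carrier K" "(a, i) [^]\<^bsub>S\<^esub> m = (b, (m * i) mod N)" by blast
  then show ?case using that by (auto simp: mult_S carrier_S iter_closed mod_simps add.commute)
qed

lemma pow_S_fixed:
  assumes "(a, i) \<in> carrier S" "(\<sigma> ^^ i) a = a"
  shows "(a, i) [^]\<^bsub>S\<^esub> (m::nat) = (a [^] m, (m * i) mod N)"
proof (induction m)
  case 0
  show ?case by (simp add: one_S)
next
  case (Suc m)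
  have aK: "a \<in> carrier K" using assms(1) by (simp add: carrier_S)
  have "(\<sigma> ^^ (m * i)) a = a" using assms(2) by (induction m) (simp_all add: funpow_add)
  then show ?case using aK Suc by (simp add: mult_S iter_mod mod_simps add.commute)
qed

lemma commuting_S: "commuting S \<longleftrightarrow> (\<forall>a\<in>carrier K. \<sigma> a = a)"
proof
  assume c: "commuting S"
  show "\<forall>a\<in>carrier K. \<sigma> a = a"
  proof
    fix a assume a: "a \<in> carrier K"
    show "\<sigma> a = a"
    proof (cases "N = 1")
      case True
      then show ?thesis using period[OF a] by simp
    next
      case False
      then have "(\<one>, 1) \<otimes>\<^bsub>S\<^esub> (a, 0) = (a, 0) \<otimes>\<^bsub>S\<^esub> (\<one>, 1)"
        using c a N unfolding commuting_def carrier_S by simp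
      then show ?thesis using a iter_closed[OF a, of 1] by (simp add: mult_S)
    qed
  qed
next
  assume fix_all: "\<forall>a\<in>carrier K. \<sigma> a = a"
  have "(\<sigma> ^^ i) a = a" if "a \<in> carrier K" for a i using that fix_all by (induction i) auto
  then show "commuting S"
    unfolding commuting_def carrier_S by (auto simp: mult_S m_comm add.commute)
qed

text \<open>Since \<open>t\<close> is prime to \<open>N\<close>, an element annihilated by
  \<open>t\<close> has second coordinate 0 and lies in the abelian \<open>K\<close>; there it is
  central exactly if \<open>\<sigma>\<close> fixes it.\<close>

lemma central_torsion_S_kernel:
  assumes "coprime t N"
  shows "central_torsion S t \<longleftrightarrow> (\<forall>a\<in>torsion K t. \<sigma> a = a)"
proof
  assume c: "central_torsion S t"
  show "\<forall>a\<in>torsion K t. \<sigma> a = a"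
  proof
    fix a assume a: "a \<in> torsion K t"
    then have aK: "a \<in> carrier K" unfolding torsion_def by simp
    show "\<sigma> a = a"
    proof (cases "N = 1")
      case True
      then show ?thesis using period[OF aK] by simp
    next
      case False
      have "(a, 0) [^]\<^bsub>S\<^esub> t = (a [^] t, (t * 0) mod N)" by (rule pow_S_fixed) (use aK N in \<open>simp_all add: carrier_S\<close>)
      then have "(a, 0) \<in> torsion S t" using a N unfolding torsion_def by (simp add: carrier_S one_S)
      then have "(a, 0) \<otimes>\<^bsub>S\<^esub> (\<one>, 1) = (\<one>, 1) \<otimes>\<^bsub>S\<^esub> (a, 0)"
        using c N False unfolding central_torsion_def carrier_S by auto
      then show ?thesis using aK iter_closed[OF aK, of 1] by (simp add: mult_S)
    qed
  qed
next
  assume fix_all: "\<forall>a\<in>torsion K t. \<sigma> a = a"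
  show "central_torsion S t"
    unfolding central_torsion_def
  proof (intro ballI)
    fix g h assume g: "g \<in> torsion S t" and h: "h \<in> carrier S"
    obtain a i b j where e: "g = (a, i)" "h = (b, j)" by (cases g; cases h)
    have gS: "(a, i) \<in> carrier S" and gt: "(a, i) [^]\<^bsub>S\<^esub> t = (\<one>, 0)"
      using g unfolding e torsion_def one_S by auto
    have "(t * i) mod N = 0" using pow_S[OF gS, of t] gt by auto
    then have "N dvd i" using assms by (metis coprime_commute coprime_dvd_mult_right_iff mod_0_imp_dvd)
    then have i: "i = 0" using gS by (auto simp: carrier_S dest: dvd_imp_le)
    have aK: "a \<in> carrier K" using gS by (simp add: carrier_S)
    have "a [^] t = \<one>" using pow_S_fixed[OF gS, of t] gt i by simp
    then have "\<sigma> a = a" using fix_all aK unfolding torsion_def by blast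
    then have "(\<sigma> ^^ m) a = a" for m by (induction m) auto
    then show "g \<otimes>\<^bsub>S\<^esub> h = h \<otimes>\<^bsub>S\<^esub> g"
      using h aK by (simp add: e i mult_S carrier_S m_comm)
  qed
qed

text \<open>An element annihilated by \<open>t\<close> has a multiple of \<open>N div t\<close> as
  second coordinate. If the iterate of \<open>\<sigma>\<close> of order \<open>N div t\<close> is
  trivial, its first coordinate is annihilated by both \<open>t\<close> and \<open>order K\<close>,
  hence trivial.\<close>

lemma central_torsion_S_complement:
  assumes "t dvd N" and "coprime t (order K)" and t0: "t > 0"
  shows "central_torsion S t \<longleftrightarrow> (\<forall>a\<in>carrier K. (\<sigma> ^^ (N div t)) a = a)"
proof
  assume c: "central_torsion S t"
  show "\<forall>a\<in>carrier K. (\<sigma> ^^ (N div t)) a = a"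
  proof
    fix a assume a: "a \<in> carrier K"
    show "(\<sigma> ^^ (N div t)) a = a"
    proof (cases "N div t < N")
      \<comment> \<open>This happens only for \<open>t = 1\<close>.\<close>
      case False
      then have "N div t = N" using div_le_dividend[of N t] by linarith
      then show ?thesis using period[OF a] by simp
    next
      case True
      have "(\<one>, N div t) [^]\<^bsub>S\<^esub> t = (\<one> [^] t, (t * (N div t)) mod N)"
        by (rule pow_S_fixed) (use True in \<open>simp_all add: carrier_S iter_one\<close>)
      then have "(\<one>, N div t) \<in> torsion S t"
        using True assms(1) unfolding torsion_def by (simp add: carrier_S one_S)
      then have "(\<one>, N div t) \<otimes>\<^bsub>S\<^esub> (a, 0) = (a, 0) \<otimes>\<^bsub>S\<^esub> (\<one>, N div t)"
        using c a N unfolding central_torsion_def carrier_S by auto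
      then show ?thesis using a by (simp add: mult_S iter_closed)
    qed
  qed
next
  assume fix_all: "\<forall>a\<in>carrier K. (\<sigma> ^^ (N div t)) a = a"
  show "central_torsion S t"
    unfolding central_torsion_def
  proof (intro ballI)
    fix g h assume g: "g \<in> torsion S t" and h: "h \<in> carrier S"
    obtain a i b j where e: "g = (a, i)" "h = (b, j)" by (cases g; cases h)
    have gS: "(a, i) \<in> carrier S" and gt: "(a, i) [^]\<^bsub>S\<^esub> t = (\<one>, 0)"
      using g unfolding e torsion_def one_S by auto
    have bK: "b \<in> carrier K" and aK: "a \<in> carrier K" using h gS by (auto simp: e carrier_S)
    have "N dvd t * i" using pow_S[OF gS, of t] gt by auto
    then have "t * (N div t) dvd t * i" using assms(1) by simp
    then obtain m where m: "i = (N div t) * m" using t0 by auto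
    have fixi: "(\<sigma> ^^ i) c = c" if "c \<in> carrier K" for c
      unfolding m using fix_all that by (induction m) (simp_all add: funpow_add)
    have "a [^] t = \<one>" using pow_S_fixed[OF gS fixi[OF aK], of t] gt by simp
    moreover have "a [^] order K = \<one>" using pow_order_eq_1[OF aK] .
    ultimately have "a = \<one>" using coprime_pows_eq_1[OF aK _ _ assms(2)] by blast
    then show "g \<otimes>\<^bsub>S\<^esub> h = h \<otimes>\<^bsub>S\<^esub> g"
      using h bK by (simp add: e mult_S fixi iter_one add.commute)
  qed
qed

lemma not_exponent_dvd_S:
  assumes "\<not> N dvd d \<or> (\<exists>a\<in>carrier K. a [^] d \<noteq> \<one>)"
  shows "\<not> exponent_dvd S d"
proof
  assume "exponent_dvd S d"
  then have all: "g [^]\<^bsub>S\<^esub> d = (\<one>, 0)" if "g \<in> carrier S" for g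
    using that unfolding exponent_dvd_def torsion_def one_S by blast
  from assms show False
  proof
    assume nd: "\<not> N dvd d"
    then have "N \<noteq> 1" by auto
    then have in_S: "(\<one>, 1) \<in> carrier S" using N by (simp add: carrier_S)
    have "(d * 1) mod N = 0" using pow_S[OF in_S, of d] all[OF in_S] by auto
    then show False using nd by (simp add: mod_eq_0_iff_dvd)
  next
    assume "\<exists>a\<in>carrier K. a [^] d \<noteq> \<one>"
    then obtain a where a: "a \<in> carrier K" "a [^] d \<noteq> \<one>" by blast
    have in_S: "(a, 0) \<in> carrier S" using a N by (simp add: carrier_S)
    then show False using pow_S_fixed[OF in_S, of d] all[OF in_S] a by simp
  qed
qed

end

section \<open>Direct products, cyclic and metacyclic groups\<close>

lemma (in group) exponent_dvd_order:
  assumes "order G dvd d"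
  shows "exponent_dvd G d"
  using assms ord_dvd_group_order dvd_trans pow_eq_id unfolding exponent_dvd_def torsion_def by blast

lemma exponent_dvd_DirProd:
  assumes "group G" "group H"
  shows "exponent_dvd (G \<times>\<times> H) d \<longleftrightarrow> exponent_dvd G d \<and> exponent_dvd H d"
proof -
  interpret G: group G by fact
  interpret H: group H by fact
  have pow: "(a, b) [^]\<^bsub>G \<times>\<times> H\<^esub> m = (a [^]\<^bsub>G\<^esub> m, b [^]\<^bsub>H\<^esub> m)" for a b and m :: nat
    by (induction m) simp_all
  show ?thesis
    unfolding exponent_dvd_def torsion_def
    by (auto simp: pow set_eq_iff)
qed

lemma commuting_DirProd:
  assumes "group G" "group H"
  shows "commuting (G \<times>\<times> H) \<longleftrightarrow> commuting G \<and> commuting H"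
proof -
  interpret G: group G by fact
  interpret H: group H by fact
  show ?thesis
    unfolding commuting_def by (auto) (use G.one_closed H.one_closed in blast)+
qed

lemma order_DirProd: "order (G \<times>\<times> H) = order G * order H"
  by (simp add: order_def card_cartesian_product)

lemma order_Zn: "order (integer_mod_group m) = m" if "m > 0"
  using that by (simp add: order_def carrier_integer_mod_group)

lemma finite_Zn: "finite (carrier (integer_mod_group m))" if "m > 0"
  using that by (simp add: carrier_integer_mod_group)

lemma commuting_Zn: "commuting (integer_mod_group m)"
  by (simp add: commuting_def add.commute)

lemma exponent_dvd_Zn:
  assumes "m > 0"
  shows "exponent_dvd (integer_mod_group m) d \<longleftrightarrow> m dvd d"
proof
  assume "exponent_dvd (integer_mod_group m) d"
  then have all: "(int d * v) mod int m = 0" if "v \<in> carrier (integer_mod_group m)" for v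
    using that unfolding exponent_dvd_def torsion_def by auto
  show "m dvd d"
  proof (cases "m = 1")
    case False
    then have "int d mod int m = 0" using all[of 1] assms by simp
    then show ?thesis by (metis int_dvd_int_iff mod_0_imp_dvd)
  qed simp
next
  assume "m dvd d"
  then show "exponent_dvd (integer_mod_group m) d"
    by (intro group.exponent_dvd_order) (simp_all add: order_Zn assms)
qed

text \<open>The group with generators \<open>x\<close> of order \<open>a\<close> and
  \<open>y\<close> of order \<open>N\<close> and the relation \<open>y x y^-1 = x^k\<close>; it is a
  group under \<open>k^N = 1\<close> modulo \<open>a\<close>, the assumption of
  \<open>metacyclic_data\<close>.\<close>

definition metacyclic :: "nat \<Rightarrow> nat \<Rightarrow> nat \<Rightarrow> (int \<times> nat) monoid" where
  "metacyclic a N k = semidirect (integer_mod_group a) (\<lambda>v. (int k * v) mod int a) N"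

locale metacyclic_data =
  fixes a N k :: nat
  assumes a: "a > 0" and N: "N > 0" and k: "[k ^ N = 1] (mod a)"
begin

lemma iter: "0 \<le> v \<Longrightarrow> v < int a \<Longrightarrow> ((\<lambda>v. (int k * v) mod int a) ^^ i) v = (int k ^ i * v) mod int a"
  by (induction i) (simp_all add: mod_simps mult.assoc)

sublocale semidirect_data "integer_mod_group a" "\<lambda>v. (int k * v) mod int a" N
proof (intro semidirect_data.intro semidirect_data_axioms.intro abelian_integer_mod_group)
  show "finite (carrier (integer_mod_group a))" using a by (rule finite_Zn)
  show "N > 0" by (rule N)
  show "(\<lambda>v. (int k * v) mod int a) \<in> hom (integer_mod_group a) (integer_mod_group a)"
    using a by (auto simp: hom_def carrier_integer_mod_group mod_simps distrib_left)
  fix v assume v: "v \<in> carrier (integer_mod_group a)"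
  then have v': "0 \<le> v" "v < int a" using a by (auto simp: carrier_integer_mod_group)
  have "[int k ^ N * v = 1 * v] (mod int a)"
    using k cong_int_iff[of "k ^ N" 1 a] by (intro cong_mult) auto
  then show "((\<lambda>v. (int k * v) mod int a) ^^ N) v = v"
    using iter[OF v', of N] v' by (simp add: cong_def)
qed

lemma group_M: "group (metacyclic a N k)"
  unfolding metacyclic_def by (rule group_S)

lemma finite_M: "finite (carrier (metacyclic a N k))"
  unfolding metacyclic_def by (rule finite_S)

lemma order_M: "order (metacyclic a N k) = a * N"
  unfolding metacyclic_def using order_S a by (simp add: order_Zn)

lemma mult_fixes_iff:
  assumes "0 \<le> v" "v < int a"
  shows "(int m * v) mod int a = v \<longleftrightarrow> int a dvd (int m - 1) * v"
proof -
  have "(int m * v) mod int a = v \<longleftrightarrow> (int m * v) mod int a = v mod int a" using assms by simp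
  then show ?thesis by (simp add: mod_eq_dvd_iff algebra_simps)
qed

lemma mult_fixes_all_iff: "(\<forall>v\<in>carrier (integer_mod_group a). (int m * v) mod int a = v) \<longleftrightarrow> [m = 1] (mod a)"
proof
  assume all: "\<forall>v\<in>carrier (integer_mod_group a). (int m * v) mod int a = v"
  show "[m = 1] (mod a)"
  proof (cases "a = 1")
    case False
    then have "(int m * 1) mod int a = 1"
      using bspec[OF all, of 1] a by (auto simp: carrier_integer_mod_group)
    then have "int a dvd int m - 1" using mult_fixes_iff[of 1 m] False a by simp
    then show ?thesis by (metis cong_iff_dvd_diff cong_int_iff of_nat_1)
  qed simp
next
  assume "[m = 1] (mod a)"
  then have "int a dvd int m - 1" by (metis cong_iff_dvd_diff cong_int_iff of_nat_1)
  then show "\<forall>v\<in>carrier (integer_mod_group a). (int m * v) mod int a = v"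
    using mult_fixes_iff a by (auto simp: carrier_integer_mod_group)
qed

lemma commuting_M: "commuting (metacyclic a N k) \<longleftrightarrow> [k = 1] (mod a)"
  unfolding metacyclic_def commuting_S mult_fixes_all_iff ..

lemma central_M_complement:
  assumes "t dvd N" "coprime t a" "t > 0"
  shows "central_torsion (metacyclic a N k) t \<longleftrightarrow> [k ^ (N div t) = 1] (mod a)"
proof -
  have "central_torsion (metacyclic a N k) t \<longleftrightarrow>
    (\<forall>v\<in>carrier (integer_mod_group a). (int (k ^ (N div t)) * v) mod int a = v)"
    unfolding metacyclic_def
    by (subst central_torsion_S_complement)
      (use assms a in \<open>auto simp: order_Zn iter carrier_integer_mod_group\<close>)
  then show ?thesis by (simp only: mult_fixes_all_iff)
qed

text \<open>The residues annihilated by \<open>t\<close> are the multiples of \<open>a / t\<close>,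
  on which multiplication by \<open>k\<close> depends only on \<open>k\<close> modulo
  \<open>t\<close>.\<close>

lemma central_M_kernel:
  assumes "t dvd a" "coprime t N"
  shows "central_torsion (metacyclic a N k) t \<longleftrightarrow> [k = 1] (mod t)"
proof -
  obtain b where b: "a = t * b" using assms(1) by blast
  have pos: "t > 0" "b > 0" using a b by auto
  have tors: "v \<in> torsion (integer_mod_group a) t \<longleftrightarrow> 0 \<le> v \<and> v < int a \<and> int b dvd v" for v
    using a pos unfolding torsion_def by (auto simp: carrier_integer_mod_group b mod_eq_0_iff_dvd)
  have "central_torsion (metacyclic a N k) t \<longleftrightarrow> (\<forall>v\<in>torsion (integer_mod_group a) t. (int k * v) mod int a = v)"
    unfolding metacyclic_def by (rule central_torsion_S_kernel[OF assms(2)])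
  also have "\<dots> \<longleftrightarrow> (\<forall>v. 0 \<le> v \<and> v < int a \<and> int b dvd v \<longrightarrow> int a dvd (int k - 1) * v)"
    using tors mult_fixes_iff by blast
  also have "\<dots> \<longleftrightarrow> int t dvd int k - 1"
  proof
    assume all: "\<forall>v. 0 \<le> v \<and> v < int a \<and> int b dvd v \<longrightarrow> int a dvd (int k - 1) * v"
    show "int t dvd int k - 1"
    proof (cases "t = 1")
      case False
      then have "int b < int a" using b pos by simp
      then have "int a dvd (int k - 1) * int b" using all pos by simp
      then show ?thesis using pos by (simp add: b)
    qed simp
  next
    assume "int t dvd int k - 1"
    then show "\<forall>v. 0 \<le> v \<and> v < int a \<and> int b dvd v \<longrightarrow> int a dvd (int k - 1) * v"
      by (auto simp: b intro: mult_dvd_mono)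
  qed
  also have "\<dots> \<longleftrightarrow> [k = 1] (mod t)" by (metis cong_iff_dvd_diff cong_int_iff of_nat_1)
  finally show ?thesis .
qed

lemma not_exponent_dvd_M:
  assumes "\<not> N dvd d \<or> \<not> a dvd d"
  shows "\<not> exponent_dvd (metacyclic a N k) d"
proof -
  have "\<exists>v\<in>carrier (integer_mod_group a). v [^]\<^bsub>integer_mod_group a\<^esub> d \<noteq> \<one>\<^bsub>integer_mod_group a\<^esub>" if "\<not> a dvd d"
    using exponent_dvd_Zn[OF a, of d] that unfolding exponent_dvd_def torsion_def by blast
  then show ?thesis unfolding metacyclic_def using not_exponent_dvd_S assms by blast
qed

end

section \<open>Isomorphism invariants and the counting of classes\<close>

lemma torsion_iso_image:
  assumes "group G" "group H" "h \<in> iso G H" "x \<in> carrier G"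
  shows "h x \<in> torsion H d \<longleftrightarrow> x \<in> torsion G d"
proof -
  interpret G: group G by fact
  interpret H: group H by fact
  have hom: "h \<in> hom G H" and bij: "bij_betw h (carrier G) (carrier H)" using assms(3) by (auto simp: iso_def)
  interpret gh: group_hom G H h using hom by unfold_locales
  have "h (x [^]\<^bsub>G\<^esub> d) = h \<one>\<^bsub>G\<^esub> \<longleftrightarrow> x [^]\<^bsub>G\<^esub> d = \<one>\<^bsub>G\<^esub>"
    using bij assms(4) by (intro inj_on_eq_iff[of h "carrier G"]) (auto simp: bij_betw_def)
  then show ?thesis using assms(4) gh.hom_nat_pow[OF assms(4), of d] unfolding torsion_def by simp
qed

lemma iso_invariants:
  assumes "group G" "group H" "G \<cong> H"
  shows "commuting G = commuting H" "exponent_dvd G d = exponent_dvd H d"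
    "central_torsion G t = central_torsion H t"
proof -
  obtain h where h: "h \<in> iso G H" using assms(3) unfolding is_iso_def by blast
  have hom: "h \<in> hom G H" and bij: "bij_betw h (carrier G) (carrier H)" using h by (auto simp: iso_def)
  interpret G: group G by fact
  interpret H: group H by fact
  have surj: "h ` carrier G = carrier H" using bij by (simp add: bij_betw_def)
  have comm_iff: "h x \<otimes>\<^bsub>H\<^esub> h y = h y \<otimes>\<^bsub>H\<^esub> h x \<longleftrightarrow> x \<otimes>\<^bsub>G\<^esub> y = y \<otimes>\<^bsub>G\<^esub> x"
    if "x \<in> carrier G" "y \<in> carrier G" for x y
    using that hom_mult[OF hom] bij by (metis G.m_closed bij_betw_inv_into_left)
  show "commuting G = commuting H"
    unfolding commuting_def surj[symmetric] using comm_iff by auto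
  show "exponent_dvd G d = exponent_dvd H d"
  proof -
    have "exponent_dvd G d \<longleftrightarrow> (\<forall>x\<in>carrier G. x \<in> torsion G d)" unfolding exponent_dvd_def torsion_def by blast
    also have "\<dots> \<longleftrightarrow> (\<forall>x\<in>carrier H. x \<in> torsion H d)"
      unfolding surj[symmetric] using torsion_iso_image[OF assms(1,2) h] by auto
    also have "\<dots> \<longleftrightarrow> exponent_dvd H d" unfolding exponent_dvd_def torsion_def by blast
    finally show ?thesis .
  qed
  have sub: "torsion K t \<subseteq> carrier K" for K :: "('c, 'd) monoid_scheme" unfolding torsion_def by blast
  show "central_torsion G t = central_torsion H t"
  proof -
    have "central_torsion H t \<longleftrightarrow> (\<forall>x\<in>carrier H. x \<in> torsion H t \<longrightarrow> (\<forall>y\<in>carrier H. x \<otimes>\<^bsub>H\<^esub> y = y \<otimes>\<^bsub>H\<^esub> x))"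
      unfolding central_torsion_def torsion_def by blast
    also have "\<dots> \<longleftrightarrow> (\<forall>x\<in>carrier G. x \<in> torsion G t \<longrightarrow> (\<forall>y\<in>carrier G. x \<otimes>\<^bsub>G\<^esub> y = y \<otimes>\<^bsub>G\<^esub> x))"
      unfolding surj[symmetric] using torsion_iso_image[OF assms(1,2) h] comm_iff by auto
    also have "\<dots> \<longleftrightarrow> central_torsion G t" unfolding central_torsion_def torsion_def by blast
    finally show ?thesis by simp
  qed
qed

text \<open>The isomorphism classes are exactly the fibres of \<open>f\<close>, so classes and
  values are in bijection; the equality of cardinalities follows whether or not the sets are
  finite.\<close>

lemma num_groups_eq_card_invariants:
  assumes "\<And>G H. G \<in> groups_of_order n \<Longrightarrow> H \<in> groups_of_order n \<Longrightarrow> f G = f H \<longleftrightarrow> G \<cong> H"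
  shows "num_groups n = card (f ` groups_of_order n)"
proof -
  let ?A = "groups_of_order n" and ?R = "group_iso_rel n"
  have eq: "equiv ?A ?R" by (rule equiv_group_iso_rel)
  have cls: "?R `` {G} = {H \<in> ?A. f H = f G}" if G: "G \<in> ?A" for G
  proof -
    have "G \<cong> H \<longleftrightarrow> f H = f G" if "H \<in> ?A" for H using assms[OF G that] by auto
    then show ?thesis using G unfolding group_iso_rel_def by auto
  qed
  have "bij_betw (\<lambda>v. {H \<in> ?A. f H = v}) (f ` ?A) (?A // ?R)"
    unfolding bij_betw_def
  proof
    show "inj_on (\<lambda>v. {H \<in> ?A. f H = v}) (f ` ?A)" by (rule inj_onI) blast
    show "(\<lambda>v. {H \<in> ?A. f H = v}) ` f ` ?A = ?A // ?R"
      unfolding quotient_def using cls by (auto simp: image_image)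
  qed
  then show ?thesis unfolding num_groups_def using bij_betw_same_card by fastforce
qed

text \<open>Positivity of \<open>num_groups n\<close> says that the set of classes is finite, for
  \<open>card\<close> is 0 on infinite sets; choosing representatives then maps the classes onto the
  values of \<open>f\<close>.\<close>

lemma card_invariants_le_num_groups:
  assumes "\<And>G H. G \<in> groups_of_order n \<Longrightarrow> H \<in> groups_of_order n \<Longrightarrow> G \<cong> H \<Longrightarrow> f G = f H"
    and S: "S \<subseteq> f ` groups_of_order n" and "num_groups n > 0"
  shows "card S \<le> num_groups n"
proof -
  let ?A = "groups_of_order n" and ?R = "group_iso_rel n"
  have fin: "finite (?A // ?R)" using assms(3) unfolding num_groups_def by (simp add: card_gt_0_iff)
  define g where "g C = f (SOME G. G \<in> C)" for C
  have "f G \<in> g ` (?A // ?R)" if G: "G \<in> ?A" for G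
  proof -
    let ?C = "?R `` {G}"
    have "G \<in> ?C" using G equiv_group_iso_rel by (rule equiv_class_self[rotated])
    then have "(SOME H. H \<in> ?C) \<in> ?C" by (rule someI)
    then have "(SOME H. H \<in> ?C) \<in> ?A" "G \<cong> (SOME H. H \<in> ?C)" by (auto simp: group_iso_rel_def)
    then have "g ?C = f G" unfolding g_def using assms(1)[OF G] by simp
    moreover have "?C \<in> ?A // ?R" using G by (rule quotientI)
    ultimately show ?thesis by (metis imageI)
  qed
  then have "S \<subseteq> g ` (?A // ?R)" using S by blast
  then have "card S \<le> card (g ` (?A // ?R))" using fin by (intro card_mono) auto
  also have "\<dots> \<le> num_groups n" unfolding num_groups_def by (rule card_image_le[OF fin])
  finally show ?thesis .
qed

subsection \<open>Orders with at least four groups\<close>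

text \<open>\<open>\<phi>\<close> turns the three invariants into a code number, chosen anew for
  each kind of order; invariance under isomorphism is settled once for every
  \<open>\<phi>\<close>.\<close>

definition invariant :: "(bool \<Rightarrow> (nat \<Rightarrow> bool) \<Rightarrow> (nat \<Rightarrow> bool) \<Rightarrow> nat) \<Rightarrow> ('a, 'b) monoid_scheme \<Rightarrow> nat" where
  "invariant \<phi> G = \<phi> (commuting G) (exponent_dvd G) (central_torsion G)"

lemma invariant_iso:
  assumes "group G" "group H" "G \<cong> H"
  shows "invariant \<phi> G = invariant \<phi> H"
proof -
  have "exponent_dvd G = exponent_dvd H" "central_torsion G = central_torsion H"
    using iso_invariants[OF assms] by auto
  then show ?thesis unfolding invariant_def using iso_invariants(1)[OF assms] by simp
qed

text \<open>Example groups live on various types; \<open>finite_group_copy\<close> moves them to the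
  type on which classes are counted.\<close>

lemma invariant_value:
  assumes "group H" "finite (carrier H)" "order H = n" "invariant \<phi> H = v"
  shows "v \<in> invariant \<phi> ` groups_of_order n"
proof -
  obtain G where G: "G \<in> groups_of_order n" "H \<cong> G" using finite_group_copy[OF assms(1,2)] assms(3) by blast
  then have "invariant \<phi> H = invariant \<phi> G"
    using invariant_iso[OF assms(1) _ G(2)] by (simp add: groups_of_order_def)
  then show ?thesis using G assms(4) by auto
qed

lemma num_groups_ge_invariant_values:
  assumes "S \<subseteq> invariant \<phi> ` groups_of_order n" "num_groups n > 0"
  shows "card S \<le> num_groups n"
  by (rule card_invariants_le_num_groups[OF _ assms]) (simp add: groups_of_order_def invariant_iso)

text \<open>Four attained codes leave only a number of classes that is at least 4 or, for an
  infinite set of classes, 0.\<close>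

lemma num_groups_not_2_3:
  assumes "0 \<in> invariant \<phi> ` groups_of_order n" "1 \<in> invariant \<phi> ` groups_of_order n"
    "2 \<in> invariant \<phi> ` groups_of_order n" "3 \<in> invariant \<phi> ` groups_of_order n"
  shows "num_groups n \<noteq> 2 \<and> num_groups n \<noteq> 3"
proof -
  have "{0, 1, 2, 3} \<subseteq> invariant \<phi> ` groups_of_order n" using assms by blast
  then have "num_groups n > 0 \<Longrightarrow> card {0, 1, 2, 3::nat} \<le> num_groups n"
    by (rule num_groups_ge_invariant_values)
  then show ?thesis by auto
qed

lemma num_groups_eq_invariant_values:
  assumes "\<And>G H. group G \<Longrightarrow> finite (carrier G) \<Longrightarrow> order G = n \<Longrightarrow> group H \<Longrightarrow> finite (carrier H) \<Longrightarrow> order H = n \<Longrightarrow>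
      invariant \<phi> G = invariant \<phi> H \<Longrightarrow> (G :: nat monoid) \<cong> (H :: nat monoid)"
  shows "num_groups n = card (invariant \<phi> ` groups_of_order n)"
  by (rule num_groups_eq_card_invariants) (auto simp: groups_of_order_def intro: assms invariant_iso)

lemma Zn_value:
  assumes "n > 0"
  shows "invariant \<phi> (integer_mod_group n) \<in> invariant \<phi> ` groups_of_order n"
  by (rule invariant_value[OF _ _ _ refl]) (use assms in \<open>simp_all add: finite_Zn order_Zn\<close>)

text \<open>The power of a primitive root modulo \<open>p\<close> with exponent
  \<open>(p - 1) / q\<close>.\<close>

lemma exists_prime_order_residue:
  assumes q: "Factorial_Ring.prime q" and p: "Factorial_Ring.prime p" and qp: "q dvd p - 1"
  obtains k :: nat where "[k ^ q = 1] (mod p)" "[k \<noteq> 1] (mod p)"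
proof -
  have p1: "p > 1" using p by (rule prime_gt_1_nat)
  obtain g where g: "residue_primroot p g" using prime_primitive_root_exists[OF p1 p] by blast
  have ordg: "Pocklington.ord p g = p - 1" using g p by (simp add: residue_primroot_def totient_prime)
  define k where "k = g ^ ((p - 1) div q)"
  have "k ^ q = g ^ (p - 1)" unfolding k_def using qp by (simp flip: power_mult)
  moreover have "[g ^ (p - 1) = 1] (mod p)" by (simp only: ord_divides ordg dvd_refl)
  ultimately have "[k ^ q = 1] (mod p)" by simp
  moreover have "[k \<noteq> 1] (mod p)"
  proof
    assume "[k = 1] (mod p)"
    then have "(p - 1) dvd (p - 1) div q" unfolding k_def by (simp only: ord_divides ordg)
    then have "p - 1 \<le> (p - 1) div q" using qp p1 prime_gt_0_nat[OF q] by (intro dvd_imp_le) (auto elim!: dvdE)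
    moreover have "(p - 1) div q < p - 1" using p1 prime_gt_1_nat[OF q] by simp
    ultimately show False by simp
  qed
  ultimately show ?thesis using that by blast
qed

text \<open>In \<open>k^p - 1 = (k - 1) (1 + k + ... + k^(p-1))\<close> both factors are divisible
  by \<open>p\<close>: the second has \<open>p\<close> summands congruent to 1.\<close>

lemma power_prime_cong_square:
  fixes k p :: nat
  assumes "[k = 1] (mod p)"
  shows "[k ^ p = 1] (mod p\<^sup>2)"
proof -
  have 1: "[int k = 1] (mod int p)" using assms by (metis cong_int_iff of_nat_1)
  have "[(\<Sum>i<p. int k ^ i) = (\<Sum>i<p. 1)] (mod int p)"
    by (rule cong_sum) (use cong_pow[OF 1] in simp)
  then have "int p dvd (\<Sum>i<p. int k ^ i)" by (simp add: cong_iff_dvd_diff dvd_diff_left_iff)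
  moreover have "int p dvd int k - 1" using 1 by (simp add: cong_iff_dvd_diff)
  ultimately have "int p * int p dvd (int k - 1) * (\<Sum>i<p. int k ^ i)" by (rule mult_dvd_mono[rotated])
  then have "int (p\<^sup>2) dvd int k ^ p - 1" by (simp add: power_diff_1_eq power2_eq_square)
  then show ?thesis by (metis cong_iff_dvd_diff cong_int_iff of_nat_1 of_nat_power)
qed

text \<open>Three abelian groups arise by splitting off no, one or two factors of order
  \<open>p\<close> and are told apart by their exponents. The fourth is nonabelian:
  \<open>1 + p\<close> has order \<open>p\<close> modulo \<open>p\<^sup>2\<close> and lets a cyclic
  group of order \<open>p m\<close> act on one of order \<open>p\<^sup>2\<close>.\<close>

lemma num_groups_cube:
  assumes p: "Factorial_Ring.prime p" and n: "n > 0" "p ^ 3 dvd n"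
  shows "num_groups n \<noteq> 2 \<and> num_groups n \<noteq> 3"
proof -
  obtain m where "n = p ^ 3 * m" using n(2) by blast
  then have m: "n = p * (p * (p * m))" by (simp add: power3_eq_cube mult.assoc)
  have pos: "m > 0" "p > 0" and p1: "p > 1" using n(1) m prime_gt_1_nat[OF p] by auto
  let ?d1 = "p * (p * m)" and ?d2 = "p * m"
  let ?\<phi> = "\<lambda>c e (z :: nat \<Rightarrow> bool). if \<not> c then 3 else if e ?d2 then 2 else if e ?d1 then 1 else 0"
  have nd: "\<not> p * (p * (p * m)) dvd p * (p * m)" "\<not> p * (p * m) dvd p * m" "\<not> p * (p * (p * m)) dvd p * m"
    using p1 pos by (auto dest!: dvd_imp_le)
  have "invariant ?\<phi> (integer_mod_group n) = 0"
    unfolding invariant_def using nd by (simp add: commuting_Zn exponent_dvd_Zn n(1)) (simp add: m)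
  then have "0 \<in> invariant ?\<phi> ` groups_of_order n" using Zn_value[OF n(1), of ?\<phi>] by simp
  moreover have "1 \<in> invariant ?\<phi> ` groups_of_order n"
    by (rule invariant_value[of "integer_mod_group p \<times>\<times> integer_mod_group ?d1"])
      (use pos nd in \<open>auto simp: DirProd_group finite_Zn order_DirProd order_Zn m invariant_def
        commuting_DirProd exponent_dvd_DirProd commuting_Zn exponent_dvd_Zn\<close>)
  moreover have "2 \<in> invariant ?\<phi> ` groups_of_order n"
    by (rule invariant_value[of "integer_mod_group p \<times>\<times> (integer_mod_group p \<times>\<times> integer_mod_group ?d2)"])
      (use pos nd in \<open>auto simp: DirProd_group finite_Zn order_DirProd order_Zn m invariant_def
        commuting_DirProd exponent_dvd_DirProd commuting_Zn exponent_dvd_Zn\<close>)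
  moreover have "3 \<in> invariant ?\<phi> ` groups_of_order n"
  proof -
    have "[(1 + p) ^ p = 1] (mod p\<^sup>2)"
      by (rule power_prime_cong_square) (metis add_0_right cong_add_lcancel_nat cong_0_iff dvd_refl)
    then have "[((1 + p) ^ p) ^ m = 1 ^ m] (mod p\<^sup>2)" by (rule cong_pow)
    then interpret metacyclic_data "p\<^sup>2" "?d2" "1 + p"
      by unfold_locales (use pos in \<open>simp_all add: power_mult\<close>)
    have "\<not> commuting (metacyclic (p\<^sup>2) ?d2 (1 + p))"
    proof
      assume "commuting (metacyclic (p\<^sup>2) ?d2 (1 + p))"
      then have "[1 + p = 1 + 0] (mod p\<^sup>2)" using commuting_M by simp
      then have "p\<^sup>2 dvd p" by (simp only: cong_add_lcancel_nat cong_0_iff)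
      then show False using p1 by (auto simp: power2_eq_square dest!: dvd_imp_le)
    qed
    then show ?thesis
      by (intro invariant_value[OF group_M finite_M])
        (use order_M m in \<open>simp_all add: invariant_def power2_eq_square\<close>)
  qed
  ultimately show ?thesis by (rule num_groups_not_2_3)
qed

text \<open>At \<open>p\<close> and at \<open>q\<close> a factor may be split off or not,
  independently. In these four abelian groups the exponent divides \<open>n / p\<close>, called
  \<open>?d1\<close>, exactly if \<open>p\<close> has been split off, and \<open>n / q\<close>,
  called \<open>?d2\<close>, exactly if \<open>q\<close> has.\<close>

lemma num_groups_two_squares:
  assumes p: "Factorial_Ring.prime p" and q: "Factorial_Ring.prime q" and "p \<noteq> q"
    and n: "n > 0" "p\<^sup>2 dvd n" "q\<^sup>2 dvd n"
  shows "num_groups n \<noteq> 2 \<and> num_groups n \<noteq> 3"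
proof -
  have "coprime (p\<^sup>2) (q\<^sup>2)" using primes_coprime[OF p q] assms(3) by simp
  then have "p\<^sup>2 * q\<^sup>2 dvd n" using n divides_mult by blast
  then obtain m where "n = p\<^sup>2 * q\<^sup>2 * m" by blast
  then have m: "n = p * (q * (p * q * m))" by (simp add: power2_eq_square ac_simps)
  have pos: "m > 0" "p > 0" "q > 0" and p1: "p > 1" "q > 1" using n(1) m prime_gt_1_nat p q by auto
  have npq: "\<not> p dvd q" "\<not> q dvd p" using primes_dvd_imp_eq p q assms(3) by blast+
  let ?d1 = "q * (p * q * m)" and ?d2 = "p * (p * q * m)"
  let ?\<phi> = "\<lambda>(c::bool) e (z :: nat \<Rightarrow> bool). if e ?d1 then if e ?d2 then 3 else 2 else if e ?d2 then 1 else 0"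
  have nd: "\<not> n dvd ?d1" "\<not> n dvd ?d2" "\<not> ?d1 dvd ?d2" "\<not> ?d2 dvd ?d1" "p * q * m dvd ?d1" "p * q * m dvd ?d2"
    "p dvd ?d1" "p dvd ?d2" "q dvd ?d1" "q dvd ?d2"
    unfolding m using p1 pos npq by (auto dest!: dvd_imp_le)
  have m': "n = p * ?d1" "n = q * ?d2" using m by simp_all
  have "invariant ?\<phi> (integer_mod_group n) = 0"
    unfolding invariant_def using nd by (simp add: exponent_dvd_Zn n(1))
  then have "0 \<in> invariant ?\<phi> ` groups_of_order n" using Zn_value[OF n(1), of ?\<phi>] by simp
  moreover have "1 \<in> invariant ?\<phi> ` groups_of_order n"
    by (rule invariant_value[of "integer_mod_group q \<times>\<times> integer_mod_group ?d2"])
      (use pos nd m' in \<open>simp_all add: DirProd_group finite_Zn order_DirProd order_Zn invariant_def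
        exponent_dvd_DirProd exponent_dvd_Zn\<close>)
  moreover have "2 \<in> invariant ?\<phi> ` groups_of_order n"
    by (rule invariant_value[of "integer_mod_group p \<times>\<times> integer_mod_group ?d1"])
      (use pos nd m' in \<open>simp_all add: DirProd_group finite_Zn order_DirProd order_Zn invariant_def
        exponent_dvd_DirProd exponent_dvd_Zn\<close>)
  moreover have "3 \<in> invariant ?\<phi> ` groups_of_order n"
    by (rule invariant_value[of "integer_mod_group p \<times>\<times> (integer_mod_group q \<times>\<times> integer_mod_group (p * q * m))"])
      (use pos nd m in \<open>simp_all add: DirProd_group finite_Zn order_DirProd order_Zn invariant_def
        exponent_dvd_DirProd exponent_dvd_Zn\<close>)
  ultimately show ?thesis by (rule num_groups_not_2_3)
qed

text \<open>Every order of this form has a cyclic group and an abelian group with one factor of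
  order \<open>p\<close> split off; later codes reserve 0 and 1 for these two.\<close>

lemma prime_square_abelian_values:
  assumes p: "Factorial_Ring.prime p" and N: "N > 0"
    and \<phi>0: "\<And>e z. \<not> e (p * N) \<Longrightarrow> \<phi> True e z = 0" and \<phi>1: "\<And>e z. e (p * N) \<Longrightarrow> \<phi> True e z = 1"
  shows "0 \<in> invariant \<phi> ` groups_of_order (p\<^sup>2 * N)" "1 \<in> invariant \<phi> ` groups_of_order (p\<^sup>2 * N)"
proof -
  have p1: "p > 1" using p by (rule prime_gt_1_nat)
  have pos: "p\<^sup>2 * N > 0" "p > 0" "p * N > 0" using p1 N by simp_all
  have "\<not> p\<^sup>2 * N dvd p * N" using p1 N by (auto simp: power2_eq_square dest!: dvd_imp_le)
  then have "invariant \<phi> (integer_mod_group (p\<^sup>2 * N)) = 0"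
    unfolding invariant_def using exponent_dvd_Zn[OF pos(1)] by (simp add: commuting_Zn \<phi>0)
  then show "0 \<in> invariant \<phi> ` groups_of_order (p\<^sup>2 * N)" using Zn_value[OF pos(1), of \<phi>] by simp
  let ?G = "integer_mod_group p \<times>\<times> integer_mod_group (p * N)"
  have "commuting ?G" "exponent_dvd ?G (p * N)"
    by (simp_all add: commuting_DirProd commuting_Zn exponent_dvd_DirProd exponent_dvd_Zn[OF pos(2)] exponent_dvd_Zn[OF pos(3)])
  then have "invariant \<phi> ?G = 1" unfolding invariant_def using \<phi>1 by simp
  then show "1 \<in> invariant \<phi> ` groups_of_order (p\<^sup>2 * N)"
    by (intro invariant_value[of ?G])
      (use pos in \<open>simp_all add: DirProd_group finite_Zn order_DirProd order_Zn power2_eq_square\<close>)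
qed

text \<open>The two nonabelian groups extend a cyclic group of order \<open>r\<close>, either by a
  cyclic group of order \<open>p\<^sup>2 N'\<close> or with a factor of order \<open>p\<close> split
  off; the exponent separates them. The source \<open>u\<close> may be \<open>p\<close> itself, so
  one factor \<open>p\<close> is kept in the acting group of the second.\<close>

lemma num_groups_square_edge_off:
  assumes p: "Factorial_Ring.prime p" and r: "Factorial_Ring.prime r" and u: "Factorial_Ring.prime u"
    and N: "N > 0" "r dvd N" and pr: "p \<noteq> r" and u_dvd: "u dvd p\<^sup>2 * N" and ur: "u dvd r - 1"
  shows "num_groups (p\<^sup>2 * N) \<noteq> 2 \<and> num_groups (p\<^sup>2 * N) \<noteq> 3"
proof -
  obtain N' where N': "N = r * N'" using N(2) by blast
  have pos: "N' > 0" "p > 0" "r > 0" and p1: "p > 1" "r > 1"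
    using N(1) N' prime_gt_1_nat[OF p] prime_gt_1_nat[OF r] by auto
  have "u \<noteq> r" using ur p1 by (auto dest: dvd_imp_le)
  then have "\<not> u dvd r" using primes_dvd_imp_eq u r by blast
  then have "u dvd p \<or> u dvd N'"
    using u_dvd u N' by (auto simp: prime_dvd_mult_iff prime_dvd_power_iff)
  then have u_pN: "u dvd p * N'" by auto
  obtain k where k: "[k ^ u = 1] (mod r)" "[k \<noteq> 1] (mod r)" using exists_prime_order_residue[OF u r ur] by blast
  have kpow: "[k ^ (p * N') = 1] (mod r)"
    using k(1) u_pN by (meson dvd_trans ord_divides)
  then have "[(k ^ (p * N')) ^ p = 1 ^ p] (mod r)" by (rule cong_pow)
  then have kpow2: "[k ^ (p\<^sup>2 * N') = 1] (mod r)" by (simp add: power2_eq_square ac_simps flip: power_mult)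
  interpret A: metacyclic_data r "p * N'" k by unfold_locales (use pos kpow in simp_all)
  interpret B: metacyclic_data r "p\<^sup>2 * N'" k by unfold_locales (use pos kpow2 in simp_all)
  let ?\<phi> = "\<lambda>c e (z :: nat \<Rightarrow> bool). if c then if e (p * N) then 1 else 0 else if e (p * N) then 3 else 2"
  have "2 \<in> invariant ?\<phi> ` groups_of_order (p\<^sup>2 * N)"
  proof (rule invariant_value[OF B.group_M B.finite_M])
    show "order (metacyclic r (p\<^sup>2 * N') k) = p\<^sup>2 * N" using B.order_M N' by simp
    have "\<not> p dvd r" using pr primes_dvd_imp_eq p r by blast
    then have "\<not> p\<^sup>2 * N' dvd p * N" using pos by (simp add: N' power2_eq_square)
    then have "\<not> exponent_dvd (metacyclic r (p\<^sup>2 * N') k) (p * N)" using B.not_exponent_dvd_M by blast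
    then show "invariant ?\<phi> (metacyclic r (p\<^sup>2 * N') k) = 2"
      unfolding invariant_def using k(2) B.commuting_M by simp
  qed
  moreover have "3 \<in> invariant ?\<phi> ` groups_of_order (p\<^sup>2 * N)"
  proof (rule invariant_value[of "integer_mod_group p \<times>\<times> metacyclic r (p * N') k"])
    let ?M = "metacyclic r (p * N') k"
    show "group (integer_mod_group p \<times>\<times> ?M)" by (simp add: DirProd_group A.group_M)
    show "finite (carrier (integer_mod_group p \<times>\<times> ?M))" using pos by (simp add: finite_Zn A.finite_M)
    show "order (integer_mod_group p \<times>\<times> ?M) = p\<^sup>2 * N"
      using pos by (simp add: order_DirProd order_Zn A.order_M N' power2_eq_square)
    have "exponent_dvd ?M (p * N)"
      by (rule group.exponent_dvd_order[OF A.group_M]) (simp only: A.order_M N', simp add: ac_simps)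
    then have "exponent_dvd (integer_mod_group p \<times>\<times> ?M) (p * N)"
      using pos by (simp add: exponent_dvd_DirProd A.group_M exponent_dvd_Zn)
    moreover have "\<not> commuting (integer_mod_group p \<times>\<times> ?M)"
      using k(2) by (simp add: commuting_DirProd A.group_M A.commuting_M)
    ultimately show "invariant ?\<phi> (integer_mod_group p \<times>\<times> ?M) = 3" unfolding invariant_def by simp
  qed
  ultimately show ?thesis
    using num_groups_not_2_3 prime_square_abelian_values[OF p N(1), of ?\<phi>] by simp
qed

text \<open>The edge acts on a kernel of order \<open>p\<^sup>2\<close> that is cyclic in one group
  and elementary in the other. In the cyclic case the multiplier is \<open>k^p\<close>: raising to
  the power \<open>p\<close> lifts the root of unity from modulus \<open>p\<close> to
  \<open>p\<^sup>2\<close>, and \<open>k^p\<close> stays nontrivial modulo \<open>p\<close>.\<close>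

lemma num_groups_square_edge_into:
  assumes p: "Factorial_Ring.prime p" and u: "Factorial_Ring.prime u"
    and N: "N > 0" "\<not> p dvd N" and u_dvd: "u dvd N" and up: "u dvd p - 1"
  shows "num_groups (p\<^sup>2 * N) \<noteq> 2 \<and> num_groups (p\<^sup>2 * N) \<noteq> 3"
proof -
  have p1: "p > 1" and pos: "p > 0" using prime_gt_1_nat[OF p] by auto
  obtain k where k: "[k ^ u = 1] (mod p)" "[k \<noteq> 1] (mod p)" using exists_prime_order_residue[OF u p up] by blast
  have kpow: "[k ^ N = 1] (mod p)"
    using k(1) u_dvd by (meson dvd_trans ord_divides)
  then have "[(k ^ N) ^ p = 1] (mod p\<^sup>2)" by (rule power_prime_cong_square)
  then have kpow2: "[(k ^ p) ^ N = 1] (mod p\<^sup>2)" by (simp add: mult.commute flip: power_mult)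
  interpret A: metacyclic_data p N k by unfold_locales (use pos N kpow in simp_all)
  interpret B: metacyclic_data "p\<^sup>2" N "k ^ p" by unfold_locales (use pos N kpow2 in simp_all)
  let ?\<phi> = "\<lambda>c e (z :: nat \<Rightarrow> bool). if c then if e (p * N) then 1 else 0 else if e (p * N) then 3 else 2"
  have "2 \<in> invariant ?\<phi> ` groups_of_order (p\<^sup>2 * N)"
  proof (rule invariant_value[OF B.group_M B.finite_M])
    show "order (metacyclic (p\<^sup>2) N (k ^ p)) = p\<^sup>2 * N" using B.order_M by simp
    have "\<not> p\<^sup>2 dvd p * N" using pos N by (simp add: power2_eq_square)
    then have "\<not> exponent_dvd (metacyclic (p\<^sup>2) N (k ^ p)) (p * N)" using B.not_exponent_dvd_M by blast
    moreover have "\<not> commuting (metacyclic (p\<^sup>2) N (k ^ p))"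
    proof
      assume "commuting (metacyclic (p\<^sup>2) N (k ^ p))"
      then have "[k ^ p = 1] (mod p\<^sup>2)" using B.commuting_M by simp
      then have kp: "[k ^ p = 1] (mod p)" by (rule cong_dvd_modulus_nat) simp
      have "coprime p (p - 1)" using p1 by (intro prime_imp_coprime[OF p]) (auto dest!: dvd_imp_le)
      then have "[k = 1] (mod p)" using prime_power_eq_1_coprime[OF p kp] pos by blast
      then show False using k(2) by blast
    qed
    ultimately show "invariant ?\<phi> (metacyclic (p\<^sup>2) N (k ^ p)) = 2" unfolding invariant_def by simp
  qed
  moreover have "3 \<in> invariant ?\<phi> ` groups_of_order (p\<^sup>2 * N)"
  proof (rule invariant_value[of "integer_mod_group p \<times>\<times> metacyclic p N k"])
    let ?M = "metacyclic p N k"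
    show "group (integer_mod_group p \<times>\<times> ?M)" by (simp add: DirProd_group A.group_M)
    show "finite (carrier (integer_mod_group p \<times>\<times> ?M))" using pos by (simp add: finite_Zn A.finite_M)
    show "order (integer_mod_group p \<times>\<times> ?M) = p\<^sup>2 * N"
      using pos by (simp add: order_DirProd order_Zn A.order_M power2_eq_square)
    have "exponent_dvd ?M (p * N)"
      by (rule group.exponent_dvd_order[OF A.group_M]) (simp add: A.order_M)
    then have "exponent_dvd (integer_mod_group p \<times>\<times> ?M) (p * N)"
      using pos by (simp add: exponent_dvd_DirProd A.group_M exponent_dvd_Zn)
    moreover have "\<not> commuting (integer_mod_group p \<times>\<times> ?M)"
      using k(2) by (simp add: commuting_DirProd A.group_M A.commuting_M)
    ultimately show "invariant ?\<phi> (integer_mod_group p \<times>\<times> ?M) = 3" unfolding invariant_def by simp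
  qed
  ultimately show ?thesis
    using num_groups_not_2_3 prime_square_abelian_values[OF p N(1), of ?\<phi>] by simp
qed

lemma squarefree_metacyclic_value:
  assumes n: "n = a * N" "squarefree n" and k: "[k ^ N = 1] (mod a)"
  shows "invariant \<phi> (metacyclic a N k) \<in> invariant \<phi> ` groups_of_order n"
proof -
  have "a > 0" "N > 0" using n by (auto intro!: gr0I)
  then interpret metacyclic_data a N k using k by unfold_locales
  show ?thesis by (rule invariant_value[OF group_M finite_M]) (simp_all add: order_M n)
qed

text \<open>The multiplier on the cyclic group of order \<open>p r\<close> can be chosen
  independently modulo \<open>p\<close> and modulo \<open>r\<close>, trivial or not, and centrality
  of the elements of order \<open>p\<close> and of order \<open>r\<close> reads off both choices.
  \<open>q \<noteq> r\<close> and \<open>s \<noteq> p\<close> keep the sources in the acting group;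
  \<open>q\<close> and \<open>s\<close> may coincide.\<close>

lemma num_groups_two_targets:
  assumes sqf: "squarefree n" and p: "Factorial_Ring.prime p" "p dvd n" and r: "Factorial_Ring.prime r" "r dvd n" and "p \<noteq> r"
    and q: "Factorial_Ring.prime q" "q dvd n" "q dvd p - 1" "q \<noteq> r"
    and s: "Factorial_Ring.prime s" "s dvd n" "s dvd r - 1" "s \<noteq> p"
  shows "num_groups n \<noteq> 2 \<and> num_groups n \<noteq> 3"
proof -
  have pr: "coprime p r" using primes_coprime p(1) r(1) assms(6) by blast
  then have "p * r dvd n" using p r divides_mult by blast
  then obtain N where N: "n = p * r * N" by blast
  have p1: "p > 1" "r > 1" using prime_gt_1_nat p(1) r(1) by auto
  have "q \<noteq> p" "s \<noteq> r" using q(3) s(3) p1 by (auto dest: dvd_imp_le)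
  then have qN: "q dvd N" and sN: "s dvd N"
    using q s p(1) r(1) N primes_dvd_imp_eq by (auto simp: prime_dvd_mult_iff)
  have cop: "coprime p N" "coprime r N"
  proof -
    have "\<not> p dvd N" using squarefreeD[OF sqf, of p] p(1) N by (auto simp: power2_eq_square)
    then show "coprime p N" by (rule prime_imp_coprime[OF p(1)])
    have "\<not> r dvd N" using squarefreeD[OF sqf, of r] r(1) N by (auto simp: power2_eq_square)
    then show "coprime r N" by (rule prime_imp_coprime[OF r(1)])
  qed
  obtain k1 where k1: "[k1 ^ q = 1] (mod p)" "[k1 \<noteq> 1] (mod p)" using exists_prime_order_residue[OF q(1) p(1) q(3)] by blast
  obtain k2 where k2: "[k2 ^ s = 1] (mod r)" "[k2 \<noteq> 1] (mod r)" using exists_prime_order_residue[OF s(1) r(1) s(3)] by blast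
  have k1N: "[k1 ^ N = 1] (mod p)" using k1(1) qN by (meson dvd_trans ord_divides)
  have k2N: "[k2 ^ N = 1] (mod r)" using k2(1) sN by (meson dvd_trans ord_divides)
  let ?\<phi> = "\<lambda>(c::bool) (e :: nat \<Rightarrow> bool) z. (if z p then 0 else 1) + (if z r then 0 else 2)"
  have val: "(if [l1 = 1] (mod p) then 0 else 1) + (if [l2 = 1] (mod r) then 0 else 2) \<in> invariant ?\<phi> ` groups_of_order n"
    if l: "[l1 ^ N = 1] (mod p)" "[l2 ^ N = 1] (mod r)" for l1 l2
  proof -
    obtain k where k: "[k = l1] (mod p)" "[k = l2] (mod r)" using binary_chinese_remainder_nat[OF pr] by blast
    have kN: "[k ^ N = 1] (mod p * r)"
      by (rule coprime_cong_mult_nat[OF _ _ pr]) (use l k cong_pow cong_trans in blast)+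
    have pos: "p * r > 0" "N > 0" using sqf N by (auto intro!: gr0I)
    interpret M: metacyclic_data "p * r" N k by unfold_locales (use pos kN in auto)
    have "central_torsion (metacyclic (p * r) N k) p \<longleftrightarrow> [l1 = 1] (mod p)"
      using M.central_M_kernel[OF dvd_triv_left cop(1)] k(1) by (simp add: cong_def)
    moreover have "central_torsion (metacyclic (p * r) N k) r \<longleftrightarrow> [l2 = 1] (mod r)"
      using M.central_M_kernel[OF dvd_triv_right cop(2)] k(2) by (simp add: cong_def)
    ultimately show ?thesis
      using squarefree_metacyclic_value[OF N sqf kN, of ?\<phi>] unfolding invariant_def by simp
  qed
  show ?thesis
    by (rule num_groups_not_2_3[of ?\<phi>])
      (use val[of 1 1] val[of k1 1] val[of 1 k2] val[of k1 k2] k1 k2 k1N k2N in \<open>simp_all add: numeral_2_eq_2 numeral_3_eq_3\<close>)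
qed

text \<open>The multipliers \<open>1\<close>, \<open>k1\<close>, \<open>k2\<close> and
  \<open>k1 * k2\<close> have orders 1, \<open>p\<close>, \<open>q\<close> and \<open>p q\<close>
  modulo \<open>r\<close>. Elements of order \<open>p\<close> are central exactly if
  \<open>k^(N div p) = 1\<close>, that is, if the \<open>p\<close>-part of the cyclic group acts
  trivially; likewise for \<open>q\<close>.\<close>

lemma num_groups_common_target:
  assumes sqf: "squarefree n" and r: "Factorial_Ring.prime r" "r dvd n"
    and p: "Factorial_Ring.prime p" "p dvd n" "p dvd r - 1" and q: "Factorial_Ring.prime q" "q dvd n" "q dvd r - 1" and "p \<noteq> q"
  shows "num_groups n \<noteq> 2 \<and> num_groups n \<noteq> 3"
proof -
  obtain N where N: "n = r * N" using r(2) by blast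
  have r1: "r > 1" using prime_gt_1_nat r(1) by auto
  have rpq: "p \<noteq> r" "q \<noteq> r" using p(3) q(3) r1 by (auto dest: dvd_imp_le)
  then have pN: "p dvd N" and qN: "q dvd N"
    using q p r(1) N primes_dvd_imp_eq by (auto simp: prime_dvd_mult_iff)
  have sqfN: "squarefree N" using sqf N by (metis dvd_triv_right squarefree_mono)
  have pq: "q dvd N div p" "\<not> p dvd N div p" "p dvd N div q" "\<not> q dvd N div q"
  proof -
    obtain c where c: "N = p * c" using pN by blast
    have p0: "p > 0" "q > 0" using p q by (auto intro: prime_gt_0_nat)
    have "\<not> q dvd p" "\<not> p dvd q" using assms(10) primes_dvd_imp_eq p(1) q(1) by blast+
    then show "q dvd N div p" using c qN q(1) p0 by (auto simp: prime_dvd_mult_iff)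
    show "\<not> p dvd N div p" using squarefreeD[OF sqfN, of p] p(1) c p0 by (auto simp: power2_eq_square)
    obtain b where b: "N = q * b" using qN by blast
    show "p dvd N div q" using b pN p(1) p0 \<open>\<not> p dvd q\<close> by (auto simp: prime_dvd_mult_iff)
    show "\<not> q dvd N div q" using squarefreeD[OF sqfN, of q] q(1) b p0 by (auto simp: power2_eq_square)
  qed
  obtain k1 where k1: "[k1 ^ p = 1] (mod r)" "[k1 \<noteq> 1] (mod r)" using exists_prime_order_residue[OF p(1) r(1) p(3)] by blast
  obtain k2 where k2: "[k2 ^ q = 1] (mod r)" "[k2 \<noteq> 1] (mod r)" using exists_prime_order_residue[OF q(1) r(1) q(3)] by blast
  have triv: "[k ^ m = 1] (mod r)" if "[k ^ t = 1] (mod r)" "t dvd m" for k t m :: nat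
    using that by (meson dvd_trans ord_divides)
  have nontriv: "[k ^ m \<noteq> 1] (mod r)" if "[k ^ t = 1] (mod r)" "[k \<noteq> 1] (mod r)" "Factorial_Ring.prime t" "\<not> t dvd m" for k t m :: nat
  proof
    assume "[k ^ m = 1] (mod r)"
    then have "[k ^ gcd t m = 1] (mod r)" using cong_power_gcd_eq_1[OF that(1)] by blast
    moreover have "gcd t m = 1" using prime_imp_coprime[OF that(3,4)] by simp
    ultimately show False using that(2) by simp
  qed
  have cop: "coprime p r" "coprime q r" using primes_coprime p(1) q(1) r(1) rpq by blast+
  have pos: "r > 0" "N > 0" "p > 0" "q > 0" using sqf N p q by (auto intro!: gr0I)
  let ?\<phi> = "\<lambda>(c::bool) (e :: nat \<Rightarrow> bool) z. (if z p then 0 else 1) + (if z q then 0 else 2)"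
  have val: "(if [k ^ (N div p) = 1] (mod r) then 0 else 1) + (if [k ^ (N div q) = 1] (mod r) then 0 else 2)
      \<in> invariant ?\<phi> ` groups_of_order n" if k: "[k ^ N = 1] (mod r)" for k
  proof -
    interpret M: metacyclic_data r N k by unfold_locales (use pos k in auto)
    show ?thesis
      using squarefree_metacyclic_value[OF N sqf k, of ?\<phi>]
        M.central_M_complement[OF pN cop(1) pos(3)] M.central_M_complement[OF qN cop(2) pos(4)]
      unfolding invariant_def by simp
  qed
  have 1: "[k1 ^ (N div p) \<noteq> 1] (mod r)" "[k1 ^ (N div q) = 1] (mod r)"
    "[k2 ^ (N div q) \<noteq> 1] (mod r)" "[k2 ^ (N div p) = 1] (mod r)"
    using nontriv[OF k1 p(1) pq(2)] triv[OF k1(1) pq(3)] nontriv[OF k2 q(1) pq(4)] triv[OF k2(1) pq(1)] by auto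
  have 2: "[(k1 * k2) ^ (N div p) = k1 ^ (N div p)] (mod r)" "[(k1 * k2) ^ (N div q) = k2 ^ (N div q)] (mod r)"
    using cong_mult[OF cong_refl[of "k1 ^ (N div p)" r] 1(4)] cong_mult[OF 1(2) cong_refl[of "k2 ^ (N div q)" r]]
    by (simp_all add: power_mult_distrib)
  have 3: "[(k1 * k2) ^ (N div p) \<noteq> 1] (mod r)" "[(k1 * k2) ^ (N div q) \<noteq> 1] (mod r)"
    using 1 2 cong_sym cong_trans by blast+
  have N1: "[k1 ^ N = 1] (mod r)" "[k2 ^ N = 1] (mod r)" using triv k1(1) k2(1) pN qN by blast+
  have N3: "[(k1 * k2) ^ N = 1] (mod r)" using cong_mult[OF N1] by (simp add: power_mult_distrib)
  show ?thesis
    by (rule num_groups_not_2_3[of ?\<phi>])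
      (use val[of 1] val[OF N1(1)] val[OF N1(2)] val[OF N3] 1 3 in \<open>simp_all add: numeral_2_eq_2 numeral_3_eq_3\<close>)
qed

subsection \<open>Orders with two or three groups\<close>

lemma exists_nonresidue:
  fixes p :: nat
  assumes p: "Factorial_Ring.prime p" "p \<noteq> 2"
  obtains d :: int where "\<And>y. \<not> [y\<^sup>2 = d] (mod int p)"
proof -
  have p2: "p > 2" using p prime_ge_2_nat[OF p(1)] by linarith
  let ?f = "\<lambda>y. y\<^sup>2 mod int p" and ?A = "{0..<int p}"
  have eq: "?f 1 = ?f (int p - 1)"
    by (simp add: power2_eq_square mod_eq_dvd_iff algebra_simps)
  \<comment> \<open>1 and \<open>p - 1\<close> have the same square and differ for odd
    \<open>p\<close>; a map of a finite set to itself that is not injective misses a value.\<close>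
  have "\<not> inj_on ?f ?A"
  proof
    assume "inj_on ?f ?A"
    from inj_onD[OF this eq] show False using p2 by auto
  qed
  moreover have "?f ` ?A \<subseteq> ?A" using p2 by auto
  ultimately have "?f ` ?A \<noteq> ?A" using eq_card_imp_inj_on[of ?A ?f] by force
  then obtain d where d: "d \<in> ?A" "d \<notin> ?f ` ?A" using \<open>?f ` ?A \<subseteq> ?A\<close> by blast
  have "\<not> [y\<^sup>2 = d] (mod int p)" for y
  proof
    assume "[y\<^sup>2 = d] (mod int p)"
    then have "d = ?f (y mod int p)" using d(1) by (simp add: cong_def power_mod)
    moreover have "y mod int p \<in> ?A" using p2 by simp
    ultimately show False using d(2) by blast
  qed
  then show ?thesis using that by blast
qed

text \<open>Arithmetic in \<open>\<int>/p[\<surd>d]\<close> for a quadratic nonresidue \<open>d\<close>, on pairs of reduced representatives.\<close>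

locale quadratic_extension =
  fixes p :: nat and d :: int
  assumes p: "Factorial_Ring.prime p" and nonres: "\<And>y. \<not> [y\<^sup>2 = d] (mod int p)"
begin

fun qmult :: "int \<times> int \<Rightarrow> int \<times> int \<Rightarrow> int \<times> int" where
  "qmult (a, b) (u, v) = ((a * u + d * b * v) mod int p, (a * v + b * u) mod int p)"

definition Q :: "(int \<times> int) monoid" where
  "Q = \<lparr>carrier = {0..<int p} \<times> {0..<int p} - {(0, 0)}, monoid.mult = qmult, one = (1, 0)\<rparr>"

lemma p1: "int p > 1" using prime_gt_1_nat[OF p] by simp

text \<open>If \<open>p\<close> did not divide \<open>b\<close>, dividing by \<open>b\<close> would
  exhibit \<open>d\<close> as a square. So the norm form vanishes modulo \<open>p\<close> only at
  zero, and nonzero elements are invertible.\<close>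

lemma norm_dvd:
  assumes "int p dvd a\<^sup>2 - d * b\<^sup>2"
  shows "int p dvd a \<and> int p dvd b"
proof (cases "int p dvd b")
  case True
  then have "int p dvd a\<^sup>2" using assms by (simp add: dvd_diff_left_iff power2_eq_square)
  then show ?thesis using True p prime_dvd_power[of "int p" a 2] by simp
next
  case False
  then have "coprime b (int p)" using p by (metis coprime_commute prime_imp_coprime prime_int_nat_transfer prime_nat_int_transfer)
  then obtain c where c: "[b * c = 1] (mod int p)" using cong_solve_coprime_int by blast
  have "[a\<^sup>2 = d * b\<^sup>2] (mod int p)" using assms by (simp add: cong_iff_dvd_diff)
  then have "[a\<^sup>2 * c\<^sup>2 = d * b\<^sup>2 * c\<^sup>2] (mod int p)" by (rule cong_mult[OF _ cong_refl])
  moreover have "[d * (b * c)\<^sup>2 = d * 1\<^sup>2] (mod int p)" by (intro cong_mult cong_refl cong_pow c)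
  ultimately have "[(a * c)\<^sup>2 = d] (mod int p)" by (simp add: power_mult_distrib mult.assoc cong_trans)
  then show ?thesis using nonres by blast
qed

lemma zero_iff:
  assumes "a \<in> {0..<int p}" "b \<in> {0..<int p}"
  shows "(a, b) = (0, 0) \<longleftrightarrow> int p dvd a\<^sup>2 - d * b\<^sup>2"
proof -
  have "c = 0" if "int p dvd c" "c \<in> {0..<int p}" for c
    using that by (metis atLeastLessThan_iff order_le_less zdvd_not_zless)
  then show ?thesis using norm_dvd[of a b] assms by auto
qed

lemma qmult_range: "qmult x y \<in> {0..<int p} \<times> {0..<int p}"
  using p1 by (cases x; cases y) auto

lemma qmult_mod_right: "qmult (a, b) (u mod int p, v mod int p) = qmult (a, b) (u, v)"
  by (auto intro!: mod_add_cong mod_mult_cong)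

lemma qmult_mod_left: "qmult (a mod int p, b mod int p) (u, v) = qmult (a, b) (u, v)"
  by (auto intro!: mod_add_cong mod_mult_cong)

lemma qmult_assoc: "qmult (qmult x y) z = qmult x (qmult y z)"
proof -
  obtain a b u v s t where e: "x = (a, b)" "y = (u, v)" "z = (s, t)" by (cases x; cases y; cases z)
  have "qmult (qmult x y) z = qmult (a * u + d * b * v, a * v + b * u) (s, t)"
    unfolding e qmult.simps(1)[of a b u v] by (rule qmult_mod_left)
  also have "\<dots> = qmult (a, b) (u * s + d * v * t, u * t + v * s)"
    by (simp add: algebra_simps)
  also have "\<dots> = qmult x (qmult y z)"
    unfolding e qmult.simps(1)[of u v s t] by (rule qmult_mod_right[symmetric])
  finally show ?thesis .
qed

lemma qmult_one: "x \<in> {0..<int p} \<times> {0..<int p} \<Longrightarrow> qmult (1, 0) x = x" "x \<in> {0..<int p} \<times> {0..<int p} \<Longrightarrow> qmult x (1, 0) = x"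
  by (cases x; simp)+

lemma group_Q: "group Q"
proof (rule groupI)
  show "\<one>\<^bsub>Q\<^esub> \<in> carrier Q" using p1 by (simp add: Q_def)
  fix x assume x: "x \<in> carrier Q"
  then show "\<one>\<^bsub>Q\<^esub> \<otimes>\<^bsub>Q\<^esub> x = x" using qmult_one by (simp add: Q_def)
  obtain a b where e: "x = (a, b)" by (cases x)
  have r: "a \<in> {0..<int p}" "b \<in> {0..<int p}" "(a, b) \<noteq> (0, 0)" using x by (auto simp: e Q_def)
  have nx: "\<not> int p dvd a\<^sup>2 - d * b\<^sup>2" using zero_iff[OF r(1,2)] r(3) by blast
  {
    fix y assume y: "y \<in> carrier Q"
    obtain u v where e': "y = (u, v)" by (cases y)
    have r': "u \<in> {0..<int p}" "v \<in> {0..<int p}" "(u, v) \<noteq> (0, 0)" using y by (auto simp: e' Q_def)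
    have ny: "\<not> int p dvd u\<^sup>2 - d * v\<^sup>2" using zero_iff[OF r'(1,2)] r'(3) by blast
    have "qmult x y \<noteq> (0, 0)"
    proof
      assume "qmult x y = (0, 0)"
      then have "int p dvd a * u + d * b * v" "int p dvd a * v + b * u" by (auto simp: e e')
      \<comment> \<open>The norm is multiplicative, so a product of elements of nonzero norm is
        nonzero.\<close>
      then have "int p dvd (a * u + d * b * v)\<^sup>2 - d * (a * v + b * u)\<^sup>2" by (simp add: power2_eq_square)
      also have "(a * u + d * b * v)\<^sup>2 - d * (a * v + b * u)\<^sup>2 = (a\<^sup>2 - d * b\<^sup>2) * (u\<^sup>2 - d * v\<^sup>2)"
        by (simp add: power2_eq_square algebra_simps)
      finally show False using nx ny p by (simp add: prime_dvd_mult_iff)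
    qed
    then show "x \<otimes>\<^bsub>Q\<^esub> y \<in> carrier Q" using qmult_range[of x y] by (simp add: Q_def)
  }
  have "coprime (a\<^sup>2 - d * b\<^sup>2) (int p)"
    using nx p by (metis coprime_commute prime_imp_coprime prime_int_nat_transfer prime_nat_int_transfer)
  then obtain m where m: "[(a\<^sup>2 - d * b\<^sup>2) * m = 1] (mod int p)" using cong_solve_coprime_int by blast
  \<comment> \<open>The inverse is the conjugate \<open>a - b \<surd>d\<close> divided by the norm;
    \<open>m\<close> inverts the norm modulo \<open>p\<close>.\<close>
  let ?y = "((a * m) mod int p, (- b * m) mod int p)"
  have "qmult ?y x = (((a\<^sup>2 - d * b\<^sup>2) * m) mod int p, 0)"
    unfolding e qmult_mod_left by (simp add: power2_eq_square algebra_simps)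
  also have "\<dots> = (1, 0)" using m p1 by (simp add: cong_def)
  finally have yx: "qmult ?y x = (1, 0)" .
  have "?y \<noteq> (0, 0)"
  proof
    assume "?y = (0, 0)"
    then have "qmult (0, 0) x = (1, 0)" using yx by simp
    then show False by (simp add: e)
  qed
  then have "?y \<in> carrier Q" using p1 by (simp add: Q_def)
  then show "\<exists>y\<in>carrier Q. y \<otimes>\<^bsub>Q\<^esub> x = \<one>\<^bsub>Q\<^esub>" using yx by (intro bexI[of _ ?y]) (simp_all add: Q_def)
next
  fix x y z assume "x \<in> carrier Q" "y \<in> carrier Q" "z \<in> carrier Q"
  show "x \<otimes>\<^bsub>Q\<^esub> y \<otimes>\<^bsub>Q\<^esub> z = x \<otimes>\<^bsub>Q\<^esub> (y \<otimes>\<^bsub>Q\<^esub> z)" using qmult_assoc by (simp add: Q_def)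
qed

lemma finite_Q: "finite (carrier Q)" by (simp add: Q_def)

lemma order_Q: "order Q = p\<^sup>2 - 1"
  using p1 by (simp add: order_def Q_def card_cartesian_product power2_eq_square card_Diff_subset)

end

text \<open>Cauchy provides an element \<open>z\<close> of order \<open>l\<close> in the unit group,
  which has order \<open>p\<^sup>2 - 1\<close>. Multiplication by \<open>z^i\<close> is the identity
  exactly if \<open>z^i = 1\<close>, as its value at 1 shows.\<close>

lemma exists_prime_order_automorphism:
  fixes p l :: nat
  assumes p: "Factorial_Ring.prime p" "p \<noteq> 2" and l: "Factorial_Ring.prime l" "l dvd p\<^sup>2 - 1"
  defines "W \<equiv> integer_mod_group p \<times>\<times> integer_mod_group p"
  obtains \<sigma> where "\<sigma> \<in> hom W W" "\<And>i. (\<forall>w\<in>carrier W. (\<sigma> ^^ i) w = w) \<longleftrightarrow> l dvd i"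
proof -
  obtain d where "\<And>y. \<not> [y\<^sup>2 = d] (mod int p)" using exists_nonresidue[OF p] by blast
  then interpret quadratic_extension p d by unfold_locales (use p in auto)
  interpret Q: group Q by (rule group_Q)
  obtain z where z: "z \<in> carrier Q" "Q.ord z = l" using Q.Cauchy_prime[OF finite_Q l(1)] l(2) order_Q by auto
  define \<sigma> where "\<sigma> = qmult z"
  have W: "carrier W = {0..<int p} \<times> {0..<int p}"
    using p1 by (simp add: W_def carrier_integer_mod_group)
  have "\<sigma> \<in> hom W W"
  proof (rule homI)
    show "\<sigma> w \<in> carrier W" if "w \<in> carrier W" for w using qmult_range W by (simp add: \<sigma>_def)
    show "\<sigma> (x \<otimes>\<^bsub>W\<^esub> y) = \<sigma> x \<otimes>\<^bsub>W\<^esub> \<sigma> y" for x y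
    proof -
      obtain a b u v s t where e: "z = (a, b)" "x = (u, v)" "y = (s, t)" by (cases x; cases y; cases z)
      have "\<sigma> (x \<otimes>\<^bsub>W\<^esub> y) = qmult (a, b) (u + s, v + t)"
        using qmult_mod_right[of a b "u + s" "v + t"] by (simp only: e \<sigma>_def W_def mult_DirProd mult_integer_mod_group)
      also have "\<dots> = (((a * u + d * b * v) + (a * s + d * b * t)) mod int p, ((a * v + b * u) + (a * t + b * s)) mod int p)"
        by (simp add: algebra_simps)
      also have "\<dots> = \<sigma> x \<otimes>\<^bsub>W\<^esub> \<sigma> y"
        by (simp only: e \<sigma>_def W_def mult_DirProd mult_integer_mod_group qmult.simps mod_add_eq)
      finally show ?thesis .
    qed
  qed
  moreover have iter: "(\<sigma> ^^ i) w = qmult (z [^]\<^bsub>Q\<^esub> i) w" if "w \<in> carrier W" for i w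
  proof (induction i)
    case 0
    show ?case using qmult_one(1)[of w] that W by (simp add: Q_def)
  next
    case (Suc i)
    have "z [^]\<^bsub>Q\<^esub> Suc i = qmult z (z [^]\<^bsub>Q\<^esub> i)" using Q.nat_pow_Suc2[OF z(1), of i] by (simp add: Q_def)
    then show ?case using Suc by (simp add: \<sigma>_def qmult_assoc)
  qed
  have "(\<forall>w\<in>carrier W. (\<sigma> ^^ i) w = w) \<longleftrightarrow> l dvd i" for i
  proof
    have one_W: "(1, 0) \<in> carrier W" using p1 W by simp
    have zi: "z [^]\<^bsub>Q\<^esub> i \<in> {0..<int p} \<times> {0..<int p}" using Q.nat_pow_closed[OF z(1), of i] by (simp add: Q_def)
    assume "\<forall>w\<in>carrier W. (\<sigma> ^^ i) w = w"
    then have "z [^]\<^bsub>Q\<^esub> i = (1, 0)" using iter[OF one_W, of i] one_W qmult_one(2)[OF zi] by simp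
    then have "z [^]\<^bsub>Q\<^esub> i = \<one>\<^bsub>Q\<^esub>" by (simp add: Q_def)
    then show "l dvd i" using Q.pow_eq_id[OF z(1)] z(2) by blast
  next
    assume "l dvd i"
    then have "z [^]\<^bsub>Q\<^esub> i = (1, 0)" using Q.pow_eq_id[OF z(1), of i] z(2) by (simp add: Q_def)
    then show "\<forall>w\<in>carrier W. (\<sigma> ^^ i) w = w" using iter qmult_one(1) W by simp
  qed
  ultimately show ?thesis using that by blast
qed

text \<open>The cyclic group of order \<open>N\<close> acts through an automorphism of order
  \<open>l\<close>. For squarefree \<open>N\<close> the condition \<open>l dvd N div t\<close> fails
  only at \<open>t = l\<close>, so centrality reveals which prime acts.\<close>

lemma exists_elementary_extension:
  fixes p l N :: nat
  assumes p: "Factorial_Ring.prime p" "p \<noteq> 2" and l: "Factorial_Ring.prime l" "l dvd p\<^sup>2 - 1"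
    and N: "N > 0" "l dvd N"
  shows "\<exists>S :: ((int \<times> int) \<times> nat) monoid. group S \<and> finite (carrier S) \<and> order S = p\<^sup>2 * N \<and> \<not> commuting S \<and>
    (\<forall>t. Factorial_Ring.prime t \<longrightarrow> t dvd N \<longrightarrow> t \<noteq> p \<longrightarrow> (central_torsion S t \<longleftrightarrow> l dvd N div t))"
proof -
  let ?W = "integer_mod_group p \<times>\<times> integer_mod_group p"
  obtain \<sigma> where \<sigma>: "\<sigma> \<in> hom ?W ?W" "\<And>i. (\<forall>w\<in>carrier ?W. (\<sigma> ^^ i) w = w) \<longleftrightarrow> l dvd i"
    using exists_prime_order_automorphism[OF p l] by blast
  have p0: "p > 0" using prime_gt_0_nat[OF p(1)] .
  interpret W: group ?W by (rule DirProd_group) simp_all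
  have "comm_group ?W"
    by (rule W.group_comm_groupI) (auto simp: add.commute)
  then interpret semidirect_data ?W \<sigma> N
    using \<sigma> N p0 by (intro semidirect_data.intro semidirect_data_axioms.intro) (auto simp: finite_Zn)
  have "order ?W = p\<^sup>2" using p0 by (simp add: order_DirProd order_Zn power2_eq_square)
  moreover have "\<not> commuting (semidirect ?W \<sigma> N)"
    using \<sigma>(2)[of 1] l(1) commuting_S by auto
  moreover have "central_torsion (semidirect ?W \<sigma> N) t \<longleftrightarrow> l dvd N div t"
    if t: "Factorial_Ring.prime t" "t dvd N" "t \<noteq> p" for t
  proof -
    have "coprime t (order ?W)" using primes_coprime[OF t(1) p(1) t(3)] calculation(1) by simp
    then show ?thesis using central_torsion_S_complement[OF t(2) _ prime_gt_0_nat[OF t(1)]] \<sigma>(2) by simp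
  qed
  ultimately show ?thesis
    using group_S finite_S order_S by (intro exI[of _ "semidirect ?W \<sigma> N"]) simp
qed

context prime_square_order
begin

text \<open>For \<open>p = 2\<close> an odd prime \<open>l\<close> dividing \<open>N\<close> would
  receive an edge from 2. An odd \<open>p\<close> is what the quadratic nonresidue requires.\<close>

lemma odd_or_trivial:
  assumes l: "Factorial_Ring.prime l" "l dvd N"
  shows "p \<noteq> 2"
proof
  assume p2: "p = 2"
  have "l \<noteq> 2" using l(2) pN p2 by auto
  then have "odd l" using l(1) primes_dvd_imp_eq two_is_prime_nat by blast
  then have "2 dvd l - 1" by simp
  moreover have "coprime (p * N) (l - 1)" using no_edge[OF l(1)] l(2) by simp
  ultimately show False using p2 coprime_common_divisor_nat[of "p * N" "l - 1" 2] by simp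
qed

text \<open>All groups are abelian here, so the exponent alone decides between the two
  classes.\<close>

lemma num_groups_no_divisor:
  assumes none: "\<And>t. Factorial_Ring.prime t \<Longrightarrow> t dvd N \<Longrightarrow> \<not> t dvd p\<^sup>2 - 1"
  shows "num_groups (p\<^sup>2 * N) = 2"
proof -
  let ?\<phi> = "\<lambda>(c :: bool) e (z :: nat \<Rightarrow> bool). if e (p * N) then 1 else 0"
  have "num_groups (p\<^sup>2 * N) = card (invariant ?\<phi> ` groups_of_order (p\<^sup>2 * N))"
  proof (rule num_groups_eq_invariant_values)
    fix G H :: "nat monoid"
    assume G: "group G" "finite (carrier G)" "order G = p\<^sup>2 * N" and H: "group H" "finite (carrier H)" "order H = p\<^sup>2 * N"
      and eq: "invariant ?\<phi> G = invariant ?\<phi> H"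
    show "G \<cong> H"
      using eq elementary_commuting_iso[OF G _ commuting_if_no_divisor[OF none G] H _ commuting_if_no_divisor[OF none H]]
        cyclic_type_iso[OF G _ H] unfolding invariant_def by (auto split: if_splits)
  qed
  also have "invariant ?\<phi> ` groups_of_order (p\<^sup>2 * N) = {0, 1}"
  proof
    show "invariant ?\<phi> ` groups_of_order (p\<^sup>2 * N) \<subseteq> {0, 1}" by (auto simp: invariant_def)
    show "{0, 1} \<subseteq> invariant ?\<phi> ` groups_of_order (p\<^sup>2 * N)"
      using prime_square_abelian_values[OF p N_facts(1), of ?\<phi>] by simp
  qed
  finally show ?thesis by simp
qed

lemma num_groups_one_divisor:
  assumes l: "Factorial_Ring.prime l" "l dvd N" "l dvd p\<^sup>2 - 1"
    and uniq: "\<And>t. Factorial_Ring.prime t \<Longrightarrow> t dvd N \<Longrightarrow> t dvd p\<^sup>2 - 1 \<Longrightarrow> t = l"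
  shows "num_groups (p\<^sup>2 * N) = 3"
proof -
  let ?\<phi> = "\<lambda>(c :: bool) e (z :: nat \<Rightarrow> bool). if c then if e (p * N) then 1 else 0 else 2"
  have "num_groups (p\<^sup>2 * N) = card (invariant ?\<phi> ` groups_of_order (p\<^sup>2 * N))"
  proof (rule num_groups_eq_invariant_values)
    fix G H :: "nat monoid"
    assume G: "group G" "finite (carrier G)" "order G = p\<^sup>2 * N" and H: "group H" "finite (carrier H)" "order H = p\<^sup>2 * N"
      and eq: "invariant ?\<phi> G = invariant ?\<phi> H"
    show "G \<cong> H"
      using eq elementary_commuting_iso[OF G _ _ H] cyclic_type_iso[OF G _ H] noncommuting_iso[OF l(1,2) uniq G _ H]
      unfolding invariant_def by (auto split: if_splits)
  qed
  also have "invariant ?\<phi> ` groups_of_order (p\<^sup>2 * N) = {0, 1, 2}"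
  proof
    show "invariant ?\<phi> ` groups_of_order (p\<^sup>2 * N) \<subseteq> {0, 1, 2}" by (auto simp: invariant_def)
    obtain S :: "((int \<times> int) \<times> nat) monoid" where S: "group S" "finite (carrier S)" "order S = p\<^sup>2 * N" "\<not> commuting S"
      using exists_elementary_extension[OF p odd_or_trivial[OF l(1,2)] l(1,3) N_facts(1) l(2)] by blast
    have "2 \<in> invariant ?\<phi> ` groups_of_order (p\<^sup>2 * N)"
      by (rule invariant_value[OF S(1-3)]) (simp add: invariant_def S(4))
    then show "{0, 1, 2} \<subseteq> invariant ?\<phi> ` groups_of_order (p\<^sup>2 * N)"
      using prime_square_abelian_values[OF p N_facts(1), of ?\<phi>] by simp
  qed
  finally show ?thesis by simp
qed

text \<open>Each of the primes \<open>l\<close> and \<open>r\<close> can be the acting one; the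
  elements of order \<open>l\<close> are central if \<open>r\<close> acts, but not if
  \<open>l\<close> does.\<close>

lemma num_groups_two_divisors:
  assumes l: "Factorial_Ring.prime l" "l dvd N" "l dvd p\<^sup>2 - 1"
    and r: "Factorial_Ring.prime r" "r dvd N" "r dvd p\<^sup>2 - 1" and lr: "l \<noteq> r"
  shows "num_groups (p\<^sup>2 * N) \<noteq> 2 \<and> num_groups (p\<^sup>2 * N) \<noteq> 3"
proof -
  let ?\<phi> = "\<lambda>(c :: bool) e (z :: nat \<Rightarrow> bool). if c then if e (p * N) then 1 else 0 else if z l then 3 else 2"
  have lp: "l \<noteq> p" using l(2) pN by auto
  obtain c where c: "N = l * c" using l(2) by blast
  have l0: "l > 0" using prime_gt_0_nat[OF l(1)] .
  have nl: "\<not> l dvd N div l" using squarefreeD[OF sqf, of l] l(1) c l0 by (auto simp: power2_eq_square)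
  have "\<not> r dvd l" using primes_dvd_imp_eq l(1) r(1) lr by blast
  then have rl: "r dvd N div l" using r(1,2) c l0 by (auto simp: prime_dvd_mult_iff)
  obtain S :: "((int \<times> int) \<times> nat) monoid" where S: "group S" "finite (carrier S)" "order S = p\<^sup>2 * N" "\<not> commuting S"
    "central_torsion S l \<longleftrightarrow> l dvd N div l"
    using exists_elementary_extension[OF p odd_or_trivial[OF l(1,2)] l(1,3) N_facts(1) l(2)] l(1,2) lp by blast
  obtain R :: "((int \<times> int) \<times> nat) monoid" where R: "group R" "finite (carrier R)" "order R = p\<^sup>2 * N" "\<not> commuting R"
    "central_torsion R l \<longleftrightarrow> r dvd N div l"
    using exists_elementary_extension[OF p odd_or_trivial[OF l(1,2)] r(1,3) N_facts(1) r(2)] l(1,2) lp by blast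
  have "2 \<in> invariant ?\<phi> ` groups_of_order (p\<^sup>2 * N)"
    by (rule invariant_value[OF S(1-3)]) (simp add: invariant_def S(4) S(5) nl)
  moreover have "3 \<in> invariant ?\<phi> ` groups_of_order (p\<^sup>2 * N)"
    by (rule invariant_value[OF R(1-3)]) (simp add: invariant_def R(4) R(5) rl)
  ultimately show ?thesis
    using num_groups_not_2_3 prime_square_abelian_values[OF p N_facts(1), of ?\<phi>] by simp
qed

end

section \<open>Counts for squarefree orders\<close>

lemma coprime_if_no_prime_edge:
  fixes n t :: nat
  assumes "t > 1" "\<And>u. Factorial_Ring.prime u \<Longrightarrow> u dvd n \<Longrightarrow> \<not> u dvd t - 1"
  shows "coprime n (t - 1)"
proof (rule ccontr)
  assume "\<not> coprime n (t - 1)"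
  then have "gcd n (t - 1) \<noteq> 1" by (simp only: coprime_iff_gcd_eq_1 not_False_eq_True)
  then obtain u where "Factorial_Ring.prime u" "u dvd gcd n (t - 1)" using prime_factor_nat by blast
  then show False using assms(2)[of u] by auto
qed

lemma squarefree_normal_index:
  assumes "group G" "finite (carrier G)" "order G = n" and sqf: "squarefree n" and t: "Factorial_Ring.prime t" "t dvd n"
    and "\<And>u. Factorial_Ring.prime u \<Longrightarrow> u dvd n \<Longrightarrow> \<not> u dvd t - 1"
  shows "normal_index G t"
proof -
  obtain m where m: "n = t * m" using t(2) by blast
  have "\<not> t dvd m" using squarefreeD[OF sqf, of t] t(1) m by (auto simp: power2_eq_square)
  moreover have "coprime n (t - 1)" using coprime_if_no_prime_edge[OF prime_gt_1_nat[OF t(1)] assms(7)] by blast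
  ultimately show ?thesis using group.normal_index_coprime[OF assms(1,2) t(1), of m] m assms(3) by metis
qed

text \<open>Every prime splits off, so every group is abelian, hence cyclic, and there is at most
  one class.\<close>

lemma num_groups_squarefree_no_edge:
  assumes sqf: "squarefree n"
    and none: "\<And>u t. Factorial_Ring.prime u \<Longrightarrow> u dvd n \<Longrightarrow> Factorial_Ring.prime t \<Longrightarrow> t dvd n \<Longrightarrow> \<not> u dvd t - 1"
  shows "num_groups n \<noteq> 2 \<and> num_groups n \<noteq> 3"
proof -
  let ?\<phi> = "\<lambda>(c :: bool) (e :: nat \<Rightarrow> bool) (z :: nat \<Rightarrow> bool). 0"
  have comm: "commuting G" if G: "group G" "finite (carrier G)" "order G = n" for G :: "nat monoid"
  proof -
    interpret group G by fact
    have "normal_index G t" if "Factorial_Ring.prime t" "t dvd n" for t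
      by (rule squarefree_normal_index[OF G sqf that]) (use none that in blast)
    then obtain y where y: "splits G (torsion G 1) y" using split_structure[OF G(2), of 1 n] G(3) sqf by auto
    have "torsion G 1 = {\<one>\<^bsub>G\<^esub>}" unfolding torsion_def by auto
    then show ?thesis using y by (intro splits_commuting[OF G(2) y]) (auto simp: splits_def)
  qed
  have "num_groups n = card (invariant ?\<phi> ` groups_of_order n)"
    by (rule num_groups_eq_invariant_values) (use commuting_squarefree_iso comm sqf in blast)
  also have "\<dots> \<le> card {0::nat}" by (rule card_mono) (auto simp: invariant_def)
  finally show ?thesis by simp
qed

lemma num_groups_squarefree_one_edge:
  assumes sqf: "squarefree n" and q: "Factorial_Ring.prime q" "q dvd n" and p: "Factorial_Ring.prime p" "p dvd n" and qp: "q dvd p - 1"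
    and uniq: "\<And>u t. Factorial_Ring.prime u \<Longrightarrow> u dvd n \<Longrightarrow> Factorial_Ring.prime t \<Longrightarrow> t dvd n \<Longrightarrow> u dvd t - 1 \<Longrightarrow> u = q \<and> t = p"
  shows "num_groups n = 2"
proof -
  let ?\<phi> = "\<lambda>(c :: bool) (e :: nat \<Rightarrow> bool) (z :: nat \<Rightarrow> bool). if c then 0 else 1"
  have idx: "normal_index G t" if "group G" "finite (carrier G)" "order G = n" "Factorial_Ring.prime t" "t dvd n" "t \<noteq> p"
    for G :: "nat monoid" and t
    by (rule squarefree_normal_index[OF that(1-3) sqf that(4,5)]) (use uniq that in blast)
  have "num_groups n = card (invariant ?\<phi> ` groups_of_order n)"
  proof (rule num_groups_eq_invariant_values)
    fix G H :: "nat monoid"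
    assume G: "group G" "finite (carrier G)" "order G = n" and H: "group H" "finite (carrier H)" "order H = n"
      and eq: "invariant ?\<phi> G = invariant ?\<phi> H"
    show "G \<cong> H"
    proof (cases "commuting G")
      case True
      then show ?thesis using eq commuting_squarefree_iso[OF G _ H _ sqf] by (auto simp: invariant_def split: if_splits)
    next
      case False
      then have "\<not> commuting H" using eq by (auto simp: invariant_def split: if_splits)
      then show ?thesis
        using noncommuting_squarefree_iso[OF G False H _ sqf p q(1)] uniq p idx[OF G] idx[OF H] by blast
    qed
  qed
  also have "invariant ?\<phi> ` groups_of_order n = {0, 1}"
  proof
    show "invariant ?\<phi> ` groups_of_order n \<subseteq> {0, 1}" by (auto simp: invariant_def)
    obtain N where N: "n = p * N" using p(2) by blast
    have pos: "n > 0" "p > 0" "N > 0" using sqf N by (auto intro!: gr0I)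
    have "q \<noteq> p" using qp prime_gt_1_nat[OF p(1)] by (auto dest: dvd_imp_le)
    then have qN: "q dvd N" using q p(1) N primes_dvd_imp_eq by (auto simp: prime_dvd_mult_iff)
    obtain k where k: "[k ^ q = 1] (mod p)" "[k \<noteq> 1] (mod p)" using exists_prime_order_residue[OF q(1) p(1) qp] by blast
    have kN: "[k ^ N = 1] (mod p)" using k(1) qN by (meson dvd_trans ord_divides)
    interpret M: metacyclic_data p N k by unfold_locales (use pos kN in auto)
    have "1 \<in> invariant ?\<phi> ` groups_of_order n"
      using squarefree_metacyclic_value[OF N sqf kN, of ?\<phi>] k(2) by (simp add: invariant_def M.commuting_M)
    moreover have "0 \<in> invariant ?\<phi> ` groups_of_order n"
      using Zn_value[OF pos(1), of ?\<phi>] by (simp add: invariant_def commuting_Zn)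
    ultimately show "{0, 1} \<subseteq> invariant ?\<phi> ` groups_of_order n" by blast
  qed
  finally show ?thesis by simp
qed

text \<open>The two edges cannot both act in one group: if \<open>p\<close> acts on the Sylow
  subgroup of \<open>s\<close>, the centralizer is normal of index \<open>p\<close>, and
  \<open>q\<close> does not act on \<open>p\<close>. This leaves the cyclic group, one group with
  only \<open>q -> p\<close> active and one with only \<open>p -> s\<close> active, told apart by
  centrality at \<open>s\<close>.\<close>

lemma num_groups_squarefree_path:
  assumes sqf: "squarefree n" and q: "Factorial_Ring.prime q" "q dvd n" and p: "Factorial_Ring.prime p" "p dvd n"
    and s: "Factorial_Ring.prime s" "s dvd n" and qp: "q dvd p - 1" and ps: "p dvd s - 1"
    and uniq: "\<And>u t. Factorial_Ring.prime u \<Longrightarrow> u dvd n \<Longrightarrow> Factorial_Ring.prime t \<Longrightarrow> t dvd n \<Longrightarrow> u dvd t - 1 \<Longrightarrow>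
      (u = q \<and> t = p) \<or> (u = p \<and> t = s)"
  shows "num_groups n = 3"
proof -
  let ?\<phi> = "\<lambda>(c :: bool) (e :: nat \<Rightarrow> bool) z. if c then 0 else if z s then 1 else 2"
  have p1: "p > 1" "s > 1" using prime_gt_1_nat p(1) s(1) by auto
  have ne: "q \<noteq> p" "p \<noteq> s" using qp ps p1 by (auto dest: dvd_imp_le)
  have "q \<le> p - 1" "p \<le> s - 1" using qp ps p1 by (auto intro!: dvd_imp_le)
  then have qs: "q \<noteq> s" using p1 by linarith
  have other: "coprime n (t - 1)" if "Factorial_Ring.prime t" "t dvd n" "t \<noteq> p" "t \<noteq> s" for t
    by (rule coprime_if_no_prime_edge[OF prime_gt_1_nat[OF that(1)]]) (use uniq that in blast)
  have uniq_p: "t = q" if "Factorial_Ring.prime t" "t dvd n" "t dvd p - 1" for t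
    using uniq[OF that(1,2) p that(3)] ne by blast
  have uniq_s: "t = p" if "Factorial_Ring.prime t" "t dvd n" "t dvd s - 1" for t
    using uniq[OF that(1,2) s that(3)] ne by blast
  have "num_groups n = card (invariant ?\<phi> ` groups_of_order n)"
  proof (rule num_groups_eq_invariant_values)
    fix G H :: "nat monoid"
    assume G: "group G" "finite (carrier G)" "order G = n" and H: "group H" "finite (carrier H)" "order H = n"
      and eq: "invariant ?\<phi> G = invariant ?\<phi> H"
    show "G \<cong> H"
    proof (cases "commuting G")
      case True
      then show ?thesis using eq commuting_squarefree_iso[OF G _ H _ sqf] by (auto simp: invariant_def split: if_splits)
    next
      case nG: False
      then have nH: "\<not> commuting H" and z: "central_torsion G s = central_torsion H s"
        using eq by (auto simp: invariant_def split: if_splits)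
      show ?thesis
      proof (cases "central_torsion G s")
        case True
        then have zH: "central_torsion H s" using z by simp
        show ?thesis
          by (rule noncommuting_squarefree_iso[OF G nG H nH sqf p q(1) uniq_p
                group.path_central_index[OF G sqf s other True] group.path_central_index[OF H sqf s other zH]])
      next
        case False
        then have zH: "\<not> central_torsion H s" using z by simp
        show ?thesis
          by (rule noncommuting_squarefree_iso[OF G nG H nH sqf s p(1) uniq_s
                group.path_noncentral_index[OF G sqf p s ps uniq_s other False]
                group.path_noncentral_index[OF H sqf p s ps uniq_s other zH]])
      qed
    qed
  qed
  also have "invariant ?\<phi> ` groups_of_order n = {0, 1, 2}"
  proof
    show "invariant ?\<phi> ` groups_of_order n \<subseteq> {0, 1, 2}" by (auto simp: invariant_def)
    obtain N where N: "n = p * N" using p(2) by blast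
    obtain M where M: "n = s * M" using s(2) by blast
    have pos: "n > 0" "p > 0" "N > 0" "s > 0" "M > 0" using sqf N M by (auto intro!: gr0I)
    have qN: "q dvd N" using q p(1) N ne primes_dvd_imp_eq by (auto simp: prime_dvd_mult_iff)
    have sN: "s dvd N" using s p(1) N ne primes_dvd_imp_eq by (auto simp: prime_dvd_mult_iff)
    have pM: "p dvd M" using p s(1) M ne primes_dvd_imp_eq by (auto simp: prime_dvd_mult_iff)
    obtain k where k: "[k ^ q = 1] (mod p)" "[k \<noteq> 1] (mod p)" using exists_prime_order_residue[OF q(1) p(1) qp] by blast
    obtain j where j: "[j ^ p = 1] (mod s)" "[j \<noteq> 1] (mod s)" using exists_prime_order_residue[OF p(1) s(1) ps] by blast
    have kN: "[k ^ N = 1] (mod p)" using k(1) qN by (meson dvd_trans ord_divides)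
    have jM: "[j ^ M = 1] (mod s)" using j(1) pM by (meson dvd_trans ord_divides)
    interpret A: metacyclic_data p N k by unfold_locales (use pos kN in auto)
    interpret B: metacyclic_data s M j by unfold_locales (use pos jM in auto)
    obtain c where c: "N = s * c" using sN by blast
    have "\<not> q dvd s" using qs primes_dvd_imp_eq q(1) s(1) by blast
    then have "q dvd N div s" using qN c q(1) pos by (auto simp: prime_dvd_mult_iff)
    then have "[k ^ (N div s) = 1] (mod p)" using k(1) by (meson dvd_trans ord_divides)
    moreover have "coprime s p" using primes_coprime[OF s(1) p(1)] ne by simp
    ultimately have zA: "central_torsion (metacyclic p N k) s" using A.central_M_complement[OF sN _ pos(4)] by blast
    have "\<not> s dvd M" using squarefreeD[OF sqf, of s] s(1) M by (auto simp: power2_eq_square)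
    then have "coprime s M" by (rule prime_imp_coprime[OF s(1)])
    then have zB: "\<not> central_torsion (metacyclic s M j) s" using B.central_M_kernel[of s] j(2) by simp
    have "1 \<in> invariant ?\<phi> ` groups_of_order n"
      using squarefree_metacyclic_value[OF N sqf kN, of ?\<phi>] k(2) zA by (simp add: invariant_def A.commuting_M)
    moreover have "2 \<in> invariant ?\<phi> ` groups_of_order n"
      using squarefree_metacyclic_value[OF M sqf jM, of ?\<phi>] j(2) zB by (simp add: invariant_def B.commuting_M)
    moreover have "0 \<in> invariant ?\<phi> ` groups_of_order n"
      using Zn_value[OF pos(1), of ?\<phi>] by (simp add: invariant_def commuting_Zn)
    ultimately show "{0, 1, 2} \<subseteq> invariant ?\<phi> ` groups_of_order n" by blast
  qed
  finally show ?thesis by simp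
qed

subsection \<open>Classification of the orders\<close>

definition prime_edge :: "nat \<Rightarrow> nat \<Rightarrow> nat \<Rightarrow> bool" where
  "prime_edge n u t \<longleftrightarrow> Factorial_Ring.prime u \<and> u dvd n \<and> Factorial_Ring.prime t \<and> t dvd n \<and> u dvd t - 1"

definition square_type :: "nat \<Rightarrow> nat \<Rightarrow> nat \<Rightarrow> bool" where
  "square_type n p N \<longleftrightarrow> Factorial_Ring.prime p \<and> n = p\<^sup>2 * N \<and> squarefree N \<and> \<not> p dvd N"

text \<open>Consequently there are no loops, and the three vertices of a path are distinct.\<close>

lemma prime_edge_less: "prime_edge n u t \<Longrightarrow> u < t"
proof -
  assume e: "prime_edge n u t"
  then have t: "Factorial_Ring.prime t" "u dvd t - 1" unfolding prime_edge_def by blast+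
  have "t > 1" using t(1) by (rule prime_gt_1_nat)
  then show "u < t" using dvd_imp_le[OF t(2)] by simp
qed

lemma prime_edge_two_targets:
  assumes "squarefree n" "prime_edge n q p" "prime_edge n s r" "p \<noteq> r" "q \<noteq> r" "s \<noteq> p"
  shows "num_groups n \<noteq> 2 \<and> num_groups n \<noteq> 3"
  using num_groups_two_targets[of n p r q s] assms unfolding prime_edge_def by blast

lemma prime_edge_common_target:
  assumes "squarefree n" "prime_edge n p r" "prime_edge n q r" "p \<noteq> q"
  shows "num_groups n \<noteq> 2 \<and> num_groups n \<noteq> 3"
  using num_groups_common_target[of n r p q] assms unfolding prime_edge_def by blast

text \<open>A further edge would share its target with an edge of the path or form a pair of
  independent targets with one of them; both are excluded. The pair is formed with
  \<open>b -> c\<close>, except when the new edge starts in \<open>c\<close>, where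
  \<open>a -> b\<close> serves.\<close>

lemma squarefree_path_edges:
  assumes sqf: "squarefree n" and num: "num_groups n = 2 \<or> num_groups n = 3"
    and ab: "prime_edge n a b" and bc: "prime_edge n b c" and ut: "prime_edge n u t"
  shows "(u, t) \<in> {(a, b), (b, c)}"
proof (rule ccontr)
  assume not: "(u, t) \<notin> {(a, b), (b, c)}"
  have lt: "a < b" "b < c" "u < t" using ab bc ut prime_edge_less by blast+
  consider "t = b" | "t = c" | "t \<noteq> b" "t \<noteq> c" "u \<noteq> c" | "t \<noteq> b" "t \<noteq> c" "u = c" by blast
  then show False
  proof cases
    case 1
    then show ?thesis using prime_edge_common_target[OF sqf ab, of u] ut not num by auto
  next
    case 2
    then show ?thesis using prime_edge_common_target[OF sqf bc, of u] ut not num by auto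
  next
    case 3
    then show ?thesis using prime_edge_two_targets[OF sqf bc ut] num by auto
  next
    case 4
    then show ?thesis using prime_edge_two_targets[OF sqf ab ut] lt num by auto
  qed
qed

lemma prime_square_orderI:
  assumes "square_type n p N" and "\<And>u t. \<not> prime_edge n u t"
  shows "prime_square_order p N"
proof
  have st: "Factorial_Ring.prime p" "n = p\<^sup>2 * N" "squarefree N" "\<not> p dvd N"
    using assms(1) unfolding square_type_def by auto
  then show "Factorial_Ring.prime p" "squarefree N" "\<not> p dvd N" by auto
  fix t assume t: "Factorial_Ring.prime t" "t dvd p * N"
  have pn: "p * N dvd n" using st(2) by (simp add: power2_eq_square)
  show "coprime (p * N) (t - 1)"
    by (rule coprime_if_no_prime_edge[OF prime_gt_1_nat[OF t(1)]])
      (use assms(2) t pn in \<open>auto simp: prime_edge_def dest: dvd_trans\<close>)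
qed

lemma num_groups_2_if_one_edge:
  assumes "squarefree n" "prime_edge n q p" "\<And>u t. prime_edge n u t \<Longrightarrow> u = q \<and> t = p"
  shows "num_groups n = 2"
  using num_groups_squarefree_one_edge[of n q p] assms unfolding prime_edge_def by blast

lemma num_groups_3_if_path:
  assumes "squarefree n" "prime_edge n q p" "prime_edge n p s"
    "\<And>u t. prime_edge n u t \<Longrightarrow> (u, t) \<in> {(q, p), (p, s)}"
  shows "num_groups n = 3"
  using num_groups_squarefree_path[of n q p s] assms unfolding prime_edge_def by blast

lemma num_groups_2_if_square:
  assumes "square_type n p N" "\<And>u t. \<not> prime_edge n u t"
    "\<And>l. Factorial_Ring.prime l \<Longrightarrow> l dvd N \<Longrightarrow> \<not> l dvd p\<^sup>2 - 1"
  shows "num_groups n = 2"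
  using prime_square_order.num_groups_no_divisor[OF prime_square_orderI[OF assms(1,2)] assms(3)] assms(1)
  unfolding square_type_def by simp

lemma num_groups_3_if_square:
  assumes "square_type n p N" "\<And>u t. \<not> prime_edge n u t"
    "\<exists>!l. Factorial_Ring.prime l \<and> l dvd N \<and> l dvd p\<^sup>2 - 1"
  shows "num_groups n = 3"
proof -
  obtain l where l: "Factorial_Ring.prime l" "l dvd N" "l dvd p\<^sup>2 - 1"
    "\<And>t. Factorial_Ring.prime t \<Longrightarrow> t dvd N \<Longrightarrow> t dvd p\<^sup>2 - 1 \<Longrightarrow> t = l"
    using assms(3) by blast
  show ?thesis
    using prime_square_order.num_groups_one_divisor[OF prime_square_orderI[OF assms(1,2)] l] assms(1)
    unfolding square_type_def by simp
qed

text \<open>Two edges that are neither independent nor share a target must form a path, and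
  \<open>squarefree_path_edges\<close> leaves no room for a third one.\<close>

lemma squarefree_num_groups_cases:
  assumes sqf: "squarefree n" and num: "num_groups n = 2 \<or> num_groups n = 3"
  shows "(\<exists>q p. prime_edge n q p \<and> (\<forall>u t. prime_edge n u t \<longrightarrow> u = q \<and> t = p)) \<or>
    (\<exists>q p s. prime_edge n q p \<and> prime_edge n p s \<and> (\<forall>u t. prime_edge n u t \<longrightarrow> (u, t) \<in> {(q, p), (p, s)}))"
proof -
  have "\<exists>q p. prime_edge n q p"
    using num_groups_squarefree_no_edge[OF sqf] num unfolding prime_edge_def by blast
  then obtain q p where qp: "prime_edge n q p" by blast
  show ?thesis
  proof (cases "\<forall>u t. prime_edge n u t \<longrightarrow> u = q \<and> t = p")
    case False
    then obtain s r where sr: "prime_edge n s r" "(s, r) \<noteq> (q, p)" by blast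
    have "p \<noteq> r" using prime_edge_common_target[OF sqf qp, of s] sr num by auto
    then have "q = r \<or> s = p" using prime_edge_two_targets[OF sqf qp sr(1)] num by auto
    then show ?thesis
      using squarefree_path_edges[OF sqf num] qp sr(1) by blast
  qed (use qp in blast)
qed

text \<open>The remainder after excluding a cube, a second square, an edge anywhere, and two primes
  of \<open>N\<close> dividing \<open>p\<^sup>2 - 1\<close>. The edges are split according to
  whether they end in \<open>p\<close>.\<close>

lemma nonsquarefree_num_groups_cases:
  assumes n: "n > 0" "\<not> squarefree n" and num: "num_groups n = 2 \<or> num_groups n = 3"
  shows "\<exists>p N. square_type n p N \<and> (\<forall>u t. \<not> prime_edge n u t) \<and>
    ((\<forall>l. Factorial_Ring.prime l \<longrightarrow> l dvd N \<longrightarrow> \<not> l dvd p\<^sup>2 - 1) \<or>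
     (\<exists>!l. Factorial_Ring.prime l \<and> l dvd N \<and> l dvd p\<^sup>2 - 1))"
proof -
  obtain p where p: "Factorial_Ring.prime p" "p\<^sup>2 dvd n"
    using n squarefree_factorial_semiring[of n] by auto
  obtain N where N: "n = p\<^sup>2 * N" using p(2) by blast
  have N0: "N > 0" using n(1) N by (auto intro!: gr0I)
  have pN: "\<not> p dvd N"
  proof
    assume "p dvd N"
    then have "p ^ 3 dvd n" using N by (simp add: power3_eq_cube power2_eq_square)
    then show False using num_groups_cube[OF p(1) n(1)] num by auto
  qed
  have "\<not> t\<^sup>2 dvd N" if t: "Factorial_Ring.prime t" for t
  proof
    assume tN: "t\<^sup>2 dvd N"
    then have "t \<noteq> p" using pN by (metis dvd_mult_left power2_eq_square)
    moreover have "t\<^sup>2 dvd n" using tN N by simp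
    ultimately show False using num_groups_two_squares[OF p(1) t _ n(1) p(2)] num by auto
  qed
  then have "squarefree N" using squarefree_factorial_semiring[of N] N0 by simp
  then have st: "square_type n p N" using p(1) N pN unfolding square_type_def by blast
  have ne: "\<not> prime_edge n u t" for u t
  proof
    assume e: "prime_edge n u t"
    then have ut: "Factorial_Ring.prime u" "u dvd p\<^sup>2 * N" "Factorial_Ring.prime t" "t dvd p\<^sup>2 * N" "u dvd t - 1" "u < t"
      using prime_edge_less[OF e] unfolding prime_edge_def N by auto
    show False
    proof (cases "t = p")
      case True
      then have "u dvd N" using ut p(1) primes_dvd_imp_eq by (auto simp: prime_dvd_mult_iff prime_dvd_power_iff)
      then show ?thesis using num_groups_square_edge_into[OF p(1) ut(1) N0 pN] ut(5) True num N by auto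
    next
      case False
      then have "t dvd N" using ut p(1) primes_dvd_imp_eq by (auto simp: prime_dvd_mult_iff prime_dvd_power_iff)
      then show ?thesis using num_groups_square_edge_off[OF p(1) ut(3,1) N0 _ _ ut(2,5)] False num N by auto
    qed
  qed
  have "l = r" if "Factorial_Ring.prime l" "l dvd N" "l dvd p\<^sup>2 - 1" "Factorial_Ring.prime r" "r dvd N" "r dvd p\<^sup>2 - 1" for l r
    using prime_square_order.num_groups_two_divisors[OF prime_square_orderI[OF st ne] that] num N by blast
  then show ?thesis using st ne by blast
qed

lemma num_groups_eq_2_iff:
  assumes "n > 0"
  shows "num_groups n = 2 \<longleftrightarrow>
    squarefree n \<and> (\<exists>q p. prime_edge n q p \<and> (\<forall>u t. prime_edge n u t \<longrightarrow> u = q \<and> t = p)) \<or>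
    (\<exists>p N. square_type n p N \<and> (\<forall>u t. \<not> prime_edge n u t) \<and>
      (\<forall>l. Factorial_Ring.prime l \<longrightarrow> l dvd N \<longrightarrow> \<not> l dvd p\<^sup>2 - 1))"
    (is "?L \<longleftrightarrow> ?R")
proof
  assume L: ?L
  show ?R
  proof (cases "squarefree n")
    case True
    then show ?thesis using squarefree_num_groups_cases[OF True] L num_groups_3_if_path[OF True]
      by (metis numeral_eq_iff semiring_norm(89))
  next
    case False
    obtain p N where pN: "square_type n p N" "\<And>u t. \<not> prime_edge n u t" and
      dis: "(\<forall>l. Factorial_Ring.prime l \<longrightarrow> l dvd N \<longrightarrow> \<not> l dvd p\<^sup>2 - 1) \<or>
       (\<exists>!l. Factorial_Ring.prime l \<and> l dvd N \<and> l dvd p\<^sup>2 - 1)"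
      using nonsquarefree_num_groups_cases[OF assms False] L by blast
    from dis have "\<forall>l. Factorial_Ring.prime l \<longrightarrow> l dvd N \<longrightarrow> \<not> l dvd p\<^sup>2 - 1"
      using num_groups_3_if_square[OF pN] L by (elim disjE) simp_all
    then show ?thesis using pN by blast
  qed
next
  assume ?R
  then show ?L using num_groups_2_if_one_edge num_groups_2_if_square by blast
qed

lemma num_groups_eq_3_iff:
  assumes "n > 0"
  shows "num_groups n = 3 \<longleftrightarrow>
    squarefree n \<and> (\<exists>q p s. prime_edge n q p \<and> prime_edge n p s \<and>
      (\<forall>u t. prime_edge n u t \<longrightarrow> (u, t) \<in> {(q, p), (p, s)})) \<or>
    (\<exists>p N. square_type n p N \<and> (\<forall>u t. \<not> prime_edge n u t) \<and>
      (\<exists>!l. Factorial_Ring.prime l \<and> l dvd N \<and> l dvd p\<^sup>2 - 1))"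
    (is "?L \<longleftrightarrow> ?R")
proof
  assume L: ?L
  show ?R
  proof (cases "squarefree n")
    case True
    then show ?thesis using squarefree_num_groups_cases[OF True] L num_groups_2_if_one_edge[OF True]
      by (metis numeral_eq_iff semiring_norm(89))
  next
    case False
    obtain p N where pN: "square_type n p N" "\<And>u t. \<not> prime_edge n u t" and
      dis: "(\<forall>l. Factorial_Ring.prime l \<longrightarrow> l dvd N \<longrightarrow> \<not> l dvd p\<^sup>2 - 1) \<or>
       (\<exists>!l. Factorial_Ring.prime l \<and> l dvd N \<and> l dvd p\<^sup>2 - 1)"
      using nonsquarefree_num_groups_cases[OF assms False] L by blast
    from dis have "\<exists>!l. Factorial_Ring.prime l \<and> l dvd N \<and> l dvd p\<^sup>2 - 1"
    proof
      assume "\<forall>l. Factorial_Ring.prime l \<longrightarrow> l dvd N \<longrightarrow> \<not> l dvd p\<^sup>2 - 1"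
      then have "num_groups n = 2" using num_groups_2_if_square[OF pN] by blast
      then show ?thesis using L by simp
    qed
    then show ?thesis using pN by blast
  qed
next
  assume ?R
  then show ?L using num_groups_3_if_path num_groups_3_if_square by blast
qed

section \<open>Translation to the indexed prime factorization\<close>

locale prime_factorization_data =
  fixes n r :: nat and p \<alpha> :: "nat \<Rightarrow> nat"
  assumes n_pos: "n > 0"
    and prime_p: "\<And>i. i \<in> {1..r} \<Longrightarrow> Factorial_Ring.prime (p i)"
    and inj_p: "inj_on p {1..r}"
    and exponent_pos: "\<And>i. i \<in> {1..r} \<Longrightarrow> \<alpha> i \<ge> 1"
    and n_eq: "n = (\<Prod>i=1..r. p i ^ \<alpha> i)"
begin

lemma prime_dvd_n_iff: "Factorial_Ring.prime t \<and> t dvd n \<longleftrightarrow> (\<exists>i\<in>{1..r}. t = p i)"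
proof
  assume t: "Factorial_Ring.prime t \<and> t dvd n"
  then obtain i where i: "i \<in> {1..r}" "t dvd p i ^ \<alpha> i" unfolding n_eq by (auto simp: prime_dvd_prod_iff)
  then have "t dvd p i" using t prime_dvd_power by blast
  then show "\<exists>i\<in>{1..r}. t = p i" using i(1) t prime_p primes_dvd_imp_eq by blast
next
  assume "\<exists>i\<in>{1..r}. t = p i"
  then obtain i where i: "i \<in> {1..r}" "t = p i" by blast
  have "p i dvd p i ^ \<alpha> i" using exponent_pos[OF i(1)] by (intro dvd_power) auto
  also have "p i ^ \<alpha> i dvd n" unfolding n_eq using i(1) by (intro dvd_prodI) auto
  finally show "Factorial_Ring.prime t \<and> t dvd n" using i prime_p by simp
qed

lemma prime_edge_iff: "prime_edge n u t \<longleftrightarrow> (\<exists>i\<in>{1..r}. \<exists>j\<in>{1..r}. u = p i \<and> t = p j \<and> p i dvd p j - 1)"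
proof -
  have "prime_edge n u t \<longleftrightarrow> (Factorial_Ring.prime u \<and> u dvd n) \<and> (Factorial_Ring.prime t \<and> t dvd n) \<and> u dvd t - 1"
    unfolding prime_edge_def by blast
  also have "\<dots> \<longleftrightarrow> (\<exists>i\<in>{1..r}. u = p i) \<and> (\<exists>j\<in>{1..r}. t = p j) \<and> u dvd t - 1"
    unfolding prime_dvd_n_iff ..
  also have "\<dots> \<longleftrightarrow> (\<exists>i\<in>{1..r}. \<exists>j\<in>{1..r}. u = p i \<and> t = p j \<and> p i dvd p j - 1)" by blast
  finally show ?thesis .
qed

lemma prime_edge_index: "i \<in> {1..r} \<Longrightarrow> j \<in> {1..r} \<Longrightarrow> prime_edge n (p i) (p j) \<longleftrightarrow> p i dvd p j - 1"
  unfolding prime_edge_iff using inj_p by (auto dest: inj_onD)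

lemma p_eq_iff: "i \<in> {1..r} \<Longrightarrow> j \<in> {1..r} \<Longrightarrow> p i = p j \<longleftrightarrow> i = j"
  using inj_p by (auto dest: inj_onD)

text \<open>Edges between primes correspond to pairs of indices by injectivity of \<open>p\<close>;
  \<open>r \<ge> 2\<close> comes from the two distinct ends of an edge.\<close>

lemma one_edge_iff:
  "(r \<ge> 2 \<and> (\<exists>!(i, j) \<in> {1..r} \<times> {1..r}. p i dvd p j - 1)) \<longleftrightarrow>
   (\<exists>q t. prime_edge n q t \<and> (\<forall>u s. prime_edge n u s \<longrightarrow> u = q \<and> s = t))" (is "?L \<longleftrightarrow> ?R")
proof
  assume ?L
  then obtain x where x: "case x of (i, j) \<Rightarrow> (i, j) \<in> {1..r} \<times> {1..r} \<and> p i dvd p j - 1"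
    "\<forall>y. (case y of (i, j) \<Rightarrow> (i, j) \<in> {1..r} \<times> {1..r} \<and> p i dvd p j - 1) \<longrightarrow> y = x"
    by (auto simp only: Ex1_def)
  obtain i j where e: "x = (i, j)" by (cases x)
  have ij: "i \<in> {1..r}" "j \<in> {1..r}" "p i dvd p j - 1" using x(1) unfolding e by simp_all
  have uniq: "a = i \<and> b = j" if "a \<in> {1..r}" "b \<in> {1..r}" "p a dvd p b - 1" for a b
    using x(2)[THEN spec, of "(a, b)"] that unfolding e by simp
  have "prime_edge n (p i) (p j)" using ij prime_edge_index by blast
  moreover have "u = p i \<and> s = p j" if "prime_edge n u s" for u s
    using that uniq unfolding prime_edge_iff by blast
  ultimately show ?R by blast
next
  assume ?R
  then obtain i j where ij: "i \<in> {1..r}" "j \<in> {1..r}" "prime_edge n (p i) (p j)"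
    "\<And>u s. prime_edge n u s \<Longrightarrow> u = p i \<and> s = p j" using prime_edge_iff by metis
  have "p i < p j" using prime_edge_less[OF ij(3)] .
  then have "i \<noteq> j" by auto
  then have "r \<ge> 2" using ij(1,2) by auto
  moreover have "\<exists>!(i, j) \<in> {1..r} \<times> {1..r}. p i dvd p j - 1"
  proof (rule ex1I[of _ "(i, j)"])
    show "case (i, j) of (i, j) \<Rightarrow> (i, j) \<in> {1..r} \<times> {1..r} \<and> p i dvd p j - 1"
      using ij(1-3) prime_edge_index by simp
    fix x assume "case x of (a, b) \<Rightarrow> (a, b) \<in> {1..r} \<times> {1..r} \<and> p a dvd p b - 1"
    then obtain a b where x: "x = (a, b)" "a \<in> {1..r}" "b \<in> {1..r}" "p a dvd p b - 1" by (cases x) auto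
    then have "p a = p i \<and> p b = p j" using ij(4) prime_edge_index by blast
    then show "x = (i, j)" using x ij(1,2) p_eq_iff by blast
  qed
  ultimately show ?L by blast
qed

text \<open>The clause over \<open>a\<close> and \<open>b\<close> says that the triple accounts for
  all divisibilities. Uniqueness of the triple follows because \<open>p i < p j < p l\<close> fixes
  the order of the two edges; \<open>r \<ge> 3\<close> comes from three distinct primes.\<close>

lemma path_iff:
  "(r \<ge> 3 \<and> (\<exists>!(i, j, l) \<in> {1..r} \<times> {1..r} \<times> {1..r}.
      p i dvd p j - 1 \<and> p j dvd p l - 1 \<and>
      (\<forall>a\<in>{1..r}. \<forall>b\<in>{1..r}. p a dvd p b - 1 \<longrightarrow> (a, b) \<in> {(i, j), (j, l)}))) \<longleftrightarrow>
   (\<exists>q t s. prime_edge n q t \<and> prime_edge n t s \<and> (\<forall>u v. prime_edge n u v \<longrightarrow> (u, v) \<in> {(q, t), (t, s)}))"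
  (is "?L \<longleftrightarrow> ?R")
proof
  assume ?L
  then obtain x where x: "case x of (i, j, l) \<Rightarrow> (i, j, l) \<in> {1..r} \<times> {1..r} \<times> {1..r} \<and>
      p i dvd p j - 1 \<and> p j dvd p l - 1 \<and>
      (\<forall>a\<in>{1..r}. \<forall>b\<in>{1..r}. p a dvd p b - 1 \<longrightarrow> (a, b) \<in> {(i, j), (j, l)})"
    by (elim conjE ex1E)
  obtain i j l where e: "x = (i, j, l)" by (cases x)
  have ijl: "i \<in> {1..r}" "j \<in> {1..r}" "l \<in> {1..r}" "p i dvd p j - 1" "p j dvd p l - 1"
    "\<And>a b. a \<in> {1..r} \<Longrightarrow> b \<in> {1..r} \<Longrightarrow> p a dvd p b - 1 \<Longrightarrow> (a, b) \<in> {(i, j), (j, l)}"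
    using x unfolding e by simp_all
  then have "prime_edge n (p i) (p j)" "prime_edge n (p j) (p l)" using prime_edge_index by blast+
  moreover have "(u, v) \<in> {(p i, p j), (p j, p l)}" if "prime_edge n u v" for u v
    using that ijl(6) unfolding prime_edge_iff by blast
  ultimately show ?R by blast
next
  assume ?R
  then obtain q t s where qts: "prime_edge n q t" "prime_edge n t s"
    "\<And>u v. prime_edge n u v \<Longrightarrow> (u, v) \<in> {(q, t), (t, s)}" by blast
  obtain i j where ij: "i \<in> {1..r}" "j \<in> {1..r}" "q = p i" "t = p j" using qts(1) prime_edge_iff by blast
  obtain l where l: "l \<in> {1..r}" "s = p l" using qts(2) prime_edge_iff by blast
  have lt: "p i < p j" "p j < p l" using prime_edge_less qts(1,2) ij l by auto
  then have "card {i, j, l} = 3" by (auto simp: card_insert_if)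
  moreover have "card {i, j, l} \<le> card {1..r}" using ij l by (intro card_mono) auto
  ultimately have "r \<ge> 3" by simp
  have all: "(a, b) \<in> {(i, j), (j, l)}" if "a \<in> {1..r}" "b \<in> {1..r}" "p a dvd p b - 1" for a b
  proof -
    have "(p a, p b) \<in> {(p i, p j), (p j, p l)}" using qts(3) prime_edge_index that ij l by blast
    then show ?thesis using p_eq_iff that(1,2) ij(1,2) l(1) by blast
  qed
  have dvd: "p i dvd p j - 1" "p j dvd p l - 1" using qts(1,2) ij l prime_edge_index by auto
  have "\<exists>!(i, j, l) \<in> {1..r} \<times> {1..r} \<times> {1..r}.
      p i dvd p j - 1 \<and> p j dvd p l - 1 \<and>
      (\<forall>a\<in>{1..r}. \<forall>b\<in>{1..r}. p a dvd p b - 1 \<longrightarrow> (a, b) \<in> {(i, j), (j, l)})"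
  proof (rule ex1I[of _ "(i, j, l)"])
    show "case (i, j, l) of (i, j, l) \<Rightarrow> (i, j, l) \<in> {1..r} \<times> {1..r} \<times> {1..r} \<and>
      p i dvd p j - 1 \<and> p j dvd p l - 1 \<and>
      (\<forall>a\<in>{1..r}. \<forall>b\<in>{1..r}. p a dvd p b - 1 \<longrightarrow> (a, b) \<in> {(i, j), (j, l)})"
      using ij(1,2) l(1) dvd all by simp
    fix x assume "case x of (i, j, l) \<Rightarrow> (i, j, l) \<in> {1..r} \<times> {1..r} \<times> {1..r} \<and>
      p i dvd p j - 1 \<and> p j dvd p l - 1 \<and>
      (\<forall>a\<in>{1..r}. \<forall>b\<in>{1..r}. p a dvd p b - 1 \<longrightarrow> (a, b) \<in> {(i, j), (j, l)})"
    then obtain a b c where x: "x = (a, b, c)" "a \<in> {1..r}" "b \<in> {1..r}" "c \<in> {1..r}" "p a dvd p b - 1" "p b dvd p c - 1"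
      by (cases x) auto
    have "(a, b) \<in> {(i, j), (j, l)}" "(b, c) \<in> {(i, j), (j, l)}" using all x by blast+
    then show "x = (i, j, l)" using x(1) lt by auto
  qed
  then show ?L using \<open>r \<ge> 3\<close> by blast
qed

text \<open>Comparing powers of \<open>P\<close> in the two factorizations gives exponent 2 at its
  index, and squarefreeness of \<open>N\<close> gives exponent 1 elsewhere.\<close>

lemma square_type_permutation:
  assumes st: "square_type n P N"
  obtains \<sigma> where "bij_betw \<sigma> {1..r} {1..r}" "r \<ge> 1" "p (\<sigma> 1) = P" "N = (\<Prod>k=2..r. p (\<sigma> k))"
proof -
  have P: "Factorial_Ring.prime P" "n = P\<^sup>2 * N" "squarefree N" "\<not> P dvd N" using st unfolding square_type_def by auto
  then obtain i where i: "i \<in> {1..r}" "P = p i" using prime_dvd_n_iff[of P] by auto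
  have Pi0: "P > 0" using prime_gt_0_nat[OF P(1)] .
  let ?rest = "\<Prod>j\<in>{1..r} - {i}. p j ^ \<alpha> j"
  have n_split: "n = P ^ \<alpha> i * ?rest" unfolding n_eq i(2) using i(1) by (simp add: prod.remove)
  have P_rest: "\<not> P dvd ?rest"
  proof
    assume "P dvd ?rest"
    then obtain j where j: "j \<in> {1..r} - {i}" "P dvd p j ^ \<alpha> j"
      using P(1) prime_dvd_prod_iff[of "{1..r} - {i}" P "\<lambda>j. p j ^ \<alpha> j"] by blast
    then have "P dvd p j" using P(1) prime_dvd_power by blast
    then have "p i = p j" using P(1) i(2) prime_p[of j] j(1) primes_dvd_imp_eq by blast
    then show False using p_eq_iff i(1) j(1) by blast
  qed
  have ai: "\<alpha> i = 2"
  proof -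
    have "\<not> \<alpha> i \<ge> 3"
    proof
      assume "\<alpha> i \<ge> 3"
      then have "P ^ 3 dvd n" unfolding n_split by (simp add: le_imp_power_dvd)
      then have "P\<^sup>2 * P dvd P\<^sup>2 * N" using P(2) by (simp add: power3_eq_cube power2_eq_square)
      then show False using P(4) Pi0 by simp
    qed
    moreover have "\<alpha> i \<noteq> 1"
    proof
      assume "\<alpha> i = 1"
      then have "P * ?rest = n" using n_split by (simp only: power_one_right)
      also have "n = P * (P * N)" using P(2) by (simp add: power2_eq_square)
      finally have "?rest = P * N" using Pi0 by (metis mult_left_cancel neq0_conv)
      then show False using P_rest by simp
    qed
    ultimately show ?thesis using exponent_pos[OF i(1)] by linarith
  qed
  have N_rest: "N = ?rest" using n_split P(2) ai Pi0 by simp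
  have aj: "\<alpha> j = 1" if j: "j \<in> {1..r} - {i}" for j
  proof (rule ccontr)
    assume "\<alpha> j \<noteq> 1"
    then have "\<alpha> j \<ge> 2" using exponent_pos[of j] j by force
    then have "p j ^ 2 dvd p j ^ \<alpha> j" by (rule le_imp_power_dvd)
    also have "\<dots> dvd N" unfolding N_rest using j by (intro dvd_prodI) auto
    finally have "p j dvd 1" using squarefreeD[OF P(3)] by blast
    then show False using prime_p[of j] j by simp
  qed
  have N_prod: "N = (\<Prod>j\<in>{1..r} - {i}. p j)" unfolding N_rest using aj by (intro prod.cong) auto
  \<comment> \<open>Only the squared prime has a prescribed place, so swapping its index with 1 is
    enough of a relabelling.\<close>
  define \<sigma> where "\<sigma> = Transposition.transpose 1 i"
  have one: "1 \<in> {1..r}" using i(1) by simp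
  have bij: "bij_betw \<sigma> {1..r} {1..r}"
    unfolding \<sigma>_def using one i(1) by simp
  have s1: "\<sigma> 1 = i" unfolding \<sigma>_def by simp
  have "{2..r} = {1..r} - {1}" by auto
  then have "bij_betw \<sigma> {2..r} ({1..r} - {i})"
    using bij_betw_DiffI[OF bij, of "{1}" "{i}"] s1 one i(1) by (simp add: bij_betw_def)
  then have "(\<Prod>k=2..r. p (\<sigma> k)) = N" unfolding N_prod by (rule prod.reindex_bij_betw)
  then show ?thesis using that[OF bij] s1 i one by simp
qed

lemma permutation_square_type:
  assumes bij: "bij_betw \<sigma> {1..r} {1..r}" and r: "r \<ge> 1" and n: "n = p (\<sigma> 1) ^ 2 * (\<Prod>k=2..r. p (\<sigma> k))"
  shows "square_type n (p (\<sigma> 1)) (\<Prod>k=2..r. p (\<sigma> k))"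
    "Factorial_Ring.prime l \<and> l dvd (\<Prod>k=2..r. p (\<sigma> k)) \<longleftrightarrow> (\<exists>k\<in>{2..r}. l = p (\<sigma> k))"
proof -
  have s: "\<sigma> k \<in> {1..r}" if "k \<in> {1..r}" for k using that bij bij_betwE by blast
  have pr: "Factorial_Ring.prime (p (\<sigma> k))" if "k \<in> {1..r}" for k using prime_p[OF s[OF that]] .
  have ne: "p (\<sigma> j) \<noteq> p (\<sigma> k)" if "j \<in> {1..r}" "k \<in> {1..r}" "j \<noteq> k" for j k
    using p_eq_iff[OF s s] that bij by (auto simp: bij_betw_def dest: inj_onD)
  have sub: "k \<in> {1..r}" if "k \<in> {2..r}" for k using that by auto
  have dvd: "Factorial_Ring.prime l \<and> l dvd (\<Prod>k=2..r. p (\<sigma> k)) \<longleftrightarrow> (\<exists>k\<in>{2..r}. l = p (\<sigma> k))" for l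
  proof
    assume l: "Factorial_Ring.prime l \<and> l dvd (\<Prod>k=2..r. p (\<sigma> k))"
    then obtain k where k: "k \<in> {2..r}" "l dvd p (\<sigma> k)"
      using prime_dvd_prod_iff[of "{2..r}" l "\<lambda>k. p (\<sigma> k)"] by blast
    then have "l = p (\<sigma> k)" using l pr[OF sub[OF k(1)]] primes_dvd_imp_eq by blast
    then show "\<exists>k\<in>{2..r}. l = p (\<sigma> k)" using k(1) by blast
  next
    assume "\<exists>k\<in>{2..r}. l = p (\<sigma> k)"
    then obtain k where k: "k \<in> {2..r}" "l = p (\<sigma> k)" by blast
    then show "Factorial_Ring.prime l \<and> l dvd (\<Prod>k=2..r. p (\<sigma> k))"
      using pr[OF sub[OF k(1)]] dvd_prodI[of "{2..r}" k "\<lambda>k. p (\<sigma> k)"] by simp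
  qed
  then show "Factorial_Ring.prime l \<and> l dvd (\<Prod>k=2..r. p (\<sigma> k)) \<longleftrightarrow> (\<exists>k\<in>{2..r}. l = p (\<sigma> k))" .
  have "squarefree (\<Prod>k=2..r. p (\<sigma> k))"
  proof (rule squarefree_prod_coprime)
    show "coprime (p (\<sigma> a)) (p (\<sigma> b))" if "a \<in> {2..r}" "b \<in> {2..r}" "a \<noteq> b" for a b
      using primes_coprime[OF pr pr ne] sub that by blast
    show "squarefree (p (\<sigma> a))" if "a \<in> {2..r}" for a using squarefree_prime[OF pr] sub that by blast
  qed
  moreover have one: "1 \<in> {1..r}" using r by simp
  then have "\<not> p (\<sigma> 1) dvd (\<Prod>k=2..r. p (\<sigma> k))"
    using dvd[of "p (\<sigma> 1)"] pr[OF one] ne[OF one sub] by force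
  ultimately show "square_type n (p (\<sigma> 1)) (\<Prod>k=2..r. p (\<sigma> k))"
    unfolding square_type_def using n pr[OF one] by blast
qed

lemma no_edge_iff:
  assumes bij: "bij_betw \<sigma> {1..r} {1..r}"
  shows "(\<forall>i\<in>{1..r}. \<forall>j\<in>{1..r}. \<not> p (\<sigma> i) dvd p (\<sigma> j) - 1) \<longleftrightarrow> (\<forall>u t. \<not> prime_edge n u t)"
proof -
  have im: "\<sigma> ` {1..r} = {1..r}" using bij by (simp add: bij_betw_def)
  have "(\<forall>i\<in>{1..r}. \<forall>j\<in>{1..r}. \<not> p (\<sigma> i) dvd p (\<sigma> j) - 1) \<longleftrightarrow>
    (\<forall>i\<in>\<sigma> ` {1..r}. \<forall>j\<in>\<sigma> ` {1..r}. \<not> p i dvd p j - 1)" by simp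
  also have "\<dots> \<longleftrightarrow> (\<forall>i\<in>{1..r}. \<forall>j\<in>{1..r}. \<not> p i dvd p j - 1)" unfolding im ..
  finally have "(\<forall>i\<in>{1..r}. \<forall>j\<in>{1..r}. \<not> p (\<sigma> i) dvd p (\<sigma> j) - 1) \<longleftrightarrow>
    (\<forall>i\<in>{1..r}. \<forall>j\<in>{1..r}. \<not> p i dvd p j - 1)" .
  then show ?thesis unfolding prime_edge_iff by blast
qed

text \<open>Squares of primes belong to this case with \<open>N = 1\<close>, where the condition on
  the divisors of \<open>N\<close> is empty; the left-hand side lists them apart as
  \<open>r = 1\<close>.\<close>

lemma square_no_divisor_iff:
  "(r = 1 \<and> \<alpha> 1 = 2 \<or> r \<ge> 2 \<and>
     (\<exists>\<sigma>. bij_betw \<sigma> {1..r} {1..r} \<and> n = p (\<sigma> 1) ^ 2 * (\<Prod>k=2..r. p (\<sigma> k)) \<and>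
        (\<forall>i\<in>{1..r}. \<forall>j\<in>{1..r}. \<not> p (\<sigma> i) dvd p (\<sigma> j) - 1) \<and>
        (\<forall>k\<in>{2..r}. \<not> p (\<sigma> k) dvd p (\<sigma> 1) ^ 2 - 1))) \<longleftrightarrow>
   (\<exists>P N. square_type n P N \<and> (\<forall>u t. \<not> prime_edge n u t) \<and>
      (\<forall>l. Factorial_Ring.prime l \<longrightarrow> l dvd N \<longrightarrow> \<not> l dvd P\<^sup>2 - 1))" (is "?L \<longleftrightarrow> ?R")
proof
  assume ?L
  then show ?R
  proof
    assume r1: "r = 1 \<and> \<alpha> 1 = 2"
    then have "n = (p 1)\<^sup>2" "Factorial_Ring.prime (p 1)" using n_eq prime_p[of 1] by auto
    then have "square_type n (p 1) 1" unfolding square_type_def using not_prime_unit by auto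
    moreover have "\<not> prime_edge n u t" for u t
      using r1 prime_edge_less[of n u t] unfolding prime_edge_iff by auto
    ultimately show ?R by (intro exI[of _ "p 1"] exI[of _ 1]) auto
  next
    assume "r \<ge> 2 \<and>
     (\<exists>\<sigma>. bij_betw \<sigma> {1..r} {1..r} \<and> n = p (\<sigma> 1) ^ 2 * (\<Prod>k=2..r. p (\<sigma> k)) \<and>
        (\<forall>i\<in>{1..r}. \<forall>j\<in>{1..r}. \<not> p (\<sigma> i) dvd p (\<sigma> j) - 1) \<and>
        (\<forall>k\<in>{2..r}. \<not> p (\<sigma> k) dvd p (\<sigma> 1) ^ 2 - 1))"
    then obtain \<sigma> where \<sigma>: "r \<ge> 1" "bij_betw \<sigma> {1..r} {1..r}" "n = p (\<sigma> 1) ^ 2 * (\<Prod>k=2..r. p (\<sigma> k))"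
      "\<forall>i\<in>{1..r}. \<forall>j\<in>{1..r}. \<not> p (\<sigma> i) dvd p (\<sigma> j) - 1" "\<forall>k\<in>{2..r}. \<not> p (\<sigma> k) dvd p (\<sigma> 1) ^ 2 - 1"
      by auto
    then show ?R
      using permutation_square_type[OF \<sigma>(2,1,3)] no_edge_iff[OF \<sigma>(2)] by metis
  qed
next
  assume ?R
  then obtain P N where PN: "square_type n P N" "\<forall>u t. \<not> prime_edge n u t"
    "\<And>l. Factorial_Ring.prime l \<Longrightarrow> l dvd N \<Longrightarrow> \<not> l dvd P\<^sup>2 - 1" by blast
  obtain \<sigma> where \<sigma>: "bij_betw \<sigma> {1..r} {1..r}" "r \<ge> 1" "p (\<sigma> 1) = P" "N = (\<Prod>k=2..r. p (\<sigma> k))"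
    by (rule square_type_permutation[OF PN(1)])
  have n: "n = p (\<sigma> 1) ^ 2 * (\<Prod>k=2..r. p (\<sigma> k))" using PN(1) \<sigma> unfolding square_type_def by simp
  show ?L
  proof (cases "r = 1")
    case True
    then have "\<sigma> 1 = 1" using \<sigma>(1) by (auto simp: bij_betw_def)
    then have "p 1 ^ \<alpha> 1 = p 1 ^ 2" using n n_eq True by simp
    then have "\<alpha> 1 = 2" using prime_gt_1_nat[OF prime_p[of 1]] True power_inject_exp[of "p 1" "\<alpha> 1" 2] by simp
    then show ?thesis using True by blast
  next
    case False
    moreover have "\<not> p (\<sigma> k) dvd p (\<sigma> 1) ^ 2 - 1" if "k \<in> {2..r}" for k
      using PN(3)[of "p (\<sigma> k)"] permutation_square_type(2)[OF \<sigma>(1,2) n, of "p (\<sigma> k)"] that \<sigma>(3,4) by blast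
    ultimately show ?thesis using \<sigma>(1,2) n no_edge_iff[OF \<sigma>(1)] PN(2) by (intro disjI2 conjI exI[of _ \<sigma>]) auto
  qed
qed

text \<open>Prime divisors of \<open>N\<close> correspond one to one to the indices from 2 to
  \<open>r\<close>, so unique existence carries over; the existence of such an index gives
  \<open>r \<ge> 2\<close>.\<close>

lemma square_one_divisor_iff:
  "(r \<ge> 2 \<and>
     (\<exists>\<sigma>. bij_betw \<sigma> {1..r} {1..r} \<and> n = p (\<sigma> 1) ^ 2 * (\<Prod>k=2..r. p (\<sigma> k)) \<and>
        (\<forall>i\<in>{1..r}. \<forall>j\<in>{1..r}. \<not> p (\<sigma> i) dvd p (\<sigma> j) - 1) \<and>
        (\<exists>!l. l \<in> {2..r} \<and> p (\<sigma> l) dvd p (\<sigma> 1) ^ 2 - 1))) \<longleftrightarrow>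
   (\<exists>P N. square_type n P N \<and> (\<forall>u t. \<not> prime_edge n u t) \<and>
      (\<exists>!l. Factorial_Ring.prime l \<and> l dvd N \<and> l dvd P\<^sup>2 - 1))" (is "?L \<longleftrightarrow> ?R")
proof -
  have ex1: "(\<exists>!l. l \<in> {2..r} \<and> p (\<sigma> l) dvd p (\<sigma> 1) ^ 2 - 1) \<longleftrightarrow>
      (\<exists>!l. Factorial_Ring.prime l \<and> l dvd (\<Prod>k=2..r. p (\<sigma> k)) \<and> l dvd (p (\<sigma> 1))\<^sup>2 - 1)"
    if \<sigma>: "bij_betw \<sigma> {1..r} {1..r}" "r \<ge> 1" "n = p (\<sigma> 1) ^ 2 * (\<Prod>k=2..r. p (\<sigma> k))" for \<sigma>
  proof -
    have inj: "p (\<sigma> j) = p (\<sigma> k) \<longleftrightarrow> j = k" if "j \<in> {2..r}" "k \<in> {2..r}" for j k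
    proof -
      have "j \<in> {1..r}" "k \<in> {1..r}" using that by auto
      then show ?thesis using p_eq_iff[of "\<sigma> j" "\<sigma> k"] \<sigma>(1) by (metis bij_betwE bij_betw_imp_inj_on inj_on_eq_iff)
    qed
    have "(\<exists>!l. Factorial_Ring.prime l \<and> l dvd (\<Prod>k=2..r. p (\<sigma> k)) \<and> l dvd (p (\<sigma> 1))\<^sup>2 - 1) \<longleftrightarrow>
      (\<exists>!l. (\<exists>k\<in>{2..r}. l = p (\<sigma> k)) \<and> l dvd (p (\<sigma> 1))\<^sup>2 - 1)"
    proof -
      have "Factorial_Ring.prime l \<and> l dvd (\<Prod>k=2..r. p (\<sigma> k)) \<and> l dvd (p (\<sigma> 1))\<^sup>2 - 1 \<longleftrightarrow>
          (\<exists>k\<in>{2..r}. l = p (\<sigma> k)) \<and> l dvd (p (\<sigma> 1))\<^sup>2 - 1" for l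
        using permutation_square_type(2)[OF \<sigma>, of l] by blast
      then show ?thesis by (simp only:)
    qed
    also have "\<dots> \<longleftrightarrow> (\<exists>!l. l \<in> {2..r} \<and> p (\<sigma> l) dvd p (\<sigma> 1) ^ 2 - 1)"
    proof
      assume "\<exists>!l. (\<exists>k\<in>{2..r}. l = p (\<sigma> k)) \<and> l dvd (p (\<sigma> 1))\<^sup>2 - 1"
      then obtain k where k: "k \<in> {2..r}" "p (\<sigma> k) dvd (p (\<sigma> 1))\<^sup>2 - 1"
        "\<And>j. j \<in> {2..r} \<Longrightarrow> p (\<sigma> j) dvd (p (\<sigma> 1))\<^sup>2 - 1 \<Longrightarrow> p (\<sigma> j) = p (\<sigma> k)" by blast
      show "\<exists>!l. l \<in> {2..r} \<and> p (\<sigma> l) dvd p (\<sigma> 1) ^ 2 - 1"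
      proof (rule ex1I[of _ k])
        show "k \<in> {2..r} \<and> p (\<sigma> k) dvd p (\<sigma> 1) ^ 2 - 1" using k(1,2) by blast
        fix j assume j: "j \<in> {2..r} \<and> p (\<sigma> j) dvd p (\<sigma> 1) ^ 2 - 1"
        then have "p (\<sigma> j) = p (\<sigma> k)" using k(3) by blast
        then show "j = k" using inj j k(1) by blast
      qed
    next
      assume "\<exists>!l. l \<in> {2..r} \<and> p (\<sigma> l) dvd p (\<sigma> 1) ^ 2 - 1"
      then show "\<exists>!l. (\<exists>k\<in>{2..r}. l = p (\<sigma> k)) \<and> l dvd (p (\<sigma> 1))\<^sup>2 - 1" by blast
    qed
    finally show ?thesis by blast
  qed
  show ?thesis
  proof
    assume ?L
    then obtain \<sigma> where "r \<ge> 2" and \<sigma>: "bij_betw \<sigma> {1..r} {1..r}" "n = p (\<sigma> 1) ^ 2 * (\<Prod>k=2..r. p (\<sigma> k))"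
      "\<forall>i\<in>{1..r}. \<forall>j\<in>{1..r}. \<not> p (\<sigma> i) dvd p (\<sigma> j) - 1" "\<exists>!l. l \<in> {2..r} \<and> p (\<sigma> l) dvd p (\<sigma> 1) ^ 2 - 1"
      by (elim conjE exE)
    have r1: "r \<ge> 1" using \<open>r \<ge> 2\<close> by simp
    show ?R
    proof (intro exI conjI)
      show "square_type n (p (\<sigma> 1)) (\<Prod>k=2..r. p (\<sigma> k))"
        by (rule permutation_square_type(1)[OF \<sigma>(1) r1 \<sigma>(2)])
      show "\<forall>u t. \<not> prime_edge n u t" using \<sigma>(3) unfolding no_edge_iff[OF \<sigma>(1)] .
      show "\<exists>!l. Factorial_Ring.prime l \<and> l dvd (\<Prod>k=2..r. p (\<sigma> k)) \<and> l dvd (p (\<sigma> 1))\<^sup>2 - 1"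
        using \<sigma>(4) unfolding ex1[OF \<sigma>(1) r1 \<sigma>(2)] .
    qed
  next
    assume ?R
    then obtain P N where PN: "square_type n P N" "\<forall>u t. \<not> prime_edge n u t"
      "\<exists>!l. Factorial_Ring.prime l \<and> l dvd N \<and> l dvd P\<^sup>2 - 1" by blast
    obtain \<sigma> where \<sigma>: "bij_betw \<sigma> {1..r} {1..r}" "r \<ge> 1" "p (\<sigma> 1) = P" "N = (\<Prod>k=2..r. p (\<sigma> k))"
      by (rule square_type_permutation[OF PN(1)])
    have n: "n = p (\<sigma> 1) ^ 2 * (\<Prod>k=2..r. p (\<sigma> k))" using PN(1) \<sigma> unfolding square_type_def by simp
    have e: "\<exists>!l. l \<in> {2..r} \<and> p (\<sigma> l) dvd p (\<sigma> 1) ^ 2 - 1" using ex1[OF \<sigma>(1,2) n] PN(3) \<sigma>(3,4) by simp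
    then have "r \<ge> 2" by auto
    then show ?L using \<sigma>(1) n no_edge_iff[OF \<sigma>(1)] PN(2) e by blast
  qed
qed

end

text \<open>\<open>\<sigma>\<close> is the relabelling, with the squared prime at 1. Uniqueness of
  the triple is taken to include that no other divisibility holds among the primes: for
  \<open>n = 42\<close> the only chain is 2, 3, 7, but 2 also divides 7 - 1, and the common target 7
  rules out three groups.\<close>

theorem theorem1p4:
  fixes n r :: nat and p \<alpha> :: "nat \<Rightarrow> nat"
  assumes "n > 0"
    and "\<And>i. i \<in> {1..r} \<Longrightarrow> Factorial_Ring.prime (p i)"
    and "inj_on p {1..r}"
    and "\<And>i. i \<in> {1..r} \<Longrightarrow> \<alpha> i \<ge> 1"
    and "n = (\<Prod>i=1..r. p i ^ \<alpha> i)"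
  shows
    "(num_groups n = 2 \<longleftrightarrow>
        (r = 1 \<and> \<alpha> 1 = 2)
      \<or> (r \<ge> 2 \<and> squarefree n \<and>
         (\<exists>!(i, j) \<in> {1..r} \<times> {1..r}. p i dvd p j - 1))
      \<or> (r \<ge> 2 \<and>
         (\<exists>\<sigma>. bij_betw \<sigma> {1..r} {1..r} \<and>
            n = p (\<sigma> 1) ^ 2 * (\<Prod>k=2..r. p (\<sigma> k)) \<and>
            (\<forall>i\<in>{1..r}. \<forall>j\<in>{1..r}. \<not> p (\<sigma> i) dvd p (\<sigma> j) - 1) \<and>
            (\<forall>k\<in>{2..r}. \<not> p (\<sigma> k) dvd p (\<sigma> 1) ^ 2 - 1))))
   \<and> (num_groups n = 3 \<longleftrightarrow>
        (r \<ge> 3 \<and> squarefree n \<and>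
         (\<exists>!(i, j, l) \<in> {1..r} \<times> {1..r} \<times> {1..r}.
            p i dvd p j - 1 \<and> p j dvd p l - 1 \<and>
            (\<forall>a\<in>{1..r}. \<forall>b\<in>{1..r}. p a dvd p b - 1 \<longrightarrow> (a, b) \<in> {(i, j), (j, l)})))
      \<or> (r \<ge> 2 \<and>
         (\<exists>\<sigma>. bij_betw \<sigma> {1..r} {1..r} \<and>
            n = p (\<sigma> 1) ^ 2 * (\<Prod>k=2..r. p (\<sigma> k)) \<and>
            (\<forall>i\<in>{1..r}. \<forall>j\<in>{1..r}. \<not> p (\<sigma> i) dvd p (\<sigma> j) - 1) \<and>
            (\<exists>!l. l \<in> {2..r} \<and> p (\<sigma> l) dvd p (\<sigma> 1) ^ 2 - 1))))"
proof -
  interpret prime_factorization_data n r p \<alpha>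
    using assms by unfold_locales
  \<comment> \<open>The orders \<open>p\<^sup>2\<close> and \<open>p\<^sup>2 N\<close> have been
    treated as one case; these propositional rules regroup the disjuncts accordingly.\<close>
  have two: "A \<longleftrightarrow> B \<or> (R \<and> S \<and> E) \<or> C" if "A \<longleftrightarrow> S \<and> (R \<and> E) \<or> (B \<or> C)" for A B C E R S :: bool
    using that by blast
  have three: "A \<longleftrightarrow> (R \<and> S \<and> E) \<or> C" if "A \<longleftrightarrow> S \<and> (R \<and> E) \<or> C" for A C E R S :: bool
    using that by blast
  show ?thesis
    by (rule conjI)
      (rule two[OF num_groups_eq_2_iff[OF assms(1), folded one_edge_iff square_no_divisor_iff]]
        three[OF num_groups_eq_3_iff[OF assms(1), folded path_iff square_one_divisor_iff]])+
qed

end
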